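(* Let $(W,S)$ be a finite Coxeter system with identity $e$, length function $\ell$ and Bruhat order $\le$, and let $w\in W$. Define the Bruhat–Poincar\'e polynomial $\overrightarrow{P}_w(q)=\sum_{v\le w}R_{ev}(q+1)$ and its average $\mathrm{av}(\overrightarrow{P}_w)=\overrightarrow{P}_w{}'(1)/\overrightarrow{P}_w(1)$. If $\mathrm{av}(\overrightarrow{P}_w)\ne \ell(w)/2$, then the lower interval $[e,w]$ is irregular.
   Context: The $R$-polynomials $R_{uw}(q)\in\mathbb{Z}[q]$ are the unique family with $R_{uw}=0$ if $u\not\le w$, $R_{uu}=1$, and, for $s\in S$ with $\ell(ws)<\ell(w)$: $R_{uw}=R_{us,ws}$ if $\ell(us)<\ell(u)$, $R_{uw}=(q-1)R_{u,ws}+qR_{us,ws}$ if $\ell(us)>\ell(u)$. The Bruhat graph of $W$ has an edge between $x$ and $y$ whenever $y=xt$ for a reflection $t$; $[e,w]$ is called regular if the (undirected) Bruhat graph induced on the vertex set $[e,w]=\{v: e\le v\le w\}$ is a regular graph (every vertex has degree $\ell(w)$), and irregular otherwise. *)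

theory Defs
  imports
    "HOL-Algebra.Multiplicative_Group"
    "HOL-Computational_Algebra.Polynomial"
begin

section \<open>Coxeter systems\<close>

definition word_prod :: "('a, 'b) monoid_scheme \<Rightarrow> 'a list \<Rightarrow> 'a" where
  "word_prod W xs = foldr (\<lambda>x y. x \<otimes>\<^bsub>W\<^esub> y) xs \<one>\<^bsub>W\<^esub>"

text \<open>
  The congruence on words over \<open>S\<close> generated by the relations \<open>(s t)^m(s,t) = 1\<close>, where
  \<open>m(s,t)\<close> is the order of \<open>s t\<close> in \<open>W\<close>. The case \<open>s = t\<close> gives \<open>s s = 1\<close>, so formal
  inverses of letters are not needed. If \<open>s t\<close> has infinite order then
  \<open>group.ord\<close> is \<open>0\<close> and the relator is the empty word.
\<close>

inductive coxeter_cong :: "('a, 'b) monoid_scheme \<Rightarrow> 'a set \<Rightarrow> 'a list \<Rightarrow> 'a list \<Rightarrow> bool"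
  for W S where
  relator: "\<lbrakk>s \<in> S; t \<in> S; us \<in> lists S; vs \<in> lists S\<rbrakk> \<Longrightarrow>
     coxeter_cong W S
       (us @ concat (replicate (group.ord W (s \<otimes>\<^bsub>W\<^esub> t)) [s, t]) @ vs) (us @ vs)"
| refl: "us \<in> lists S \<Longrightarrow> coxeter_cong W S us us"
| sym: "coxeter_cong W S us vs \<Longrightarrow> coxeter_cong W S vs us"
| trans: "\<lbrakk>coxeter_cong W S us vs; coxeter_cong W S vs ws\<rbrakk> \<Longrightarrow> coxeter_cong W S us ws"

text \<open>
  \<open>W\<close> is generated by the set \<open>S\<close> of involutions and is presented by the relations above.
\<close>

locale coxeter_system = group W for W (structure) +
  fixes S :: "'a set"
  assumes gens_subset: "S \<subseteq> carrier W"
    and gens_involution: "s \<in> S \<Longrightarrow> s \<noteq> \<one> \<and> s \<otimes> s = \<one>"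
    and gens_generate: "generate W S = carrier W"
    and presentation: "\<lbrakk>us \<in> lists S; vs \<in> lists S; word_prod W us = word_prod W vs\<rbrakk> \<Longrightarrow>
      coxeter_cong W S us vs"

definition cox_length :: "('a, 'b) monoid_scheme \<Rightarrow> 'a set \<Rightarrow> 'a \<Rightarrow> nat" where
  "cox_length W S w = (LEAST n. \<exists>xs \<in> lists S. length xs = n \<and> word_prod W xs = w)"

definition reflections :: "('a, 'b) monoid_scheme \<Rightarrow> 'a set \<Rightarrow> 'a set" where
  "reflections W S = {x \<otimes>\<^bsub>W\<^esub> s \<otimes>\<^bsub>W\<^esub> inv\<^bsub>W\<^esub> x | x s. x \<in> carrier W \<and> s \<in> S}"

definition bruhat_step :: "('a, 'b) monoid_scheme \<Rightarrow> 'a set \<Rightarrow> 'a \<Rightarrow> 'a \<Rightarrow> bool" where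
  "bruhat_step W S x y \<longleftrightarrow> x \<in> carrier W \<and> y \<in> carrier W \<and>
     (\<exists>t \<in> reflections W S. y = x \<otimes>\<^bsub>W\<^esub> t) \<and> cox_length W S x < cox_length W S y"

definition bruhat_le :: "('a, 'b) monoid_scheme \<Rightarrow> 'a set \<Rightarrow> 'a \<Rightarrow> 'a \<Rightarrow> bool" where
  "bruhat_le W S x y \<longleftrightarrow> x \<in> carrier W \<and> y \<in> carrier W \<and> (bruhat_step W S)\<^sup>*\<^sup>* x y"

definition bruhat_interval :: "('a, 'b) monoid_scheme \<Rightarrow> 'a set \<Rightarrow> 'a \<Rightarrow> 'a \<Rightarrow> 'a set" where
  "bruhat_interval W S x y = {v. bruhat_le W S x v \<and> bruhat_le W S v y}"


section \<open>The \<open>R\<close>-polynomials and the Bruhat--Poincare polynomial\<close>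

definition is_R_family ::
  "('a, 'b) monoid_scheme \<Rightarrow> 'a set \<Rightarrow> ('a \<Rightarrow> 'a \<Rightarrow> int poly) \<Rightarrow> bool" where
  "is_R_family W S R \<longleftrightarrow>
     (\<forall>u w. \<not> bruhat_le W S u w \<longrightarrow> R u w = 0) \<and>
     (\<forall>u \<in> carrier W. R u u = 1) \<and>
     (\<forall>u \<in> carrier W. \<forall>w \<in> carrier W. \<forall>s \<in> S.
        cox_length W S (w \<otimes>\<^bsub>W\<^esub> s) < cox_length W S w \<longrightarrow>
          (cox_length W S (u \<otimes>\<^bsub>W\<^esub> s) < cox_length W S u \<longrightarrow>
             R u w = R (u \<otimes>\<^bsub>W\<^esub> s) (w \<otimes>\<^bsub>W\<^esub> s)) \<and>
          (cox_length W S (u \<otimes>\<^bsub>W\<^esub> s) > cox_length W S u \<longrightarrow>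
             R u w = ([:0, 1:] - 1) * R u (w \<otimes>\<^bsub>W\<^esub> s)
                     + [:0, 1:] * R (u \<otimes>\<^bsub>W\<^esub> s) (w \<otimes>\<^bsub>W\<^esub> s)))"

text \<open>
  Since \<open>bruhat_le\<close> only relates elements of the carrier, the first clause also fixes the
  values outside the carrier, so that the family is unique as a total function.
\<close>

definition R_poly :: "('a, 'b) monoid_scheme \<Rightarrow> 'a set \<Rightarrow> 'a \<Rightarrow> 'a \<Rightarrow> int poly" where
  "R_poly W S = (THE R. is_R_family W S R)"

definition bruhat_poincare :: "('a, 'b) monoid_scheme \<Rightarrow> 'a set \<Rightarrow> 'a \<Rightarrow> int poly" where
  "bruhat_poincare W S w = (\<Sum>v | bruhat_le W S v w. pcompose (R_poly W S \<one>\<^bsub>W\<^esub> v) [:1, 1:])"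

definition poly_average :: "int poly \<Rightarrow> real" where
  "poly_average p = of_int (poly (pderiv p) 1) / of_int (poly p 1)"


section \<open>The Bruhat graph\<close>

definition bruhat_graph_edges :: "('a, 'b) monoid_scheme \<Rightarrow> 'a set \<Rightarrow> 'a set set" where
  "bruhat_graph_edges W S =
     {{x, y} | x y. x \<in> carrier W \<and> y \<in> carrier W \<and> (\<exists>t \<in> reflections W S. y = x \<otimes>\<^bsub>W\<^esub> t)}"

definition induced_edges :: "'a set set \<Rightarrow> 'a set \<Rightarrow> 'a set set" where
  "induced_edges E V = {e \<in> E. e \<subseteq> V}"

definition graph_degree :: "'a set set \<Rightarrow> 'a \<Rightarrow> nat" where
  "graph_degree E v = card {e \<in> E. v \<in> e}"

definition regular_graph :: "'a set \<Rightarrow> 'a set set \<Rightarrow> bool" where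
  "regular_graph V E \<longleftrightarrow> (\<exists>d. \<forall>v \<in> V. graph_degree E v = d)"

text \<open>
  In the graph induced on \<open>[e,w]\<close> the vertex \<open>w\<close> has degree \<open>\<ell>(w)\<close>, since exactly \<open>\<ell>(w)\<close>
  reflections \<open>t\<close> satisfy \<open>\<ell>(w t) < \<ell>(w)\<close>. Hence a common degree is necessarily \<open>\<ell>(w)\<close>.
\<close>

definition regular_lower_interval :: "('a, 'b) monoid_scheme \<Rightarrow> 'a set \<Rightarrow> 'a \<Rightarrow> bool" where
  "regular_lower_interval W S w \<longleftrightarrow>
     (let V = bruhat_interval W S \<one>\<^bsub>W\<^esub> w
      in regular_graph V (induced_edges (bruhat_graph_edges W S) V))"

abbreviation irregular_lower_interval :: "('a, 'b) monoid_scheme \<Rightarrow> 'a set \<Rightarrow> 'a \<Rightarrow> bool" where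
  "irregular_lower_interval W S w \<equiv> \<not> regular_lower_interval W S w"

end

theory Submission
  imports Defs
begin

text \<open>
  Let \<open>X\<close> be the set of all \<open>v \<le> w\<close> and \<open>N(g)\<close> the set of left inversions of \<open>g\<close>. If the Bruhat graph
  on \<open>X\<close> is regular, then in the Hecke algebra the sum of all \<open>T_v\<close> with \<open>v \<in> X\<close>, multiplied by \<open>T_g\<close>,
  is the sum of \<open>q^h(g,v) T_(v g)\<close> over \<open>v \<in> X\<close>, where \<open>h(g,v)\<close> counts the \<open>r \<in> N(g)\<close> with \<open>v r \<in> X\<close>.
  For \<open>g\<close> the longest element \<open>w0\<close> the exponent is the degree \<open>\<ell>(w)\<close> of \<open>v\<close>, and since the coefficient of
  \<open>T_w0\<close> in \<open>T_v T_w0\<close> is \<open>R_(e,v)\<close>, the sum of all \<open>R_(e,v)\<close> with \<open>v \<le> w\<close> is \<open>q^\<ell>(w)\<close>. The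
  Bruhat--Poincare polynomial is then \<open>(q + 1)^\<ell>(w)\<close>, of average \<open>\<ell>(w)/2\<close>.

  The induction on \<open>g\<close> needs \<open>h(g,v) = h(g,vt)\<close> whenever \<open>t = g s g^-1\<close> with \<open>g s > g\<close> and \<open>v, vt \<in> X\<close>.
  This is a statement about cosets of dihedral reflection subgroups: it holds if \<open>X\<close> meets every such
  coset either in one element or in a set that has as many even as odd elements. In a coset violating
  this, \<open>X\<close> consists of all elements up to some length \<open>K\<close>. Take such a coset whose
  elements of maximal length in \<open>X\<close> are as long as possible, and an edge \<open>v < vt\<close> ending in
  one of them. Sum over all cosets through this edge: the degrees of \<open>v\<close> and \<open>vt\<close> agree, so
  another coset must violate the condition with longer maximal elements, a contradiction.
\<close>

section \<open>Words and inversions\<close>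

text \<open>Multiplication by a generator produces \<open>q^h + (q - 1) q^h'\<close>, which is a
  single power of \<open>q\<close> exactly when the two exponents agree; this is why equal exponents
  along an edge are required. The obstacle is that regularity speaks of total degrees, whereas the
  exponents count only reflections in an inversion set. The bridge: each reflection other than
  \<open>t\<close> lies in exactly one rank two flat through \<open>t\<close>, so the degree
  difference of \<open>v\<close> and \<open>vt\<close> splits into contributions of flats. Each
  contribution is, up to sign, the number of even minus the number of odd elements of
  \<open>X\<close> in a coset, hence \<open>0\<close> in a balanced coset and \<open>1\<close> or
  \<open>-1\<close> in a violating one. If all contributions are nonnegative and one is
  \<open>1\<close>, the degrees differ; the extremal choice of the edge serves to exclude
  \<open>-1\<close>. Hyperplanes and their crossing are expressed throughout by the parity cocycle
  \<open>inversions\<close>. As the R-polynomials are given by a definite description, their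
  existence has to be proved too, and the same Hecke algebra computation with the longest element
  supplies it.\<close>

fun refl_list :: "('a, 'b) monoid_scheme \<Rightarrow> 'a list \<Rightarrow> 'a list" where
  "refl_list W [] = []"
| "refl_list W (s # xs) = s # map (\<lambda>r. s \<otimes>\<^bsub>W\<^esub> r \<otimes>\<^bsub>W\<^esub> inv\<^bsub>W\<^esub> s) (refl_list W xs)"

lemma count_list_distinct: "distinct xs \<Longrightarrow> count_list xs t = (if t \<in> set xs then 1 else 0)"
  by (induction xs) auto

context coxeter_system
begin

abbreviation len :: "'a \<Rightarrow> nat" where "len \<equiv> cox_length W S"
abbreviation refl :: "'a set" where "refl \<equiv> reflections W S"
abbreviation wprod :: "'a list \<Rightarrow> 'a" where "wprod \<equiv> word_prod W"
abbreviation rlist :: "'a list \<Rightarrow> 'a list" where "rlist \<equiv> refl_list W"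

section \<open>Conjugation and reflections\<close>

definition conjg :: "'a \<Rightarrow> 'a \<Rightarrow> 'a" where "conjg g r = g \<otimes> r \<otimes> inv g"

lemma rlist_Cons [simp]: "rlist (s # xs) = s # map (conjg s) (rlist xs)"
  by (simp add: conjg_def[abs_def])

declare refl_list.simps(2) [simp del]

lemma S_carrier [simp]: "s \<in> S \<Longrightarrow> s \<in> carrier W"
  using gens_subset by auto

lemma S_sq [simp]: "s \<in> S \<Longrightarrow> s \<otimes> s = \<one>"
  using gens_involution by auto

lemma S_inv [simp]: "s \<in> S \<Longrightarrow> inv s = s"
  by (simp add: inv_equality)

lemma inv_mult_cancel [simp]:
  "\<lbrakk>x \<in> carrier W; y \<in> carrier W\<rbrakk> \<Longrightarrow> inv x \<otimes> (x \<otimes> y) = y"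
  "\<lbrakk>x \<in> carrier W; y \<in> carrier W\<rbrakk> \<Longrightarrow> x \<otimes> (inv x \<otimes> y) = y"
  by (simp_all flip: m_assoc)

lemma S_mult_cancel [simp]: "\<lbrakk>s \<in> S; y \<in> carrier W\<rbrakk> \<Longrightarrow> s \<otimes> (s \<otimes> y) = y"
  by (simp flip: m_assoc)

lemma conjg_closed [simp]: "\<lbrakk>g \<in> carrier W; r \<in> carrier W\<rbrakk> \<Longrightarrow> conjg g r \<in> carrier W"
  by (simp add: conjg_def)

lemma conjg_conjg: "\<lbrakk>g \<in> carrier W; h \<in> carrier W; r \<in> carrier W\<rbrakk> \<Longrightarrow> conjg g (conjg h r) = conjg (g \<otimes> h) r"
  by (simp add: conjg_def inv_mult_group m_assoc)

lemma conjg_one [simp]: "r \<in> carrier W \<Longrightarrow> conjg \<one> r = r"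
  by (simp add: conjg_def)

lemma conjg_inv_conjg [simp]:
  "\<lbrakk>g \<in> carrier W; r \<in> carrier W\<rbrakk> \<Longrightarrow> conjg (inv g) (conjg g r) = r"
  "\<lbrakk>g \<in> carrier W; r \<in> carrier W\<rbrakk> \<Longrightarrow> conjg g (conjg (inv g) r) = r"
  by (simp_all add: conjg_conjg)

lemma conjg_eq_iff: "\<lbrakk>g \<in> carrier W; r \<in> carrier W; t \<in> carrier W\<rbrakk> \<Longrightarrow> conjg g r = t \<longleftrightarrow> r = conjg (inv g) t"
  by auto

lemma conjg_inj: "g \<in> carrier W \<Longrightarrow> inj_on (conjg g) (carrier W)"
  by (metis conjg_inv_conjg(1) inj_onI)

lemma refl_carrier [simp]: "t \<in> refl \<Longrightarrow> t \<in> carrier W"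
  by (auto simp: reflections_def)

lemma refl_conjg: "t \<in> refl \<longleftrightarrow> (\<exists>x\<in>carrier W. \<exists>s\<in>S. t = conjg x s)"
  unfolding reflections_def conjg_def by blast

lemma reflE:
  assumes "t \<in> refl"
  obtains x s where "x \<in> carrier W" "s \<in> S" "t = conjg x s"
  using assms unfolding refl_conjg by blast

lemma S_refl [simp]: "s \<in> S \<Longrightarrow> s \<in> refl"
  unfolding refl_conjg by (rule bexI[of _ \<one>], rule bexI[of _ s]) auto

lemma conjg_refl [simp]: "\<lbrakk>g \<in> carrier W; t \<in> refl\<rbrakk> \<Longrightarrow> conjg g t \<in> refl"
  unfolding refl_conjg by (metis S_carrier conjg_conjg m_closed)

lemma refl_sq [simp]: "t \<in> refl \<Longrightarrow> t \<otimes> t = \<one>"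
  by (erule reflE) (simp add: conjg_def m_assoc)

lemma refl_inv [simp]: "t \<in> refl \<Longrightarrow> inv t = t"
  by (simp add: inv_equality)

lemma refl_mult_cancel [simp]: "\<lbrakk>t \<in> refl; y \<in> carrier W\<rbrakk> \<Longrightarrow> t \<otimes> (t \<otimes> y) = y"
  by (simp flip: m_assoc)

lemma mult_refl_cancel [simp]: "\<lbrakk>t \<in> refl; y \<in> carrier W\<rbrakk> \<Longrightarrow> y \<otimes> t \<otimes> t = y"
  by (simp add: m_assoc)

section \<open>Words in the generators and reduced words\<close>

lemma wprod_simps [simp]: "wprod [] = \<one>" "wprod (x # xs) = x \<otimes> wprod xs"
  by (simp_all add: word_prod_def)

lemma wprod_closed [simp]: "set xs \<subseteq> carrier W \<Longrightarrow> wprod xs \<in> carrier W"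
  by (induction xs) auto

lemma wprod_append: "\<lbrakk>set xs \<subseteq> carrier W; set ys \<subseteq> carrier W\<rbrakk> \<Longrightarrow> wprod (xs @ ys) = wprod xs \<otimes> wprod ys"
  by (induction xs) (auto simp: m_assoc)

lemma S_lists_carrier [simp]: "set xs \<subseteq> S \<Longrightarrow> set xs \<subseteq> carrier W"
  using gens_subset by auto

lemma wprod_rev: "set xs \<subseteq> S \<Longrightarrow> wprod (rev xs) = inv (wprod xs)"
  by (induction xs) (auto simp: wprod_append inv_mult_group)

lemma ex_word: "w \<in> carrier W \<Longrightarrow> \<exists>xs. set xs \<subseteq> S \<and> wprod xs = w"
proof -
  assume "w \<in> carrier W"
  then have "w \<in> generate W S" by (simp add: gens_generate)
  then show ?thesis
  proof induction
    case one
    show ?case by (rule exI[of _ "[]"]) simp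
  next
    case (incl h)
    then show ?case by (intro exI[of _ "[h]"]) simp
  next
    case (inv h)
    then show ?case by (intro exI[of _ "[h]"]) simp
  next
    case (eng h1 h2)
    then obtain xs ys where "set xs \<subseteq> S" "wprod xs = h1" "set ys \<subseteq> S" "wprod ys = h2" by auto
    then show ?case by (intro exI[of _ "xs @ ys"]) (simp add: wprod_append)
  qed
qed

lemma len_le: "set xs \<subseteq> S \<Longrightarrow> len (wprod xs) \<le> length xs"
  unfolding cox_length_def by (rule Least_le) auto

lemma ex_reduced:
  assumes "w \<in> carrier W"
  obtains xs where "set xs \<subseteq> S" "wprod xs = w" "length xs = len w"
proof -
  have "\<exists>n. \<exists>xs\<in>lists S. length xs = n \<and> wprod xs = w"
    using ex_word[OF assms] by (auto simp: lists_eq_set)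
  from LeastI_ex[OF this] show ?thesis
    using that by (auto simp: cox_length_def lists_eq_set)
qed

section \<open>Reflection sequences of words and their parity\<close>

lemma rlist_append: "\<lbrakk>set xs \<subseteq> carrier W; set ys \<subseteq> carrier W\<rbrakk> \<Longrightarrow>
   rlist (xs @ ys) = rlist xs @ map (conjg (wprod xs)) (rlist ys)"
proof (induction xs)
  case Nil
  have "set (rlist ys) \<subseteq> carrier W" using Nil(2) by (induction ys) auto
  then show ?case by (auto simp: map_idI subset_iff)
next
  case (Cons x xs)
  have "set (rlist ys) \<subseteq> carrier W" using Cons.prems(2) by (induction ys) auto
  then show ?case using Cons
    by (auto simp: conjg_conjg subset_iff)
qed

lemma rlist_refl: "set xs \<subseteq> S \<Longrightarrow> set (rlist xs) \<subseteq> refl"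
  by (induction xs) auto

lemma length_rlist [simp]: "length (rlist xs) = length xs"
  by (induction xs) auto

lemma count_map_conjg:
  assumes "g \<in> carrier W" "set xs \<subseteq> carrier W" "t \<in> carrier W"
  shows "count_list (map (conjg g) xs) t = count_list xs (conjg (inv g) t)"
  using assms by (induction xs) (auto simp: conjg_eq_iff)

lemma count_rlist_append:
  assumes "set xs \<subseteq> S" "set ys \<subseteq> S" "t \<in> carrier W"
  shows "count_list (rlist (xs @ ys)) t
     = count_list (rlist xs) t + count_list (rlist ys) (conjg (inv (wprod xs)) t)"
  using assms rlist_refl[of ys] by (subst rlist_append) (auto simp: count_map_conjg subset_iff)

lemma mult_pow_comm:
  assumes "s \<in> S" "t \<in> S"
  shows "s \<otimes> inv ((s \<otimes> t) [^] (n::nat)) = (s \<otimes> t) [^] n \<otimes> s"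
proof (induction n)
  case (Suc n)
  have "s \<otimes> inv ((s \<otimes> t) [^] Suc n) = s \<otimes> (inv (s \<otimes> t) \<otimes> inv ((s \<otimes> t) [^] n))"
    using assms by (simp add: inv_mult_group)
  also have "\<dots> = s \<otimes> t \<otimes> (s \<otimes> inv ((s \<otimes> t) [^] n))"
    using assms by (simp add: inv_mult_group m_assoc)
  also have "\<dots> = s \<otimes> t \<otimes> (s \<otimes> t) [^] n \<otimes> s"
    using assms Suc by (simp add: m_assoc)
  also have "s \<otimes> t \<otimes> (s \<otimes> t) [^] n = (s \<otimes> t) [^] Suc n"
    using assms nat_pow_Suc2 by simp
  finally show ?case .
qed (use assms in auto)

text \<open>The word of \<open>(s t)^n\<close> crosses the reflections of the dihedral group in
  rotational order. In this closed form the sequence visibly has the order of \<open>s t\<close> as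
  a period, which is what the relators require.\<close>

lemma rlist_dihedral:
  assumes "s \<in> S" "t \<in> S"
  shows "rlist (concat (replicate n [s, t])) = map (\<lambda>i. (s \<otimes> t) [^] i \<otimes> s) [0..<2*n]
    \<and> wprod (concat (replicate n [s, t])) = (s \<otimes> t) [^] n"
proof (induction n)
  case (Suc n)
  have sub: "set (concat (replicate n [s, t])) \<subseteq> carrier W" "set (concat (replicate n [s, t])) \<subseteq> S"
    using assms by (auto split: if_splits)
  have rep: "concat (replicate (Suc n) [s, t]) = concat (replicate n [s, t]) @ [s, t]"
    by (induction n) auto
  define p where "p = (s \<otimes> t) [^] n"
  have p: "p \<in> carrier W" "s \<otimes> inv p = p \<otimes> s"
    using assms mult_pow_comm[OF assms] by (simp_all add: p_def)
  have a1: "p \<otimes> p = (s \<otimes> t) [^] (2*n)" using assms by (simp add: p_def nat_pow_mult mult_2)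
  have "conjg p s = p \<otimes> p \<otimes> s" using p assms by (simp add: conjg_def m_assoc)
  have a3: "conjg p (s \<otimes> t \<otimes> s) = p \<otimes> (s \<otimes> t) \<otimes> (s \<otimes> inv p)"
    using p assms by (simp add: conjg_def m_assoc)
  have a4: "p \<otimes> (s \<otimes> t) = (s \<otimes> t) \<otimes> p"
    using nat_pow_Suc nat_pow_Suc2 assms by (simp add: p_def)
  have 1: "conjg p s = (s \<otimes> t) [^] (2*n) \<otimes> s"
    and 2: "conjg p (s \<otimes> t \<otimes> s) = (s \<otimes> t) [^] (Suc (2*n)) \<otimes> s"
proof -
    show "conjg p s = (s \<otimes> t) [^] (2*n) \<otimes> s" using \<open>conjg p s = p \<otimes> p \<otimes> s\<close> \<open>p \<otimes> p = (s \<otimes> t) [^] (2*n)\<close> by simp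
    have "conjg p (s \<otimes> t \<otimes> s) = s \<otimes> t \<otimes> (p \<otimes> p) \<otimes> s"
      using p assms a3 a4 by (simp add: m_assoc)
    then show "conjg p (s \<otimes> t \<otimes> s) = (s \<otimes> t) [^] (Suc (2*n)) \<otimes> s"
      using a1 nat_pow_Suc2[of "s \<otimes> t" "2*n"] assms by (simp del: nat_pow_Suc)
  qed
  have "rlist (concat (replicate (Suc n) [s, t]))
    = map (\<lambda>i. (s \<otimes> t) [^] i \<otimes> s) [0..<2*n] @ [conjg p s, conjg p (s \<otimes> t \<otimes> s)]"
    unfolding rep using sub assms Suc by (subst rlist_append) (auto simp: p_def conjg_def)
  also have "\<dots> = map (\<lambda>i. (s \<otimes> t) [^] i \<otimes> s) [0..<2*Suc n]"
    unfolding 1 2 by simp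
  finally have r: "rlist (concat (replicate (Suc n) [s, t])) = map (\<lambda>i. (s \<otimes> t) [^] i \<otimes> s) [0..<2*Suc n]" .
  have "wprod (concat (replicate (Suc n) [s, t])) = (s \<otimes> t) [^] Suc n"
    unfolding rep using sub assms Suc by (simp add: wprod_append)
  then show ?case using r by blast
qed simp

text \<open>The sequence of a relator of length \<open>2m\<close> is one block of length
  \<open>m\<close> written twice, and its product is trivial. Inserting it changes every
  multiplicity by an even number. Together with the presentation, the parity of multiplicities
  becomes a function of the group element.\<close>

lemma cong_parity:
  assumes "coxeter_cong W S us vs"
  shows "set us \<subseteq> S \<and> set vs \<subseteq> S \<and> wprod us = wprod vs \<and> even (length us) = even (length vs) \<and>
    (\<forall>t\<in>carrier W. even (count_list (rlist us) t) = even (count_list (rlist vs) t))"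
  using assms
proof induction
  case (relator s t us vs)
  define m where "m = group.ord W (s \<otimes> t)"
  define xs where "xs = concat (replicate m [s, t])"
  have S: "set xs \<subseteq> S" "set us \<subseteq> S" "set vs \<subseteq> S"
    using relator by (auto simp: xs_def split: if_splits)
  have pow: "(s \<otimes> t) [^] m = \<one>" using relator by (simp add: m_def)
  have xs: "rlist xs = map (\<lambda>i. (s \<otimes> t) [^] i \<otimes> s) [0..<2*m]" "wprod xs = \<one>"
    using rlist_dihedral[of s t m] relator pow by (auto simp: xs_def)
  have "[0..<2*m] = [0..<m] @ map (\<lambda>i. i + m) [0..<m]"
    using upt_add_eq_append[of 0 m m] by (simp add: map_add_upt mult_2)
  moreover have "(s \<otimes> t) [^] (i + m) = (s \<otimes> t) [^] i" for i :: nat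
    using relator pow by (simp flip: nat_pow_mult)
  ultimately have "rlist xs = map (\<lambda>i. (s \<otimes> t) [^] i \<otimes> s) [0..<m] @ map (\<lambda>i. (s \<otimes> t) [^] i \<otimes> s) [0..<m]"
    using relator by (auto simp: xs o_def)
  then have ev: "even (count_list (rlist xs) t)" for t by simp
  have "even (length xs)" unfolding xs_def by (induction m) auto
  moreover have "even (count_list (rlist (us @ xs @ vs)) t) = even (count_list (rlist (us @ vs)) t)"
    if "t \<in> carrier W" for t
    using that S ev by (simp add: count_rlist_append xs)
  ultimately show ?case
    using S xs by (simp add: wprod_append flip: m_def xs_def)
qed (auto simp: in_lists_conv_set)

lemma word_parity:
  assumes "set us \<subseteq> S" "set vs \<subseteq> S" "wprod us = wprod vs"
  shows "even (length us) = even (length vs)"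
    and "t \<in> carrier W \<Longrightarrow> even (count_list (rlist us) t) = even (count_list (rlist vs) t)"
  using cong_parity[OF presentation, of us vs] assms by (auto simp: lists_eq_set)

section \<open>The inversion cocycle and the exchange condition\<close>

definition inversions :: "'a \<Rightarrow> 'a set" where
  "inversions w = {t \<in> carrier W. \<exists>xs. set xs \<subseteq> S \<and> wprod xs = w \<and> odd (count_list (rlist xs) t)}"

lemma inversions_word:
  assumes "set xs \<subseteq> S" "t \<in> carrier W"
  shows "t \<in> inversions (wprod xs) \<longleftrightarrow> odd (count_list (rlist xs) t)"
  using assms word_parity(2) unfolding inversions_def by blast

lemma inversions_refl: "inversions w \<subseteq> refl"
proof
  fix t assume "t \<in> inversions w"
  then obtain xs where "set xs \<subseteq> S" "odd (count_list (rlist xs) t)" by (auto simp: inversions_def)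
  then show "t \<in> refl" using rlist_refl count_notin[of t "rlist xs"] by (metis even_zero subsetD)
qed

text \<open>The cocycle rule: the inversions of \<open>x y\<close> are the symmetric difference of
  those of \<open>x\<close> and the conjugates by \<open>x\<close> of those of \<open>y\<close>.
  Most later length comparisons are instances of it.\<close>

lemma inversions_mult:
  assumes "x \<in> carrier W" "y \<in> carrier W" "t \<in> carrier W"
  shows "t \<in> inversions (x \<otimes> y) \<longleftrightarrow> (t \<in> inversions x) \<noteq> (conjg (inv x) t \<in> inversions y)"
proof -
  obtain xs ys where w: "set xs \<subseteq> S" "wprod xs = x" "set ys \<subseteq> S" "wprod ys = y"
    using ex_word assms by metis
  then have "x \<otimes> y = wprod (xs @ ys)" by (simp add: wprod_append)
  then show ?thesis
    using w assms inversions_word[of "xs @ ys" t] inversions_word[of xs t]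
      inversions_word[of ys "conjg (inv x) t"] by (simp add: count_rlist_append)
qed

lemma inversions_S: "s \<in> S \<Longrightarrow> t \<in> inversions s \<longleftrightarrow> t = s"
proof -
  assume s: "s \<in> S"
  then have "t \<in> carrier W \<Longrightarrow> t \<in> inversions s \<longleftrightarrow> t = s"
    using inversions_word[of "[s]" t] by (simp split: if_splits)
  moreover have "t \<in> inversions s \<Longrightarrow> t \<in> carrier W" by (simp add: inversions_def)
  ultimately show ?thesis using s S_carrier by metis
qed

lemma inversions_one [simp]: "inversions \<one> = {}"
  using inversions_word[of "[]"] by (auto simp: inversions_def)

text \<open>For \<open>t = u s u^-1\<close> the contributions of \<open>u\<close> and
  \<open>u^-1\<close> cancel, because \<open>u u^-1\<close> has no inversions; the letter
  \<open>s\<close> in the middle remains.\<close>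

lemma refl_in_inversions: assumes "t \<in> refl" shows "t \<in> inversions t"
proof -
  obtain u s where us: "u \<in> carrier W" "s \<in> S" "t = conjg u s" using assms by (rule reflE)
  have 1: "t \<in> inversions (u \<otimes> (s \<otimes> inv u)) \<longleftrightarrow>
      (t \<in> inversions u) \<noteq> (conjg (inv u) t \<in> inversions (s \<otimes> inv u))"
    using us by (intro inversions_mult) auto
  have 2: "s \<in> inversions (s \<otimes> inv u) \<longleftrightarrow> \<not> (s \<in> inversions (inv u))"
    using us inversions_mult[of s "inv u" s] by (simp add: inversions_S conjg_def)
  have 3: "s \<in> inversions (inv u) \<longleftrightarrow> t \<in> inversions u"
    using us inversions_mult[of u "inv u" t] by simp
  show ?thesis using 1 2 3 us by (simp add: conjg_def m_assoc)
qed

text \<open>Left multiplication by the \<open>i\<close>-th entry of the reflection sequence deletes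
  the \<open>i\<close>-th letter: the exchange condition.\<close>

lemma rlist_split:
  assumes "t \<in> set (rlist xs)" "set xs \<subseteq> S"
  shows "\<exists>ys. set ys \<subseteq> S \<and> length ys < length xs \<and> wprod ys = t \<otimes> wprod xs"
  using assms
proof (induction xs arbitrary: t)
  case (Cons s xs)
  show ?case
  proof (cases "t = s")
    case True
    then show ?thesis using Cons by (intro exI[of _ xs]) auto
  next
    case False
    then obtain r where r: "r \<in> set (rlist xs)" "t = conjg s r"
      using Cons by auto
    then obtain ys where ys: "set ys \<subseteq> S" "length ys < length xs" "wprod ys = r \<otimes> wprod xs"
      using Cons by (metis insert_subset list.simps(15))
    have "r \<in> carrier W" using r rlist_refl Cons.prems by fastforce
    then show ?thesis
      using ys r Cons.prems by (intro exI[of _ "s # ys"]) (auto simp: conjg_def m_assoc)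
  qed
qed simp

lemma inversions_len_less:
  assumes "w \<in> carrier W" "t \<in> inversions w"
  shows "len (t \<otimes> w) < len w"
proof -
  obtain xs where xs: "set xs \<subseteq> S" "wprod xs = w" "length xs = len w"
    using ex_reduced[OF assms(1)] by metis
  have "t \<in> refl" using assms inversions_refl by auto
  then have "odd (count_list (rlist xs) t)" using inversions_word[of xs t] assms xs refl_carrier by simp
  then have "t \<in> set (rlist xs)" by (metis count_notin even_zero)
  then obtain ys where "set ys \<subseteq> S" "length ys < length xs" "wprod ys = t \<otimes> wprod xs"
    using rlist_split[of t xs] xs by metis
  then show ?thesis using xs len_le by (metis le_less_trans)
qed

text \<open>If \<open>t\<close> is not an inversion of \<open>w\<close>, the cocycle rule makes it
  one of \<open>t w\<close>, and \<open>inversions_len_less\<close> for \<open>t w\<close> gives the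
  reverse inequality.\<close>

lemma len_left_less_iff:
  assumes "w \<in> carrier W" "t \<in> refl"
  shows "len (t \<otimes> w) < len w \<longleftrightarrow> t \<in> inversions w"
    and "len w < len (t \<otimes> w) \<longleftrightarrow> t \<notin> inversions w"
proof -
  have "len w < len (t \<otimes> w)" if "t \<notin> inversions w"
  proof -
    have "t \<in> inversions (t \<otimes> w)"
      using inversions_mult[of t w t] assms that refl_in_inversions by (simp add: conjg_def)
    then show ?thesis using inversions_len_less[of "t \<otimes> w" t] assms by simp
  qed
  then show "len (t \<otimes> w) < len w \<longleftrightarrow> t \<in> inversions w" "len w < len (t \<otimes> w) \<longleftrightarrow> t \<notin> inversions w"
    using inversions_len_less[OF assms(1)] by (meson less_asym)+
qed

lemma len_right_less_iff:
  assumes "w \<in> carrier W" "t \<in> refl"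
  shows "len (w \<otimes> t) < len w \<longleftrightarrow> conjg w t \<in> inversions w"
    and "len w < len (w \<otimes> t) \<longleftrightarrow> conjg w t \<notin> inversions w"
proof -
  have "conjg w t \<otimes> w = w \<otimes> t" using assms by (simp add: conjg_def m_assoc)
  then show "len (w \<otimes> t) < len w \<longleftrightarrow> conjg w t \<in> inversions w"
    "len w < len (w \<otimes> t) \<longleftrightarrow> conjg w t \<notin> inversions w"
    using len_left_less_iff[of w "conjg w t"] assms by auto
qed

lemma len_right_not_less:
  assumes "w \<in> carrier W" "t \<in> refl"
  shows "\<not> len (w \<otimes> t) < len w \<longleftrightarrow> len w < len (w \<otimes> t)"
  using len_right_less_iff assms by auto

text \<open>Conjugation by \<open>s\<close> fixes \<open>s\<close>, so a second occurrence of the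
  first letter \<open>s\<close> would place \<open>s\<close> in the sequence of the tail. By
  exchange, \<open>s\<close> times the tail would then have a word shorter than the tail,
  contradicting reducedness.\<close>

lemma rlist_reduced_distinct:
  assumes "set xs \<subseteq> S" "len (wprod xs) = length xs"
  shows "distinct (rlist xs)"
  using assms
proof (induction xs)
  case (Cons s xs)
  have le: "len (wprod xs) \<le> length xs" using Cons len_le by simp
  have "len (s \<otimes> wprod xs) \<le> Suc (len (wprod xs))"
  proof -
    obtain ys where "set ys \<subseteq> S" "wprod ys = wprod xs" "length ys = len (wprod xs)"
      using ex_reduced[of "wprod xs"] Cons by auto
    then show ?thesis using len_le[of "s # ys"] Cons by auto
  qed
  then have red: "len (wprod xs) = length xs" using le Cons by simp
  then have d: "distinct (rlist xs)" using Cons by simp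
  have sub: "set (rlist xs) \<subseteq> carrier W" using rlist_refl Cons.prems by fastforce
  have "s \<notin> conjg s ` set (rlist xs)"
  proof
    assume "s \<in> conjg s ` set (rlist xs)"
    then obtain r where r: "r \<in> set (rlist xs)" "s = conjg s r" by auto
    then have "r \<in> carrier W" using sub by auto
    then have "r = conjg (inv s) s" using r(2) conjg_inv_conjg(1)[of s r] Cons.prems by auto
    then have "s \<in> set (rlist xs)" using r Cons.prems by (simp add: conjg_def)
    then obtain ys where "set ys \<subseteq> S" "length ys < length xs" "wprod ys = s \<otimes> wprod xs"
      using rlist_split Cons.prems by (meson set_subset_Cons subset_trans)
    then show False using len_le[of ys] Cons.prems by simp
  qed
  moreover have "distinct (map (conjg s) (rlist xs))"
    using d conjg_inj[of s] sub Cons.prems by (auto simp: distinct_map inj_on_subset)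
  ultimately show ?case by simp
qed simp

lemma inversions_reduced:
  assumes "set xs \<subseteq> S" "len (wprod xs) = length xs"
  shows "inversions (wprod xs) = set (rlist xs)"
proof -
  have "odd (count_list (rlist xs) t) \<longleftrightarrow> t \<in> set (rlist xs)" for t
    using count_list_distinct[OF rlist_reduced_distinct[OF assms]] by simp
  moreover have "set (rlist xs) \<subseteq> carrier W" using rlist_refl[OF assms(1)] by auto
  ultimately show ?thesis using inversions_word[OF assms(1)] by (auto simp: inversions_def)
qed

lemma inversions_card:
  assumes "w \<in> carrier W"
  shows "finite (inversions w)" "card (inversions w) = len w"
proof -
  obtain xs where xs: "set xs \<subseteq> S" "wprod xs = w" "length xs = len w"
    using ex_reduced[OF assms(1)] by metis
  then show "finite (inversions w)" "card (inversions w) = len w"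
    using inversions_reduced[of xs] rlist_reduced_distinct[of xs] by (auto simp: distinct_card)
qed

section \<open>Parity and elementary bounds of the length\<close>

lemma len_parity: "set xs \<subseteq> S \<Longrightarrow> even (len (wprod xs)) = even (length xs)"
  using word_parity(1) ex_reduced[of "wprod xs"] by (metis S_lists_carrier wprod_closed)

lemma len_mult_parity:
  assumes "x \<in> carrier W" "y \<in> carrier W"
  shows "even (len (x \<otimes> y)) \<longleftrightarrow> (even (len x) \<longleftrightarrow> even (len y))"
proof -
  obtain xs ys where w: "set xs \<subseteq> S" "wprod xs = x" "set ys \<subseteq> S" "wprod ys = y"
    using ex_word assms by metis
  then show ?thesis using len_parity[of "xs @ ys"] len_parity[of xs] len_parity[of ys]
    by (auto simp: wprod_append)
qed

lemma len_one [simp]: "len \<one> = 0"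
  using len_le[of "[]"] by simp

lemma len_eq_0: "\<lbrakk>w \<in> carrier W; len w = 0\<rbrakk> \<Longrightarrow> w = \<one>"
  by (metis ex_reduced length_0_conv wprod_simps(1))

lemma len_S: "s \<in> S \<Longrightarrow> len s = 1"
proof -
  assume s: "s \<in> S"
  have "len s \<le> 1" using len_le[of "[s]"] s by simp
  moreover have "len s \<noteq> 0" using len_eq_0[of s] s gens_involution by auto
  ultimately show ?thesis by simp
qed

lemma len_mult_le: "\<lbrakk>x \<in> carrier W; y \<in> carrier W\<rbrakk> \<Longrightarrow> len (x \<otimes> y) \<le> len x + len y"
proof -
  assume a: "x \<in> carrier W" "y \<in> carrier W"
  obtain xs ys where w: "set xs \<subseteq> S" "wprod xs = x" "length xs = len x"
      "set ys \<subseteq> S" "wprod ys = y" "length ys = len y"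
    using ex_reduced[OF a(1)] ex_reduced[OF a(2)] by metis
  then show ?thesis using len_le[of "xs @ ys"] by (auto simp: wprod_append)
qed

lemma len_inv: "x \<in> carrier W \<Longrightarrow> len (inv x) = len x"
proof -
  have le: "len (inv x) \<le> len x" if "x \<in> carrier W" for x
  proof -
    obtain xs where w: "set xs \<subseteq> S" "wprod xs = x" "length xs = len x" using ex_reduced[OF \<open>x \<in> carrier W\<close>] by metis
    then show ?thesis using len_le[of "rev xs"] by (auto simp: wprod_rev)
  qed
  assume "x \<in> carrier W"
  then show ?thesis using le[of x] le[of "inv x"] by simp
qed

lemma refl_odd: assumes "t \<in> refl" shows "odd (len t)"
  using assms by (rule reflE) (simp add: conjg_def len_mult_parity len_inv len_S)

lemma len_mult_refl_neq: "\<lbrakk>x \<in> carrier W; t \<in> refl\<rbrakk> \<Longrightarrow> len (x \<otimes> t) \<noteq> len x"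
  using len_mult_parity[of x t] refl_odd[of t] by auto

lemma len_up:
  assumes "x \<in> carrier W" "s \<in> S" "len x < len (x \<otimes> s)" shows "len (x \<otimes> s) = len x + 1"
  using len_mult_le[of x s] len_S assms by simp

lemma len_down:
  assumes "x \<in> carrier W" "s \<in> S" "len (x \<otimes> s) < len x" shows "len x = len (x \<otimes> s) + 1"
  using len_up[of "x \<otimes> s" s] assms by (simp add: m_assoc)

lemma ex_descent:
  assumes "x \<in> carrier W" "x \<noteq> \<one>"
  shows "\<exists>s\<in>S. len (x \<otimes> s) < len x"
proof -
  obtain xs where xs: "set xs \<subseteq> S" "wprod xs = x" "length xs = len x"
    using ex_reduced[OF assms(1)] by metis
  then obtain ys s where ys: "xs = ys @ [s]" using assms by (cases xs rule: rev_cases) auto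
  then have "x \<otimes> s = wprod ys" using xs by (auto simp: wprod_append m_assoc)
  moreover have "len (wprod ys) < len x" using len_le[of ys] xs ys by auto
  ultimately show ?thesis using xs ys by (intro bexI[of _ s]) auto
qed

end

section \<open>Rank two cosets\<close>

locale finite_coxeter_system = coxeter_system +
  assumes fin: "finite (carrier W)"
begin

text \<open>
  The alternating word of length \<open>|n|\<close>, starting with \<open>a\<close> if \<open>n > 0\<close> and with \<open>b\<close> if \<open>n < 0\<close>. As \<open>n\<close>
  grows, \<open>x \<otimes> alt a b n\<close> walks around the coset of \<open>x\<close> modulo the dihedral group of \<open>a\<close> and \<open>b\<close>,
  which has \<open>2 * ord (a \<otimes> b)\<close> elements.
\<close>

definition alt :: "'a \<Rightarrow> 'a \<Rightarrow> int \<Rightarrow> 'a" where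
  "alt a b n = (if even n then (a \<otimes> b) [^] (n div 2) else (a \<otimes> b) [^] (n div 2) \<otimes> a)"

abbreviation dih_ord :: "'a \<Rightarrow> 'a \<Rightarrow> nat" where "dih_ord a b \<equiv> ord (a \<otimes> b)"

definition is_min :: "'a \<Rightarrow> 'a \<Rightarrow> 'a \<Rightarrow> bool" where
  "is_min a b x \<longleftrightarrow> x \<in> carrier W \<and> (\<forall>n. len x \<le> len (x \<otimes> alt a b n))"

text \<open>The letter that leads from \<open>alt a b n\<close> to \<open>alt a b (n + 1)\<close>,
  and also back.\<close>

definition letter :: "'a \<Rightarrow> 'a \<Rightarrow> int \<Rightarrow> 'a" where
  "letter a b n = (if even n then a else b)"

section \<open>Arithmetic of alternating words\<close>

lemma mult_int_pow_comm:
  assumes "a \<in> S" "b \<in> S"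
  shows "a \<otimes> (a \<otimes> b) [^] (i::int) = (a \<otimes> b) [^] (- i) \<otimes> a"
proof (cases "i \<ge> 0")
  case True
  define p where "p = (a \<otimes> b) [^] nat i"
  have p: "p \<in> carrier W" "a \<otimes> inv p = p \<otimes> a"
    using assms mult_pow_comm[OF assms] by (simp_all add: p_def)
  then have "inv p \<otimes> (a \<otimes> inv p) \<otimes> p = inv p \<otimes> (p \<otimes> a) \<otimes> p" by simp
  then have "a \<otimes> p = inv p \<otimes> a" using p(1) assms by (simp add: m_assoc)
  moreover have "(a \<otimes> b) [^] i = p" "(a \<otimes> b) [^] (- i) = inv p"
    using True assms int_pow_int[of W "a \<otimes> b" "nat i"] by (simp_all add: p_def int_pow_neg)
  ultimately show ?thesis by simp
next
  case False
  then have "(a \<otimes> b) [^] i = inv ((a \<otimes> b) [^] nat (-i))" "(a \<otimes> b) [^] (- i) = (a \<otimes> b) [^] nat (-i)"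
    using assms int_pow_int[of W "a \<otimes> b" "nat (-i)"] int_pow_neg[of "a \<otimes> b" "-i"] by simp_all
  then show ?thesis using mult_pow_comm[OF assms] by simp
qed

lemma alt_closed [simp]: "\<lbrakk>a \<in> S; b \<in> S\<rbrakk> \<Longrightarrow> alt a b n \<in> carrier W"
  by (simp add: alt_def)

text \<open>Even indices are rotations and act on positions as translations; odd indices are
  reflections. The sign change for odd \<open>k\<close> arises because \<open>a\<close> inverts the
  rotation \<open>a b\<close>.\<close>

lemma alt_mult:
  assumes "a \<in> S" "b \<in> S"
  shows "alt a b k \<otimes> alt a b l = alt a b (if even k then k + l else k - l)"
proof -
  define c where "c = a \<otimes> b"
  have c: "c \<in> carrier W" using assms by (simp add: c_def)
  have ac: "a \<otimes> (c [^] i \<otimes> y) = c [^] (-i) \<otimes> (a \<otimes> y)" if "y \<in> carrier W" for i :: int and y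
    using mult_int_pow_comm[OF assms, of i] that c assms by (simp flip: m_assoc c_def)
  have ac1: "a \<otimes> c [^] i = c [^] (-i) \<otimes> a" for i :: int
    using mult_int_pow_comm[OF assms, of i] by (simp flip: c_def)
  have cc: "c [^] i \<otimes> (c [^] j \<otimes> y) = c [^] (i + j) \<otimes> y" if "y \<in> carrier W" for i j :: int and y
    using that c by (simp add: int_pow_mult m_assoc)
  have cc1: "c [^] i \<otimes> c [^] j = c [^] (i + j)" for i j :: int
    using c by (simp add: int_pow_mult)
  obtain i j where ij: "k = 2*i \<or> k = 2*i+1" "l = 2*j \<or> l = 2*j+1"
    by (meson evenE oddE)
  have d: "(2*i + 2*j) div 2 = i + j" "(2*i + (2*j+1)) div 2 = i + j" "(2*i+1 - 2*j) div 2 = i - j"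
    "(2*i+1 - (2*j+1)) div 2 = i - j" by presburger+
  show ?thesis
    using ij c assms by (elim disjE) (simp_all add: alt_def m_assoc ac ac1 cc cc1 d flip: c_def)
qed

lemma alt_simps [simp]:
  assumes "a \<in> S" "b \<in> S"
  shows "alt a b 0 = \<one>" "alt a b 1 = a" "alt a b (-1) = b"
proof -
  have "(a \<otimes> b) [^] (-1::int) = b \<otimes> a"
    using assms by (simp add: int_pow_neg inv_mult_group)
  then show "alt a b 0 = \<one>" "alt a b 1 = a" "alt a b (-1) = b"
    using assms by (simp_all add: alt_def m_assoc)
qed

lemma alt_swap:
  assumes "a \<in> S" "b \<in> S"
  shows "alt b a n = alt a b (-n)"
proof -
  have c: "b \<otimes> a = inv (a \<otimes> b)" using assms by (simp add: inv_mult_group)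
  show ?thesis
  proof (cases "even n")
    case True
    then obtain i where "n = 2*i" by blast
    moreover have "- (2 * i) div 2 = - i" by presburger
    ultimately show ?thesis using assms by (simp add: alt_def c int_pow_inv int_pow_neg)
  next
    case False
    then obtain i where i: "n = 2*i+1" by (meson oddE)
    have d: "(- (2*i) - 1) div 2 = -i + (-1)" by presburger
    have "alt a b (-n) = (a \<otimes> b) [^] (-i) \<otimes> ((a \<otimes> b) [^] (-1::int) \<otimes> a)"
      using i assms d int_pow_mult[of "a \<otimes> b" "-i" "-1"] by (simp add: alt_def m_assoc)
    also have "(a \<otimes> b) [^] (-1::int) \<otimes> a = b"
      using assms by (simp add: int_pow_neg inv_mult_group m_assoc)
    finally show ?thesis using i assms by (simp add: alt_def c int_pow_inv int_pow_neg)
  qed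
qed

lemma alt_inv:
  assumes "a \<in> S" "b \<in> S"
  shows "inv (alt a b n) = alt a b (if even n then -n else n)"
  using assms by (intro inv_equality) (auto simp: alt_mult)

lemma letter_S: "\<lbrakk>a \<in> S; b \<in> S\<rbrakk> \<Longrightarrow> letter a b n \<in> S"
  by (simp add: letter_def)

lemma alt_letter:
  assumes "a \<in> S" "b \<in> S"
  shows "alt a b n \<otimes> letter a b n = alt a b (n + 1)" "alt a b n \<otimes> letter a b (n - 1) = alt a b (n - 1)"
  using assms alt_mult[OF assms, of n 1] alt_mult[OF assms, of n "-1"] by (auto simp: letter_def)

lemma alt_a_b:
  assumes "a \<in> S" "b \<in> S"
  shows "alt a b n \<otimes> a = alt a b (if even n then n + 1 else n - 1)"
    "alt a b n \<otimes> b = alt a b (if even n then n - 1 else n + 1)"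
  using assms alt_mult[OF assms, of n 1] alt_mult[OF assms, of n "-1"] by auto

text \<open>The odd alternating words are the reflections of the dihedral group; the second part
  identifies the one crossed between the positions \<open>k\<close> and \<open>k + 1\<close> as the
  word with index \<open>2*k+1\<close>.\<close>

lemma conjg_alt:
  assumes "a \<in> S" "b \<in> S"
  shows "odd l \<Longrightarrow> conjg (alt a b k) (alt a b l) = alt a b (if even k then 2*k + l else 2*k - l)"
    "conjg (alt a b k) (letter a b k) = alt a b (2*k+1)"
proof -
  show 1: "odd l \<Longrightarrow> conjg (alt a b k) (alt a b l) = alt a b (if even k then 2*k + l else 2*k - l)"for l
    using assms by (auto simp: conjg_def alt_inv alt_mult algebra_simps)
  show "conjg (alt a b k) (letter a b k) = alt a b (2*k+1)"
    using 1[of 1] 1[of "-1"] assms by (auto simp: letter_def)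
qed

lemma alt_refl: "\<lbrakk>a \<in> S; b \<in> S; odd n\<rbrakk> \<Longrightarrow> alt a b n \<in> refl"
proof -
  assume a: "a \<in> S" "b \<in> S" "odd n"
  then obtain i where "n = 2*i+1" by (meson oddE)
  then show ?thesis using conjg_alt(2)[of a b i] a letter_S by (metis S_refl alt_closed conjg_refl)
qed

lemma mo_pos: "\<lbrakk>a \<in> S; b \<in> S\<rbrakk> \<Longrightarrow> dih_ord a b > 0"
  using ord_ge_1[OF fin, of "a \<otimes> b"] by simp

lemma mo_swap: "\<lbrakk>a \<in> S; b \<in> S\<rbrakk> \<Longrightarrow> dih_ord b a = dih_ord a b"
  using ord_inv[of "a \<otimes> b"] by (simp add: inv_mult_group)

lemma mo_ge_2: assumes "a \<in> S" "b \<in> S" "a \<noteq> b" shows "dih_ord a b \<ge> 2"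
proof -
  have "dih_ord a b \<noteq> 1"
  proof
    assume "dih_ord a b = 1"
    then have "a \<otimes> b = \<one>" using assms ord_eq_1[of "a \<otimes> b"] by simp
    then have "a \<otimes> b \<otimes> b = \<one> \<otimes> b" by simp
    then show False using assms by (simp add: m_assoc)
  qed
  then show ?thesis using mo_pos[of a b] assms by linarith
qed

lemma alt_odd_eq_iff:
  assumes "a \<in> S" "b \<in> S"
  shows "alt a b (2*i+1) = alt a b (2*j+1) \<longleftrightarrow> int (dih_ord a b) dvd i - j"
proof -
  have "alt a b (2*i+1) = alt a b (2*j+1) \<longleftrightarrow> (a \<otimes> b) [^] i = (a \<otimes> b) [^] j"
    using assms by (simp add: alt_def)
  then show ?thesis using int_pow_eq[of "a \<otimes> b" i j] assms
    by (simp add: mod_eq_dvd_iff dvd_diff_commute)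
qed

lemma alt_period:
  assumes "a \<in> S" "b \<in> S"
  shows "alt a b (n + 2 * int (dih_ord a b) * j) = alt a b n"
proof -
  have "(n + 2 * int (dih_ord a b) * j) div 2 = n div 2 + int (dih_ord a b) * j" by simp
  moreover have "(a \<otimes> b) [^] (n div 2 + int (dih_ord a b) * j) = (a \<otimes> b) [^] (n div 2)"
    using assms by (simp add: int_pow_eq)
  ultimately show ?thesis using assms by (simp add: alt_def)
qed

lemma alt_representative:
  assumes "a \<in> S" "b \<in> S"
  shows "\<exists>k. - int (dih_ord a b) < k \<and> k \<le> int (dih_ord a b) \<and> alt a b n = alt a b k"
proof -
  define M where "M = int (dih_ord a b)"
  have M: "M > 0" using mo_pos assms by (simp add: M_def)
  define k where "k = (n + M - 1) mod (2 * M) - (M - 1)"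
  have "n = k + 2 * M * ((n + M - 1) div (2*M))"
    using mult_div_mod_eq[of "2*M" "n + M - 1"] unfolding k_def by linarith
  then have "alt a b n = alt a b k"
    using alt_period[OF assms, of k] unfolding M_def by metis
  moreover have "- M < k" "k \<le> M"
    using M pos_mod_bound[of "2*M" "n+M-1"] pos_mod_sign[of "2*M" "n+M-1"] unfolding k_def by linarith+
  ultimately show ?thesis unfolding M_def by blast
qed

text \<open>Each step of the walk crosses a new reflection: two indices \<open>2*i+1\<close> give
  the same reflection only if the values of \<open>i\<close> differ by a multiple of the order, and
  here they differ by less.\<close>

lemma inversions_alt:
  assumes "a \<in> S" "b \<in> S" "n \<le> dih_ord a b"
  shows "inversions (alt a b (int n)) = (\<lambda>i. alt a b (2 * int i + 1)) ` {..<n}"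
  using assms(3)
proof (induction n)
  case 0
  then show ?case using assms by simp
next
  case (Suc n)
  have IH: "inversions (alt a b (int n)) = (\<lambda>i. alt a b (2 * int i + 1)) ` {..<n}"
    using Suc by simp
  have new: "alt a b (2 * int n + 1) \<notin> inversions (alt a b (int n))"
  proof
    assume "alt a b (2 * int n + 1) \<in> inversions (alt a b (int n))"
    then obtain i where i: "i < n" "alt a b (2 * int n + 1) = alt a b (2 * int i + 1)"
      unfolding IH by auto
    then have "int (dih_ord a b) dvd int n - int i" using alt_odd_eq_iff assms by blast
    then have "int (dih_ord a b) \<le> int n - int i" using i by (intro zdvd_imp_le) auto
    then show False using Suc.prems by linarith
  qed
  have "t \<in> inversions (alt a b (int (Suc n))) \<longleftrightarrow>
      t \<in> inversions (alt a b (int n)) \<or> t = alt a b (2 * int n + 1)" if t: "t \<in> carrier W" for t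
  proof -
    have "alt a b (int (Suc n)) = alt a b (int n) \<otimes> letter a b (int n)"
      using alt_letter(1)[OF assms(1,2), of "int n"] by (simp add: add.commute)
    moreover have "conjg (inv (alt a b (int n))) t = letter a b (int n) \<longleftrightarrow> t = alt a b (2 * int n + 1)"
      using conjg_alt(2)[OF assms(1,2), of "int n"] t assms letter_S[OF assms(1,2)]
      by (metis S_carrier alt_closed conjg_eq_iff)
    ultimately show ?thesis
      using inversions_mult[of "alt a b (int n)" "letter a b (int n)" t] t assms new
        letter_S[OF assms(1,2), of "int n"] inversions_S by auto
  qed
  moreover have "inversions x \<subseteq> carrier W" for x by (auto simp: inversions_def)
  ultimately have "inversions (alt a b (int (Suc n))) = insert (alt a b (2 * int n + 1)) (inversions (alt a b (int n)))"
    using assms(1,2) alt_closed by blast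
  then show ?case unfolding IH by (simp add: lessThan_Suc)
qed

section \<open>Minimal elements of rank two cosets\<close>

lemma is_min_swap: "\<lbrakk>a \<in> S; b \<in> S\<rbrakk> \<Longrightarrow> is_min b a x = is_min a b x"
  unfolding is_min_def by (metis alt_swap minus_minus)

lemma is_min_carrier: "is_min a b x \<Longrightarrow> x \<in> carrier W"
  by (simp add: is_min_def)

lemma is_min_inversions:
  assumes "a \<in> S" "b \<in> S" "is_min a b x" "odd n"
  shows "conjg x (alt a b n) \<notin> inversions x"
  using assms len_right_less_iff[of x "alt a b n"] alt_refl[of a b n] unfolding is_min_def
  by (metis leD)

text \<open>The reflection crossed in this step has not been crossed inside the dihedral group, and
  minimality of \<open>x\<close> keeps its conjugate out of the inversions of \<open>x\<close>; the
  cocycle rule combines the two facts.\<close>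

lemma is_min_up:
  assumes "a \<in> S" "b \<in> S" "is_min a b x" "n < dih_ord a b"
  shows "len (x \<otimes> alt a b (int n)) < len (x \<otimes> alt a b (int n + 1))"
proof -
  let ?d = "alt a b (int n)" and ?c = "letter a b (int n)"
  have c: "x \<in> carrier W" "?d \<in> carrier W" "?c \<in> S"
    using assms letter_S is_min_carrier by auto
  have "alt a b (2 * int n + 1) \<notin> inversions ?d"
  proof
    assume "alt a b (2 * int n + 1) \<in> inversions ?d"
    then obtain i where i: "i < n" "alt a b (2 * int n + 1) = alt a b (2 * int i + 1)"
      using inversions_alt[OF assms(1,2), of n] assms by auto
    then have "int (dih_ord a b) dvd int n - int i" using alt_odd_eq_iff assms by blast
    then have "int (dih_ord a b) \<le> int n - int i" using i by (intro zdvd_imp_le) auto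
    then show False using assms by linarith
  qed
  moreover have "conjg x (alt a b (2 * int n + 1)) \<notin> inversions x"
    by (rule is_min_inversions) (use assms in auto)
  ultimately have "conjg x (alt a b (2 * int n + 1)) \<notin> inversions (x \<otimes> ?d)"
    using c assms by (simp add: inversions_mult)
  then have "conjg (x \<otimes> ?d) ?c \<notin> inversions (x \<otimes> ?d)"
    using c conjg_alt(2)[OF assms(1,2), of "int n"] by (simp flip: conjg_conjg)
  then have "len (x \<otimes> ?d) < len (x \<otimes> ?d \<otimes> ?c)"
    using c len_right_less_iff(2)[of "x \<otimes> ?d" ?c] by simp
  then show ?thesis using alt_letter(1)[OF assms(1,2), of "int n"] c by (simp add: m_assoc)
qed

lemma len_alt:
  assumes "a \<in> S" "b \<in> S" "is_min a b x" "\<bar>n\<bar> \<le> int (dih_ord a b)"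
  shows "len (x \<otimes> alt a b n) = len x + nat \<bar>n\<bar>"
proof -
  have *: "len (x \<otimes> alt a b (int n)) = len x + n"
    if "a \<in> S" "b \<in> S" "is_min a b x" "n \<le> dih_ord a b" for a b n
    using that(4)
  proof (induction n)
    case (Suc n)
    have "alt a b (int n + 1) = alt a b (int n) \<otimes> letter a b (int n)"
      using alt_letter(1) that by simp
    then have "x \<otimes> alt a b (int n + 1) = x \<otimes> alt a b (int n) \<otimes> letter a b (int n)"
      using that is_min_carrier letter_S by (simp add: m_assoc)
    then have "len (x \<otimes> alt a b (int n + 1)) = len (x \<otimes> alt a b (int n)) + 1"
      using is_min_up[OF that(1-3), of n] Suc.prems that is_min_carrier letter_S
        len_up[of "x \<otimes> alt a b (int n)" "letter a b (int n)"] by simp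
    then show ?case using Suc by (simp add: add.commute)
  qed (use that is_min_carrier in auto)
  show ?thesis
  proof (cases "n \<ge> 0")
    case True
    then show ?thesis using *[OF assms(1-3), of "nat n"] assms by simp
  next
    case False
    then show ?thesis
      using *[of b a "nat (-n)"] assms is_min_swap mo_swap[of a b] alt_swap[of a b "-n"] by simp
  qed
qed

lemma ex_is_min:
  assumes "a \<in> S" "b \<in> S" "y \<in> carrier W"
  obtains x k where "is_min a b x" "y = x \<otimes> alt a b k" "- int (dih_ord a b) < k" "k \<le> int (dih_ord a b)"
proof -
  obtain n where n: "\<And>k. len (y \<otimes> alt a b n) \<le> len (y \<otimes> alt a b k)"
    using ex_has_least_nat[of "\<lambda>_. True" 0 "\<lambda>n. len (y \<otimes> alt a b n)"] by auto
  have "is_min a b (y \<otimes> alt a b n)"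
    using n assms by (auto simp: is_min_def m_assoc alt_mult)
  moreover obtain k where "- int (dih_ord a b) < k" "k \<le> int (dih_ord a b)" "inv (alt a b n) = alt a b k"
    using alt_representative[OF assms(1,2)] alt_inv[OF assms(1,2)] by metis
  moreover from this have "y = y \<otimes> alt a b n \<otimes> alt a b k"
    using assms by (simp add: m_assoc flip: \<open>inv (alt a b n) = alt a b k\<close>)
  ultimately show ?thesis using that by blast
qed

text \<open>A local minimum of a coset is global: away from position \<open>0\<close> one of the two
  letters leads back towards the minimum.\<close>

lemma is_min_iff_ascents:
  assumes "a \<in> S" "b \<in> S" "y \<in> carrier W" "len y < len (y \<otimes> a)" "len y < len (y \<otimes> b)"
  shows "is_min a b y"
proof -
  obtain x k where xk: "is_min a b x" "y = x \<otimes> alt a b k" "- int (dih_ord a b) < k" "k \<le> int (dih_ord a b)"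
    using ex_is_min[OF assms(1-3)] .
  have x: "x \<in> carrier W" using xk is_min_carrier by simp
  have "k = 0"
  proof (rule ccontr)
    assume "k \<noteq> 0"
    define j where "j = (if k > 0 then k - 1 else k + 1)"
    have "\<bar>j\<bar> \<le> int (dih_ord a b)" "nat \<bar>j\<bar> < nat \<bar>k\<bar>" "\<bar>k\<bar> \<le> int (dih_ord a b)" using xk \<open>k \<noteq> 0\<close> by (auto simp: j_def)
    then have "len (x \<otimes> alt a b j) < len y" using xk len_alt[OF assms(1,2)] by simp
    moreover have "x \<otimes> alt a b j = y \<otimes> letter a b (if k > 0 then k - 1 else k)"
      using alt_letter[OF assms(1,2), of k] xk(2) x assms letter_S by (auto simp: j_def m_assoc)
    ultimately show False using assms by (auto simp: letter_def split: if_splits)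
  qed
  then show ?thesis using xk x assms by simp
qed

text \<open>By the cocycle rule the two comparisons can differ only if the conjugate of the
  reflection by \<open>g\<close> is an inversion of \<open>g\<close>, and minimality of
  \<open>g\<close> excludes this.\<close>

lemma refl_coset_compare:
  assumes "a \<in> S" "b \<in> S" "is_min a b g" "odd n" "v \<in> carrier W"
  shows "len (v \<otimes> g \<otimes> alt a b n) < len (v \<otimes> g) \<longleftrightarrow> len (v \<otimes> conjg g (alt a b n)) < len v"
proof -
  let ?r = "alt a b n"
  have c: "g \<in> carrier W" "?r \<in> refl" using assms is_min_carrier alt_refl by auto
  have "conjg (v \<otimes> g) ?r \<in> inversions (v \<otimes> g) \<longleftrightarrow>
      (conjg (v \<otimes> g) ?r \<in> inversions v) \<noteq> (conjg (inv v) (conjg (v \<otimes> g) ?r) \<in> inversions g)"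
    using c assms by (intro inversions_mult) auto
  also have "conjg (inv v) (conjg (v \<otimes> g) ?r) = conjg g ?r" using c assms by (simp flip: conjg_conjg)
  finally have "conjg (v \<otimes> g) ?r \<in> inversions (v \<otimes> g) \<longleftrightarrow> conjg v (conjg g ?r) \<in> inversions v"
    using is_min_inversions[OF assms(1-4)] c assms by (simp add: conjg_conjg)
  then show ?thesis
    using len_right_less_iff(1)[of "v \<otimes> g" ?r] len_right_less_iff(1)[of v "conjg g ?r"] c assms by simp
qed

lemma inversions_coset:
  assumes "a \<in> S" "b \<in> S" "is_min a b g" "n \<le> dih_ord a b"
  shows "inversions (g \<otimes> alt a b (int n)) = inversions g \<union> (\<lambda>i. conjg g (alt a b (2 * int i + 1))) ` {..<n}"
    and "inversions g \<inter> (\<lambda>i. conjg g (alt a b (2 * int i + 1))) ` {..<n} = {}"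
proof -
  have g: "g \<in> carrier W" using assms is_min_carrier by simp
  have nin: "conjg g (alt a b (2 * int i + 1)) \<notin> inversions g" for i
    using is_min_inversions[OF assms(1-3)] by simp
  then show "inversions g \<inter> (\<lambda>i. conjg g (alt a b (2 * int i + 1))) ` {..<n} = {}" by blast
  have "t \<in> inversions (g \<otimes> alt a b (int n)) \<longleftrightarrow>
      t \<in> inversions g \<or> t \<in> (\<lambda>i. conjg g (alt a b (2 * int i + 1))) ` {..<n}" if t: "t \<in> carrier W" for t
  proof -
    have "conjg (inv g) t \<in> inversions (alt a b (int n)) \<longleftrightarrow> (\<exists>i<n. conjg (inv g) t = alt a b (2 * int i + 1))"
      using inversions_alt[OF assms(1,2,4)] by auto
    also have "\<dots> \<longleftrightarrow> (\<exists>i<n. t = conjg g (alt a b (2 * int i + 1)))"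
      using g t assms by (metis alt_closed conjg_inv_conjg)
    finally show ?thesis using inversions_mult[of g "alt a b (int n)" t] g t assms nin by auto
  qed
  moreover have "inversions x \<subseteq> carrier W" for x by (auto simp: inversions_def)
  moreover have "(\<lambda>i. conjg g (alt a b (2 * int i + 1))) ` {..<n} \<subseteq> carrier W" using g assms by auto
  ultimately show "inversions (g \<otimes> alt a b (int n)) =
      inversions g \<union> (\<lambda>i. conjg g (alt a b (2 * int i + 1))) ` {..<n}"
    by blast
qed

end

section \<open>Rank two cosets and lower sets\<close>

context finite_coxeter_system
begin

definition coset2 :: "'a \<Rightarrow> 'a \<Rightarrow> 'a \<Rightarrow> 'a set" where
  "coset2 a b x = range (\<lambda>n. x \<otimes> alt a b n)"

text \<open>A lower set for the dihedral order on one coset: closure is demanded along the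
  reflections of the dihedral group only, while lengths are those of the whole group.\<close>

definition lower2 :: "'a \<Rightarrow> 'a \<Rightarrow> 'a \<Rightarrow> 'a set \<Rightarrow> bool" where
  "lower2 a b x Y \<longleftrightarrow> a \<in> S \<and> b \<in> S \<and> a \<noteq> b \<and> is_min a b x \<and> Y \<subseteq> coset2 a b x \<and>
     (\<forall>y\<in>Y. \<forall>n. odd n \<longrightarrow> len (y \<otimes> alt a b n) < len y \<longrightarrow> y \<otimes> alt a b n \<in> Y)"

lemma coset2_swap: "\<lbrakk>a \<in> S; b \<in> S\<rbrakk> \<Longrightarrow> coset2 b a x = coset2 a b x"
proof -
  assume ab: "a \<in> S" "b \<in> S"
  have "range (\<lambda>n. x \<otimes> alt a b (- n)) = (\<lambda>n. x \<otimes> alt a b n) ` range uminus"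
    by (simp only: image_image)
  moreover have "range (uminus :: int \<Rightarrow> int) = UNIV" by (metis surj_def minus_minus)
  ultimately show ?thesis using ab by (simp add: coset2_def alt_swap[of a b])
qed

lemma lower2_swap: "lower2 a b x Y \<Longrightarrow> lower2 b a x Y"
  unfolding lower2_def using coset2_swap[of a b x] is_min_swap[of a b x] alt_swap[of a b]
  by (metis even_minus)

lemma coset2_closed: "\<lbrakk>a \<in> S; b \<in> S; x \<in> carrier W; y \<in> coset2 a b x\<rbrakk> \<Longrightarrow> y \<in> carrier W"
  by (auto simp: coset2_def)

lemma coset2_alt:
  assumes "a \<in> S" "b \<in> S" "x \<in> carrier W"
  shows "coset2 a b (x \<otimes> alt a b k) = coset2 a b x"
proof -
  have sub: "coset2 a b (x \<otimes> alt a b k) \<subseteq> coset2 a b x" if "x \<in> carrier W" for x k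
    using that assms by (auto simp: coset2_def m_assoc alt_mult)
  have "x = x \<otimes> alt a b k \<otimes> inv (alt a b k)" using assms by (simp add: m_assoc)
  then have "coset2 a b x \<subseteq> coset2 a b (x \<otimes> alt a b k)"
    using sub[of "x \<otimes> alt a b k" "if even k then -k else k"] assms by (simp add: alt_inv)
  then show ?thesis using sub assms by blast
qed

lemma coset2_mult:
  assumes "a \<in> S" "b \<in> S" "x \<in> carrier W" "y \<in> coset2 a b x"
  shows "y \<otimes> a \<in> coset2 a b x" "y \<otimes> b \<in> coset2 a b x" "y \<otimes> alt a b n \<in> coset2 a b x"
proof -
  show *: "y \<otimes> alt a b n \<in> coset2 a b x" for n
    using assms by (auto simp: coset2_def m_assoc alt_mult)
  show "y \<otimes> a \<in> coset2 a b x" "y \<otimes> b \<in> coset2 a b x"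
    using *[of 1] *[of "-1"] assms by simp_all
qed

lemma coset2_representative:
  assumes "a \<in> S" "b \<in> S" "is_min a b x" "y \<in> coset2 a b x"
  obtains k where "y = x \<otimes> alt a b k" "- int (dih_ord a b) < k" "k \<le> int (dih_ord a b)" "len y = len x + nat \<bar>k\<bar>"
proof -
  obtain k where "y = x \<otimes> alt a b k" "- int (dih_ord a b) < k" "k \<le> int (dih_ord a b)"
    using assms alt_representative[OF assms(1,2)] by (auto simp: coset2_def) metis
  moreover from this have "len y = len x + nat \<bar>k\<bar>" using len_alt[OF assms(1-3), of k] by simp
  ultimately show ?thesis using that by blast
qed

text \<open>The coset is a polygon: strictly between bottom and top each length occurs twice, and
  the two elements of that length ascend along different letters.\<close>

lemma coset2_ascent_unique:
  assumes "a \<in> S" "b \<in> S" "is_min a b x" "y \<in> coset2 a b x" "z \<in> coset2 a b x"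
    "len y = len z" "len y < len (y \<otimes> a)" "len z < len (z \<otimes> a)"
  shows "y = z"
proof -
  obtain k where k: "y = x \<otimes> alt a b k" "- int (dih_ord a b) < k" "k \<le> int (dih_ord a b)" "len y = len x + nat \<bar>k\<bar>"
    using coset2_representative[OF assms(1-4)] .
  obtain l where l: "z = x \<otimes> alt a b l" "- int (dih_ord a b) < l" "l \<le> int (dih_ord a b)" "len z = len x + nat \<bar>l\<bar>"
    using coset2_representative[OF assms(1-3,5)] .
  have x: "x \<in> carrier W" using assms is_min_carrier by simp
  \<comment> \<open>Multiplication by \<open>a\<close> raises an even position and lowers an odd
    one, so in the listed cases it moves towards position \<open>0\<close> and is a descent.\<close>
  have down: "False" if "y = x \<otimes> alt a b k" "len y < len (y \<otimes> a)" "\<bar>k\<bar> \<le> int (dih_ord a b)"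
    "if even k then k < 0 else k > 0" for y k
  proof -
    define j where "j = (if even k then k + 1 else k - 1)"
    have "y \<otimes> a = x \<otimes> alt a b j"
      using that(1) x assms(1,2) by (simp add: m_assoc alt_a_b j_def)
    moreover have j: "\<bar>j\<bar> < \<bar>k\<bar>" using that(4) by (simp add: j_def split: if_splits)
    moreover have "len (x \<otimes> alt a b k) = len x + nat \<bar>k\<bar>" "len (x \<otimes> alt a b j) = len x + nat \<bar>j\<bar>"
      using len_alt[OF assms(1-3)] that(3) j by simp_all
    ultimately have "len (y \<otimes> a) < len y" using that(1) by simp
    then show False using that(2) by simp
  qed
  have bd: "\<bar>k\<bar> \<le> int (dih_ord a b)" "\<bar>l\<bar> \<le> int (dih_ord a b)" using k(2,3) l(2,3) by linarith+
  have "\<not> (if even k then k < 0 else k > 0)" "\<not> (if even l then l < 0 else l > 0)"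
    using down[OF k(1) assms(7) bd(1)] down[OF l(1) assms(8) bd(2)] by blast+
  moreover have "\<bar>k\<bar> = \<bar>l\<bar>" using k(4) l(4) assms(6) by linarith
  ultimately have "k = l" by presburger
  then show ?thesis using k(1) l(1) by simp
qed

text \<open>The element \<open>z \<otimes> a\<close> has the length of \<open>y\<close> and ascends
  along \<open>a\<close>, so it is \<open>y\<close> by uniqueness.\<close>

lemma coset2_ascent_of_descent:
  assumes "a \<in> S" "b \<in> S" "is_min a b x" "y \<in> coset2 a b x" "z \<in> coset2 a b x"
    "len z = len y + 1" "len y < len (y \<otimes> a)" "len (z \<otimes> a) < len z"
  shows "z = y \<otimes> a"
proof -
  have c: "x \<in> carrier W" "y \<in> carrier W" "z \<in> carrier W"
    using is_min_carrier assms(3) coset2_closed[OF assms(1,2)] assms(4,5) by blast+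
  have za: "z \<otimes> a \<in> coset2 a b x" using coset2_mult(1)[OF assms(1,2) c(1) assms(5)] .
  have "len (z \<otimes> a) = len y" using len_down[of z a] c assms by simp
  moreover have "len (z \<otimes> a) < len (z \<otimes> a \<otimes> a)" using assms c by simp
  ultimately have "z \<otimes> a = y"
    using coset2_ascent_unique[OF assms(1-3) za assms(4)] assms(7) by simp
  then have "z \<otimes> a \<otimes> a = y \<otimes> a" by simp
  then show ?thesis using c assms(1) by simp
qed

lemma coset2_descent:
  assumes "a \<in> S" "b \<in> S" "is_min a b x" "y \<in> coset2 a b x" "y \<noteq> x"
  shows "len (y \<otimes> a) < len y \<or> len (y \<otimes> b) < len y"
proof (rule ccontr)
  assume no: "\<not> ?thesis"
  have x: "x \<in> carrier W" using assms is_min_carrier by simp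
  then have y: "y \<in> carrier W" using assms coset2_closed by blast
  have "len y < len (y \<otimes> a)" "len y < len (y \<otimes> b)"
    using no len_right_not_less[of y a] len_right_not_less[of y b] y assms by auto
  then have "is_min a b y" using is_min_iff_ascents assms y by blast
  obtain k where k: "y = x \<otimes> alt a b k" "- int (dih_ord a b) < k" "k \<le> int (dih_ord a b)" "len y = len x + nat \<bar>k\<bar>"
    using coset2_representative[OF assms(1-4)] .
  have "len y \<le> len (y \<otimes> inv (alt a b k))"
    using \<open>is_min a b y\<close> assms alt_inv unfolding is_min_def by metis
  also have "y \<otimes> inv (alt a b k) = x" using k x assms by (simp add: m_assoc)
  finally have "k = 0" using k by linarith
  then show False using k assms x by simp
qed

lemma lower2D:
  assumes "lower2 a b x Y"
  shows "a \<in> S" "b \<in> S" "a \<noteq> b" "is_min a b x" "Y \<subseteq> coset2 a b x" "x \<in> carrier W" "Y \<subseteq> carrier W"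
    and "\<lbrakk>y \<in> Y; odd n; len (y \<otimes> alt a b n) < len y\<rbrakk> \<Longrightarrow> y \<otimes> alt a b n \<in> Y"
    and "\<lbrakk>y \<in> Y; len (y \<otimes> a) < len y\<rbrakk> \<Longrightarrow> y \<otimes> a \<in> Y"
    and "\<lbrakk>y \<in> Y; len (y \<otimes> b) < len y\<rbrakk> \<Longrightarrow> y \<otimes> b \<in> Y"
proof -
  show 1: "a \<in> S" "b \<in> S" "a \<noteq> b" "is_min a b x" "Y \<subseteq> coset2 a b x"
    using assms by (auto simp: lower2_def)
  then show "x \<in> carrier W" "Y \<subseteq> carrier W" using is_min_carrier coset2_closed by blast+
  show *: "\<lbrakk>y \<in> Y; odd n; len (y \<otimes> alt a b n) < len y\<rbrakk> \<Longrightarrow> y \<otimes> alt a b n \<in> Y" for n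
    using assms by (auto simp: lower2_def)
  show "\<lbrakk>y \<in> Y; len (y \<otimes> a) < len y\<rbrakk> \<Longrightarrow> y \<otimes> a \<in> Y" "\<lbrakk>y \<in> Y; len (y \<otimes> b) < len y\<rbrakk> \<Longrightarrow> y \<otimes> b \<in> Y"
    using *[of 1] *[of "-1"] 1 by simp_all
qed

text \<open>In a dihedral group, shorter implies smaller. Positions of different parity are joined
  by a reflection; for equal parity an intermediate position is inserted.\<close>

lemma lower2_less:
  assumes "lower2 a b x Y" "y \<in> coset2 a b x" "z \<in> Y" "len y < len z"
  shows "y \<in> Y"
proof -
  note L = lower2D[OF assms(1)]
  obtain k where k: "y = x \<otimes> alt a b k" "- int (dih_ord a b) < k" "k \<le> int (dih_ord a b)" "len y = len x + nat \<bar>k\<bar>"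
    using coset2_representative[OF L(1,2,4) assms(2)] .
  obtain l where l: "z = x \<otimes> alt a b l" "- int (dih_ord a b) < l" "l \<le> int (dih_ord a b)" "len z = len x + nat \<bar>l\<bar>"
    using coset2_representative[OF L(1,2,4) subsetD[OF L(5) assms(3)]] .
  have step: "x \<otimes> alt a b j \<in> Y" if "x \<otimes> alt a b i \<in> Y" "\<bar>j\<bar> < \<bar>i\<bar>" "odd (i - j)" "\<bar>i\<bar> \<le> int (dih_ord a b)" for i j
  proof -
    \<comment> \<open>By \<open>alt_mult\<close>, multiplying by \<open>alt a b n\<close> moves an
      even position \<open>i\<close> to \<open>i + n\<close> and an odd one to
      \<open>i - n\<close>.\<close>
    define n where "n = (if even i then j - i else i - j)"
    have "x \<otimes> alt a b i \<otimes> alt a b n = x \<otimes> alt a b j"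
      using L(1,2,6) by (simp add: m_assoc alt_mult n_def)
    moreover have "len (x \<otimes> alt a b j) < len (x \<otimes> alt a b i)"
      using that len_alt[OF L(1,2,4), of i] len_alt[OF L(1,2,4), of j] by auto
    moreover have "odd n" using that by (auto simp: n_def)
    ultimately show ?thesis using L(8)[OF that(1), of n] by simp
  qed
  have kl: "\<bar>k\<bar> < \<bar>l\<bar>" "\<bar>l\<bar> \<le> int (dih_ord a b)" using k l assms by auto
  show ?thesis
  proof (cases "odd (l - k)")
    case True
    then show ?thesis using step[of l k] kl k(1) l(1) assms(3) by simp
  next
    case False
    \<comment> \<open>The neighbour of position \<open>l\<close> one step nearer to the bottom.
      Equal parity of \<open>k\<close> and \<open>l\<close> rules out adjacent levels, so it still
      lies strictly above the level of \<open>k\<close>.\<close>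
    define i where "i = (if l > 0 then l - 1 else l + 1)"
    have "\<bar>l\<bar> \<noteq> \<bar>k\<bar> + 1" using False by presburger
    then have "\<bar>k\<bar> < \<bar>i\<bar>" "\<bar>i\<bar> < \<bar>l\<bar>" "odd (l - i)" "odd (i - k)"
      using kl False by (auto simp: i_def)
    moreover have "x \<otimes> alt a b l \<in> Y" using assms(3) l(1) by simp
    ultimately have "x \<otimes> alt a b i \<in> Y" using step[of l i] kl(2) by simp
    then have "x \<otimes> alt a b k \<in> Y"
      using step[of i k] kl(2) \<open>\<bar>k\<bar> < \<bar>i\<bar>\<close> \<open>\<bar>i\<bar> < \<bar>l\<bar>\<close> \<open>odd (i - k)\<close> by simp
    then show ?thesis using k(1) by simp
  qed
qed

text \<open>
  If \<open>Y\<close> is closed neither under \<open>a\<close> nor under \<open>b\<close>, it consists of all elements of the coset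
  up to the length of \<open>y1\<close> and \<open>y2\<close>.
\<close>

lemma lower2_bad_le:
  assumes "lower2 a b x Y" "y1 \<in> Y" "y1 \<otimes> a \<notin> Y" "y2 \<in> Y" "y2 \<otimes> b \<notin> Y"
  shows "len y2 \<le> len y1"
proof (rule ccontr)
  assume "\<not> ?thesis"
  then have lt: "len y1 < len y2" by simp
  note L = lower2D[OF assms(1)]
  have c: "y1 \<in> carrier W" "y2 \<in> carrier W" "y1 \<in> coset2 a b x" "y2 \<in> coset2 a b x"
    using assms L(1,2,4-7) by auto
  have u1: "len y1 < len (y1 \<otimes> a)" using L(9) assms len_right_not_less[of y1 a] c L(1,2,4-7) by auto
  then have u1': "len (y1 \<otimes> a) = len y1 + 1" using len_up c L(1,2,4-7) by auto
  have "\<not> len (y1 \<otimes> a) < len y2"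
    using lower2_less[OF assms(1), of "y1 \<otimes> a" y2] coset2_mult L(1,2,4-7) c assms by blast
  then have eq: "len y2 = len y1 + 1" using lt u1' by simp
  have "len x \<le> len y1" using c(3) L(4) by (auto simp: coset2_def is_min_def)
  then have "y2 \<noteq> x" using lt by auto
  moreover have "\<not> len (y2 \<otimes> b) < len y2" using L(10) assms by auto
  \<comment> \<open>Since \<open>y2\<close> leaves \<open>Y\<close> through \<open>b\<close>, its
    descent must be \<open>a\<close>; this makes it the upper neighbour of \<open>y1\<close> along
    \<open>a\<close>, which is not in \<open>Y\<close>.\<close>
  ultimately have d: "len (y2 \<otimes> a) < len y2" using coset2_descent[OF L(1,2,4) c(4)] by blast
  then have "y2 = y1 \<otimes> a"
    using coset2_ascent_of_descent[OF L(1,2,4) c(3,4) eq u1] by simp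
  then show False using assms by simp
qed

lemma lower2_bad:
  assumes "lower2 a b x Y" "y1 \<in> Y" "y1 \<otimes> a \<notin> Y" "y2 \<in> Y" "y2 \<otimes> b \<notin> Y"
  shows "len y2 = len y1" "\<And>z. z \<in> Y \<Longrightarrow> len z \<le> len y1" "\<And>z. z \<in> Y \<Longrightarrow> z \<otimes> a \<notin> Y \<Longrightarrow> z = y1"
proof -
  note L = lower2D[OF assms(1)]
  \<comment> \<open>Two applications, the second with \<open>a\<close> and \<open>b\<close>
    exchanged, put every element leaving through \<open>a\<close> on the level of
    \<open>y2\<close>.\<close>
  have eq: "len z = len y2" if "z \<in> Y" "z \<otimes> a \<notin> Y" for z
    using lower2_bad_le[OF assms(1) that assms(4,5)]
      lower2_bad_le[OF lower2_swap[OF assms(1)] assms(4,5) that] by simp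
  then show eq1: "len y2 = len y1" using assms by simp
  have c: "y1 \<in> carrier W" "y2 \<in> carrier W" "y1 \<in> coset2 a b x" "y2 \<in> coset2 a b x"
    using assms L(1,2,4-7) by auto
  have asc: "len z < len (z \<otimes> a)" if "z \<in> Y" "z \<otimes> a \<notin> Y" for z
  proof -
    have "z \<in> carrier W" using that L(7) by blast
    moreover have "\<not> len (z \<otimes> a) < len z" using L(9) that by blast
    ultimately show ?thesis using len_right_not_less[of z a] L(1) by simp
  qed
  have asc2: "len y2 < len (y2 \<otimes> b)"
  proof -
    have "\<not> len (y2 \<otimes> b) < len y2" using L(10) assms(4,5) by blast
    then show ?thesis using len_right_not_less[of y2 b] L(2) c(2) by simp
  qed
  show "z = y1" if "z \<in> Y" "z \<otimes> a \<notin> Y" for z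
    using coset2_ascent_unique[OF L(1,2,4), of z y1] that asc[OF that] asc[OF assms(2,3)]
      eq[OF that] eq1 c L by auto
  show "len z \<le> len y1" if z: "z \<in> Y" for z
  proof (rule ccontr)
    assume "\<not> ?thesis"
    then have lt: "len y1 < len z" by simp
    have zc: "z \<in> carrier W" "z \<in> coset2 a b x" using z L(1,2,4-7) by auto
    have "len (y1 \<otimes> a) = len y1 + 1" using len_up c L(1,2,4-7) asc assms by auto
    moreover have "\<not> len (y1 \<otimes> a) < len z"
      using lower2_less[OF assms(1), of "y1 \<otimes> a" z] coset2_mult L(1,2,4-7) c assms z by blast
    ultimately have zl: "len z = len y1 + 1" using lt by simp
    have "len x \<le> len y1" using c(3) L(4) by (auto simp: coset2_def is_min_def)
    then have "z \<noteq> x" using lt by auto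
    then consider "len (z \<otimes> a) < len z" | "len (z \<otimes> b) < len z" using coset2_descent[OF L(1,2,4) zc(2)] by blast
    then show False
    proof cases
      case 1
      then have "z = y1 \<otimes> a"
        using coset2_ascent_of_descent[OF L(1,2,4) c(3) zc(2) zl] asc[OF assms(2,3)] by simp
      then show False using z assms(3) by simp
    next
      case 2
      have "is_min b a x" "y2 \<in> coset2 b a x" "z \<in> coset2 b a x"
        using is_min_swap[OF L(1,2)] coset2_swap[OF L(1,2)] L(4) c(4) zc(2) by simp_all
      then have "z = y2 \<otimes> b"
        using coset2_ascent_of_descent[OF L(2,1), of x y2 z] asc2 2 zl eq1 by simp
      then show False using z assms(5) by simp
    qed
  qed
qed

section \<open>Signed counts in rank two cosets\<close>

definition lsgn :: "'a \<Rightarrow> int" where "lsgn z = (- 1) ^ len z"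

lemma lsgn_refl: "\<lbrakk>y \<in> carrier W; t \<in> refl\<rbrakk> \<Longrightarrow> lsgn (y \<otimes> t) = - lsgn y"
  using len_mult_parity[of y t] refl_odd[of t] unfolding lsgn_def by (cases "even (len y)") auto

lemma lsgn_cases: "lsgn z = 1 \<or> lsgn z = -1"
  by (cases "even (len z)") (auto simp: lsgn_def)

lemma lsgn_alt:
  assumes "a \<in> S" "b \<in> S" "y \<in> carrier W"
  shows "lsgn (y \<otimes> alt a b n) = (if even n then lsgn y else - lsgn y)"
proof (cases "even n")
  case True
  have "y \<otimes> alt a b n \<otimes> a = y \<otimes> alt a b (n + 1)"
    using True assms by (simp add: m_assoc alt_a_b)
  then have "- lsgn (y \<otimes> alt a b n) = - lsgn y"
    using lsgn_refl[of "y \<otimes> alt a b n" a] lsgn_refl[of y "alt a b (n+1)"] assms True alt_refl by simp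
  then show ?thesis using True by simp
next
  case False
  then show ?thesis using lsgn_refl alt_refl assms by simp
qed

text \<open>Right multiplication by \<open>c\<close> is a sign reversing involution of
  \<open>Y\<close>.\<close>

lemma lsgn_sum_stable:
  assumes "Y \<subseteq> carrier W" "c \<in> S" "\<And>y. y \<in> Y \<Longrightarrow> y \<otimes> c \<in> Y"
  shows "sum lsgn Y = 0"
proof -
  have "sum lsgn Y = (\<Sum>y\<in>Y. lsgn (y \<otimes> c))"
    by (rule sum.reindex_bij_witness[of _ "\<lambda>y. y \<otimes> c" "\<lambda>y. y \<otimes> c"]) (use assms in auto)
  also have "\<dots> = (\<Sum>y\<in>Y. - lsgn y)"
    by (rule sum.cong) (use assms lsgn_refl in auto)
  finally show ?thesis by (simp add: sum_negf)
qed

text \<open>Only \<open>y1\<close> leaves \<open>Y\<close> through \<open>a\<close>; the remaining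
  elements cancel in pairs \<open>y\<close>, \<open>y \<otimes> a\<close>.\<close>

lemma lsgn_sum_bad:
  assumes "lower2 a b x Y" "y1 \<in> Y" "y1 \<otimes> a \<notin> Y" "y2 \<in> Y" "y2 \<otimes> b \<notin> Y"
  shows "sum lsgn Y = lsgn y1"
proof -
  note L = lower2D[OF assms(1)]
  have "sum lsgn (Y - {y1}) = 0"
  proof (rule lsgn_sum_stable)
    show "y \<otimes> a \<in> Y - {y1}" if y: "y \<in> Y - {y1}" for y
    proof -
      have "y \<otimes> a \<in> Y" using lower2_bad(3)[OF assms, of y] y by blast
      moreover have "y \<otimes> a \<noteq> y1"
      proof
        assume "y \<otimes> a = y1"
        then have "y1 \<otimes> a = y" using y L(1,2,4-7) by auto
        then show False using y assms by simp
      qed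
      ultimately show ?thesis by simp
    qed
  qed (use L in auto)
  moreover have "finite Y" using L(7) fin finite_subset by blast
  ultimately show ?thesis using sum.remove[of Y y1 lsgn] assms by simp
qed

lemma alt_odds:
  assumes "a \<in> S" "b \<in> S"
  shows "{alt a b n | n. odd n} = (\<lambda>i. alt a b (2 * int i + 1)) ` {..<dih_ord a b}"
proof -
  have "alt a b n \<in> (\<lambda>i. alt a b (2 * int i + 1)) ` {..<dih_ord a b}" if "odd n" for n
  proof -
    obtain i where i: "n = 2*i+1" using \<open>odd n\<close> by (meson oddE)
    define j where "j = nat (i mod int (dih_ord a b))"
    have pos: "dih_ord a b > 0" using mo_pos assms by simp
    then have j: "int j = i mod int (dih_ord a b)" by (simp add: j_def)
    then have "int (dih_ord a b) dvd i - int j" by (simp add: minus_mod_eq_mult_div)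
    then have "alt a b n = alt a b (2 * int j + 1)" using alt_odd_eq_iff assms i by simp
    moreover have "j < dih_ord a b" using j pos by (simp add: nat_less_iff j_def)
    ultimately show ?thesis by blast
  qed
  then show ?thesis by (auto intro: exI[of _ "2 * int i + 1" for i])
qed

text \<open>A normal form: the two generators are named so that \<open>y\<close> is reached from the
  bottom along nonnegative positions and \<open>s\<close> is the letter that continues
  upwards.\<close>

lemma ascent_representative:
  assumes "s \<in> S" "r \<in> S" "s \<noteq> r" "y \<in> carrier W" "len y < len (y \<otimes> s)"
  obtains x a b k where "a = s \<and> b = r \<or> a = r \<and> b = s" "is_min a b x" "y = x \<otimes> alt a b (int k)"
    "k < dih_ord a b" "s = letter a b (int k)"
proof -
  obtain x k where xk: "is_min s r x" "y = x \<otimes> alt s r k" "- int (dih_ord s r) < k" "k \<le> int (dih_ord s r)"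
    using ex_is_min[OF assms(1,2,4)] .
  \<comment> \<open>At position \<open>0\<close> either naming describes \<open>y\<close>; the
    choice \<open>a = s\<close> there makes \<open>s\<close> the next letter.\<close>
  define a where "a = (if k \<ge> 0 then s else r)"
  define b where "b = (if k \<ge> 0 then r else s)"
  define n where "n = nat \<bar>k\<bar>"
  have ab: "a \<in> S" "b \<in> S" "a = s \<and> b = r \<or> a = r \<and> b = s" using assms by (auto simp: a_def b_def)
  have mi: "is_min a b x" using xk assms is_min_swap by (auto simp: a_def b_def)
  have mo: "dih_ord a b = dih_ord s r" using mo_swap assms by (auto simp: a_def b_def)
  have y: "y = x \<otimes> alt a b (int n)" using xk assms alt_swap[of s r] by (auto simp: a_def b_def n_def)
  have nm: "n \<le> dih_ord a b" using xk mo by (auto simp: n_def)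
  have x: "x \<in> carrier W" using mi is_min_carrier by simp
  have ly: "len y = len x + n" using len_alt[OF ab(1,2) mi, of "int n"] y nm by simp
  have "n \<noteq> dih_ord a b"
  proof
    assume "n = dih_ord a b"
    have "y \<otimes> s \<in> coset2 a b x"
      using y ab coset2_mult[of a b x y] x unfolding coset2_def by blast
    then obtain k where "- int (dih_ord a b) < k" "k \<le> int (dih_ord a b)" "len (y \<otimes> s) = len x + nat \<bar>k\<bar>"
      using coset2_representative[OF ab(1,2) mi] by metis
    then show False using assms ly \<open>n = dih_ord a b\<close> by linarith
  qed
  then have n: "n < dih_ord a b" using nm by simp
  have "s = letter a b (int n)"
  proof (rule ccontr)
    assume ne: "s \<noteq> letter a b (int n)"
    have "n \<noteq> 0" using ne by (auto simp: letter_def a_def n_def split: if_splits)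
    have "s = letter a b (int n - 1)" using ne ab by (auto simp: letter_def split: if_splits)
    then have "y \<otimes> s = x \<otimes> alt a b (int n - 1)"
      using alt_letter(2)[OF ab(1,2), of "int n"] y x ab assms by (simp add: m_assoc)
    then have "len (y \<otimes> s) = len x + (n - 1)"
      using len_alt[OF ab(1,2) mi, of "int n - 1"] n \<open>n \<noteq> 0\<close> by (simp add: nat_diff_distrib)
    then show False using assms ly by simp
  qed
  then show ?thesis using that ab mi y n by blast
qed

section \<open>The longest element\<close>

lemma ex_longest: "\<exists>z\<in>carrier W. inversions z = refl"
proof -
  obtain z where z: "z \<in> carrier W" "\<And>y. y \<in> carrier W \<Longrightarrow> len y \<le> len z"
  proof -
    have "Max (len ` carrier W) \<in> len ` carrier W" using fin one_closed by (intro Max_in) auto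
    then obtain z where "z \<in> carrier W" "len z = Max (len ` carrier W)" by auto
    moreover have "len y \<le> Max (len ` carrier W)" if "y \<in> carrier W" for y
      using fin that by simp
    ultimately show ?thesis using that by metis
  qed
  have "t \<in> inversions z" if "t \<in> refl" for t
    using len_left_less_iff(2)[OF z(1) that] z(2)[of "t \<otimes> z"] z(1) that by auto
  then show ?thesis using z inversions_refl by blast
qed

lemma inversions_inv_longest:
  assumes "z \<in> carrier W" "inversions z = refl" shows "inversions (inv z) = refl"
proof -
  have "r \<in> inversions (inv z)" if "r \<in> refl" for r
    using inversions_mult[of "inv z" z r] assms that by simp
  then show ?thesis using inversions_refl by blast
qed

text \<open>Both \<open>z\<close> and \<open>z^-1\<close> have all reflections as inversions, so in
  \<open>z s z^-1\<close> everything cancels except the contribution of \<open>s\<close>. An element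
  with one inversion has length one and is a generator.\<close>

lemma conjg_longest_S:
  assumes "z \<in> carrier W" "inversions z = refl" "s \<in> S" shows "conjg z s \<in> S"
proof -
  have inv: "inversions (inv z) = refl" using inversions_inv_longest assms by simp
  have "r \<in> inversions (conjg z s) \<longleftrightarrow> r = conjg z s" if r: "r \<in> refl" for r
  proof -
    have "r \<in> inversions (z \<otimes> (s \<otimes> inv z)) \<longleftrightarrow> (r \<in> inversions z) \<noteq> (conjg (inv z) r \<in> inversions (s \<otimes> inv z))"
      using assms r by (intro inversions_mult) auto
    also have "conjg (inv z) r \<in> inversions (s \<otimes> inv z) \<longleftrightarrow>
        (conjg (inv z) r \<in> inversions s) \<noteq> (conjg (inv s) (conjg (inv z) r) \<in> inversions (inv z))"
      using assms r by (intro inversions_mult) auto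
    finally have "r \<in> inversions (z \<otimes> (s \<otimes> inv z)) \<longleftrightarrow> conjg (inv z) r = s"
      using assms r inv by (simp add: inversions_S)
    then show ?thesis using assms r by (auto simp: conjg_def m_assoc)
  qed
  then have "inversions (conjg z s) = {conjg z s}" using inversions_refl[of "conjg z s"] assms by fastforce
  then have "len (conjg z s) = 1" using inversions_card[of "conjg z s"] assms by simp
  then obtain xs where "set xs \<subseteq> S" "wprod xs = conjg z s" "length xs = 1"
    using ex_reduced[of "conjg z s"] assms by auto
  then obtain x where "x \<in> S" "wprod [x] = conjg z s" by (auto simp: length_Suc_conv)
  then show ?thesis by auto
qed

text \<open>Right multiplication by a longest element \<open>u\<close> complements the inversion
  set. Hence \<open>z u\<close> has no descents, is the identity, and \<open>z\<close> is the
  inverse of \<open>u\<close>.\<close>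

lemma longest_if_descents:
  assumes z: "z \<in> carrier W" and desc: "\<And>s. s \<in> S \<Longrightarrow> len (z \<otimes> s) < len z"
  shows "inversions z = refl"
proof -
  obtain u where u: "u \<in> carrier W" "inversions u = refl" using ex_longest by blast
  have "\<not> len (z \<otimes> u \<otimes> s) < len (z \<otimes> u)" if s: "s \<in> S" for s
  proof -
    define r where "r = conjg u s"
    have r: "r \<in> S" using conjg_longest_S[OF u s] by (simp add: r_def)
    have "conjg z r \<in> inversions z" using len_right_less_iff(1)[of z r] desc r z by auto
    moreover have "conjg z r \<in> inversions (z \<otimes> u) \<longleftrightarrow> (conjg z r \<in> inversions z) \<noteq> (conjg (inv z) (conjg z r) \<in> inversions u)"
      using z u r by (intro inversions_mult) auto
    ultimately have "conjg z r \<notin> inversions (z \<otimes> u)" using u r z by simp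
    moreover have "conjg (z \<otimes> u) s = conjg z r" using z u s by (simp add: r_def conjg_conjg)
    ultimately show ?thesis using len_right_less_iff(1)[of "z \<otimes> u" s] z u s by simp
  qed
  then have "z \<otimes> u = \<one>" using ex_descent[of "z \<otimes> u"] z u by auto
  then have "z = inv u" using inv_equality z u by simp
  then show ?thesis using inversions_inv_longest u by simp
qed

end

section \<open>Lower sets and flats\<close>

context finite_coxeter_system
begin

text \<open>The reflections of the dihedral reflection subgroup conjugate under \<open>g\<close> to the one of \<open>a\<close> and \<open>b\<close>.\<close>

definition flat :: "'a \<Rightarrow> 'a \<Rightarrow> 'a \<Rightarrow> 'a set" where
  "flat a b g = conjg g ` {alt a b n | n. odd n}"

lemma flat_iff: "t \<in> flat a b g \<longleftrightarrow> (\<exists>n. odd n \<and> t = conjg g (alt a b n))"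
  by (auto simp: flat_def)

lemma flat_subset: "\<lbrakk>a \<in> S; b \<in> S; g \<in> carrier W\<rbrakk> \<Longrightarrow> flat a b g \<subseteq> refl"
  by (auto simp: flat_iff alt_refl)

lemma flat_swap: "\<lbrakk>a \<in> S; b \<in> S\<rbrakk> \<Longrightarrow> flat b a g = flat a b g"
proof -
  assume ab: "a \<in> S" "b \<in> S"
  have "flat b a g \<subseteq> flat a b g" if "a \<in> S" "b \<in> S" for a b
  proof
    fix t assume "t \<in> flat b a g"
    then obtain n where "odd n" "t = conjg g (alt b a n)" by (auto simp: flat_iff)
    then show "t \<in> flat a b g"
      unfolding flat_iff using alt_swap[OF that] by (intro exI[of _ "-n"]) simp
  qed
  then show ?thesis using ab by blast
qed

lemma flat_alt:
  assumes "a \<in> S" "b \<in> S" "g \<in> carrier W"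
  shows "flat a b (g \<otimes> alt a b k) = flat a b g"
proof -
  have sub: "flat a b (g \<otimes> alt a b k) \<subseteq> flat a b g" if "g \<in> carrier W" for g k
  proof
    fix t assume "t \<in> flat a b (g \<otimes> alt a b k)"
    then obtain n where n: "odd n" "t = conjg (g \<otimes> alt a b k) (alt a b n)" by (auto simp: flat_iff)
    then have "t = conjg g (alt a b (if even k then 2*k + n else 2*k - n))"
      using conjg_alt(1)[OF assms(1,2), of n k] that assms by (simp flip: conjg_conjg)
    then show "t \<in> flat a b g" unfolding flat_iff using n(1) by (metis even_add even_diff even_mult_iff even_two_times_div_two odd_even_add dvd_triv_left)
  qed
  have "g = g \<otimes> alt a b k \<otimes> alt a b (if even k then -k else k)"
    using assms by (simp add: m_assoc flip: alt_inv)
  then have "flat a b g \<subseteq> flat a b (g \<otimes> alt a b k)"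
    using sub[of "g \<otimes> alt a b k" "if even k then -k else k"] assms by simp
  then show ?thesis using sub assms by blast
qed

lemma conjg_image_flat: "\<lbrakk>a \<in> S; b \<in> S; g \<in> carrier W; y \<in> carrier W\<rbrakk> \<Longrightarrow> conjg g ` flat a b y = flat a b (g \<otimes> y)"
  unfolding flat_def image_image by (rule image_cong) (auto simp: conjg_conjg)

text \<open>
  Starting from a simple reflection, \<open>chain_step\<close> moves along its reflecting hyperplane and crosses one flat
  containing it at a time; by \<open>chain_end\<close> the walk ends when all other reflections have been crossed.
\<close>

lemma chain_step:
  assumes "y \<in> carrier W" "s \<in> S" "r \<in> S" "s \<noteq> r" "is_min s r y"
  obtains y' s' where "s' \<in> S" "y' \<in> carrier W" "conjg y' s' = conjg y s" "len y < len y'" "len y' < len (y' \<otimes> s')"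
    "inversions y' = inversions y \<union> (flat s r y - {conjg y s})" "inversions y \<inter> (flat s r y - {conjg y s}) = {}"
proof -
  define m where "m = dih_ord r s"
  have m: "m \<ge> 2" using mo_ge_2[of r s] assms by (simp add: m_def)
  \<comment> \<open>The walk starts with \<open>r\<close> and stops just before the last of the
    \<open>m\<close> reflections of the flat. That last one is \<open>s\<close>, because its index
    \<open>2 * (m - 1) + 1\<close> is congruent to \<open>-1\<close> modulo
    \<open>2 * m\<close>.\<close>
  define y' where "y' = y \<otimes> alt r s (int (m - 1))"
  define s' where "s' = letter r s (int (m - 1))"
  have mi: "is_min r s y" using is_min_swap[OF assms(2,3)] assms(5) by simp
  have s': "s' \<in> S" using letter_S assms by (simp add: s'_def)
  have y': "y' \<in> carrier W" using assms by (simp add: y'_def)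
  have last: "alt r s (2 * int (m - 1) + 1) = s"
  proof -
    have e: "2 * int (m - 1) + 1 = -1 + 2 * int (dih_ord r s) * 1" using m by (simp add: m_def of_nat_diff)
    have "alt r s (2 * int (m - 1) + 1) = alt r s (-1)"
      using alt_period[OF assms(3,2), of "-1" 1] unfolding e .
    then show ?thesis using assms by simp
  qed
  have "conjg y' s' = conjg y (conjg (alt r s (int (m - 1))) s')"
    using assms s' by (simp add: y'_def conjg_conjg)
  also have "conjg (alt r s (int (m - 1))) s' = s"
    unfolding s'_def using conjg_alt(2)[OF assms(3,2)] last by simp
  finally have 1: "conjg y' s' = conjg y s" .
  have 2: "len y < len y'" using len_alt[OF assms(3,2) mi, of "int (m-1)"] m by (simp add: y'_def m_def)
  have 3: "len y' < len (y' \<otimes> s')"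
    using is_min_up[OF assms(3,2) mi, of "m-1"] m alt_letter(1)[OF assms(3,2), of "int (m-1)"] assms s'
    by (simp add: y'_def s'_def m_def m_assoc)
  have "flat s r y = flat r s y" using flat_swap[OF assms(2,3)] by simp
  also have "\<dots> = (\<lambda>i. conjg y (alt r s (2 * int i + 1))) ` {..<m}"
    unfolding flat_def alt_odds[OF assms(3,2)] image_image m_def ..
  also have "{..<m} = insert (m - 1) {..<m - 1}" using m by auto
  finally have "flat s r y = insert (conjg y s) ((\<lambda>i. conjg y (alt r s (2 * int i + 1))) ` {..<m - 1})"
    using last by simp
  moreover have "conjg y s \<notin> (\<lambda>i. conjg y (alt r s (2 * int i + 1))) ` {..<m - 1}"
  proof
    assume "conjg y s \<in> (\<lambda>i. conjg y (alt r s (2 * int i + 1))) ` {..<m - 1}"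
    then obtain i where i: "i < m - 1" "conjg y s = conjg y (alt r s (2 * int i + 1))" by auto
    then have "s = alt r s (2 * int i + 1)" using assms conjg_inv_conjg(1)[of y] by (metis S_carrier alt_closed)
    then have "alt r s (2 * int (m-1) + 1) = alt r s (2 * int i + 1)" using last by simp
    then have "int m dvd int (m - 1) - int i" unfolding m_def using alt_odd_eq_iff assms by blast
    then have "int m \<le> int (m - 1) - int i" using i by (intro zdvd_imp_le) auto
    then show False using m by linarith
  qed
  ultimately have fl: "flat s r y - {conjg y s} = (\<lambda>i. conjg y (alt r s (2 * int i + 1))) ` {..<m - 1}" by auto
  have "m - 1 \<le> dih_ord r s" by (simp add: m_def)
  note inv = inversions_coset[OF assms(3,2) mi this]
  show ?thesis
  proof (rule that[OF s' y' 1 2 3])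
    show "inversions y' = inversions y \<union> (flat s r y - {conjg y s})" unfolding fl y'_def using inv(1) .
    show "inversions y \<inter> (flat s r y - {conjg y s}) = {}" unfolding fl using inv(2) .
  qed
qed

lemma chain_end:
  assumes y: "y \<in> carrier W" "s \<in> S" "conjg y s \<in> S" "len y < len (y \<otimes> s)"
    and desc: "\<And>r. r \<in> S \<Longrightarrow> r \<noteq> s \<Longrightarrow> len (y \<otimes> r) < len y"
  shows "inversions y = refl - {conjg y s}"
proof -
  have "len (y \<otimes> s \<otimes> r) < len (y \<otimes> s)" if r: "r \<in> S" for r
  proof (cases "r = s")
    case True
    then show ?thesis using y by simp
  next
    case False
    obtain x a b k where xk: "a = s \<and> b = r \<or> a = r \<and> b = s" "is_min a b x" "y = x \<otimes> alt a b (int k)"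
        "k < dih_ord a b" "s = letter a b (int k)"
      using ascent_representative[OF y(2) r False[symmetric] y(1,4)] .
    have ab: "a \<in> S" "b \<in> S" using xk(1) y r by auto
    have x: "x \<in> carrier W" using xk is_min_carrier by simp
    have k0: "k \<noteq> 0"
    proof
      assume "k = 0"
      then have "y = x" using xk x ab by simp
      moreover have "alt a b 1 = r \<or> alt a b (-1) = r" using xk(1) ab by auto
      ultimately have "len y \<le> len (y \<otimes> r)" using xk(2) unfolding is_min_def by metis
      then show False using desc[OF r False] by simp
    qed
    have "conjg y s = conjg x (alt a b (2 * int k + 1))"
      using conjg_alt(2)[OF ab, of "int k"] xk x ab y by (simp flip: conjg_conjg)
    then have "conjg y s \<otimes> x = x \<otimes> alt a b (2 * int k + 1)"
      using x ab by (simp add: conjg_def m_assoc)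
    \<comment> \<open>As \<open>conjg y s\<close> is a generator, it raises the length of
      \<open>x\<close> by at most one. So position \<open>2*k+1\<close>, taken modulo twice the
      order, is at distance at most one from the bottom; with \<open>k\<close> nonzero this leaves
      only \<open>k + 1\<close> equal to the order, and \<open>y \<otimes> s\<close> is the top of
      its coset.\<close>
    then have le: "len (x \<otimes> alt a b (2 * int k + 1)) \<le> len x + 1"
      using len_mult_le[of "conjg y s" x] len_S[OF y(3)] x y by (metis S_carrier add.commute)
    have "k + 1 = dih_ord a b"
    proof (rule ccontr)
      assume ne: "k + 1 \<noteq> dih_ord a b"
      show False
      proof (cases "2 * int k + 1 \<le> int (dih_ord a b)")
        case True
        then show False using le k0 len_alt[OF ab xk(2), of "2 * int k + 1"] by simp
      next
        case False
        have "alt a b (2 * int k + 1) = alt a b (2 * int k + 1 - 2 * int (dih_ord a b))"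
          using alt_period[OF ab, of "2 * int k + 1" "-1"] by simp
        moreover have "\<bar>2 * int k + 1 - 2 * int (dih_ord a b)\<bar> \<le> int (dih_ord a b)" using False xk(4) by linarith
        ultimately have "nat \<bar>2 * int k + 1 - 2 * int (dih_ord a b)\<bar> \<le> 1"
          using le len_alt[OF ab xk(2), of "2 * int k + 1 - 2 * int (dih_ord a b)"] by simp
        then show False using ne xk(4) by linarith
      qed
    qed
    moreover have "y \<otimes> s = x \<otimes> alt a b (int k + 1)"
      using alt_letter(1)[OF ab, of "int k"] xk x ab y by (metis alt_closed m_assoc S_carrier)
    ultimately have ys: "y \<otimes> s = x \<otimes> alt a b (int (dih_ord a b))" by (metis of_nat_Suc Suc_eq_plus1 add.commute)
    then have l: "len (y \<otimes> s) = len x + dih_ord a b" using len_alt[OF ab xk(2), of "int (dih_ord a b)"] by simp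
    have "y \<otimes> s \<otimes> r \<in> coset2 a b x"
      using coset2_mult[OF ab x, of "y \<otimes> s"] ys xk(1) unfolding coset2_def by blast
    then have "len (y \<otimes> s \<otimes> r) \<le> len x + dih_ord a b"
      using coset2_representative[OF ab xk(2)] by (metis abs_le_iff add_left_mono le_nat_iff linorder_not_le minus_le_iff nat_int nat_mono order_less_imp_le)
    then show ?thesis using l len_mult_refl_neq[of "y \<otimes> s" r] y r by simp
  qed
  then have all: "inversions (y \<otimes> s) = refl" using longest_if_descents[of "y \<otimes> s"] y by simp
  have "t \<in> inversions y \<longleftrightarrow> t \<noteq> conjg y s" if t: "t \<in> refl" for t
  proof -
    have "t \<in> inversions (y \<otimes> s) \<longleftrightarrow> (t \<in> inversions y) \<noteq> (conjg (inv y) t \<in> inversions s)"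
      using y t by (intro inversions_mult) auto
    moreover have "conjg (inv y) t = s \<longleftrightarrow> t = conjg y s" using y t by auto
    moreover have "conjg y s \<notin> inversions y" using len_right_less_iff(2)[of y s] y by simp
    ultimately show ?thesis using all t y inversions_S by auto
  qed
  then show ?thesis using inversions_refl by blast
qed

end

locale coxeter_lower_set = finite_coxeter_system +
  fixes X :: "'a set"
  assumes XW: "X \<subseteq> carrier W"
    and Xlow: "\<lbrakk>v \<in> X; t \<in> refl; len (v \<otimes> t) < len v\<rbrakk> \<Longrightarrow> v \<otimes> t \<in> X"
begin

text \<open>
  The coset of \<open>y g^-1\<close> modulo the conjugate dihedral group is shifted by \<open>g\<close> to a coset of the standard
  dihedral group of \<open>a\<close> and \<open>b\<close>; if \<open>g\<close> is minimal, this preserves all length comparisons along reflections.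
\<close>

definition Yset :: "'a \<Rightarrow> 'a \<Rightarrow> 'a \<Rightarrow> 'a \<Rightarrow> 'a set" where
  "Yset a b g y = {z \<in> coset2 a b y. z \<otimes> inv g \<in> X}"

text \<open>The share of the reflections in \<open>A\<close> in the difference between the degrees
  of \<open>v\<close> and \<open>v \<otimes> t\<close>.\<close>

definition Q :: "'a \<Rightarrow> 'a \<Rightarrow> 'a set \<Rightarrow> int" where
  "Q v t A = int (card {r \<in> A. v \<otimes> r \<in> X}) - int (card {r \<in> A. v \<otimes> t \<otimes> r \<in> X})"

lemma X_carrier [simp]: "v \<in> X \<Longrightarrow> v \<in> carrier W"
  using XW by auto

lemma finite_refl: "finite refl"
  using fin finite_subset[of refl "carrier W"] refl_carrier by blast

lemma Yset_alt: "\<lbrakk>a \<in> S; b \<in> S; y \<in> carrier W\<rbrakk> \<Longrightarrow> Yset a b g (y \<otimes> alt a b k) = Yset a b g y"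
  by (simp add: Yset_def coset2_alt)

lemma Yset_eq:
  assumes "a \<in> S" "b \<in> S" "y \<in> carrier W" "z \<in> Yset a b g y" shows "Yset a b g z = Yset a b g y"
proof -
  obtain n where "z = y \<otimes> alt a b n" using assms by (auto simp: Yset_def coset2_def)
  then show ?thesis using Yset_alt assms by simp
qed

lemma self_coset2: "\<lbrakk>a \<in> S; b \<in> S; y \<in> carrier W\<rbrakk> \<Longrightarrow> y \<in> coset2 a b y"
  unfolding coset2_def by (rule range_eqI[of _ _ 0]) simp

text \<open>\<open>refl_coset_compare\<close> carries the downward closure of \<open>X\<close> over
  to the standard coset.\<close>

lemma Yset_lower2:
  assumes "a \<in> S" "b \<in> S" "a \<noteq> b" "is_min a b g" "y \<in> carrier W"
  obtains x where "lower2 a b x (Yset a b g y)"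
proof -
  obtain x k where xk: "is_min a b x" "y = x \<otimes> alt a b k" using ex_is_min[OF assms(1,2,5)] by metis
  have x: "x \<in> carrier W" "g \<in> carrier W" using xk assms is_min_carrier by auto
  have sub: "Yset a b g y \<subseteq> coset2 a b x" using coset2_alt[OF assms(1,2) x(1)] xk(2) by (auto simp: Yset_def)
  have "z \<otimes> alt a b n \<in> Yset a b g y"
    if z: "z \<in> Yset a b g y" "odd n" "len (z \<otimes> alt a b n) < len z" for z n
  proof -
    have zc: "z \<in> carrier W" "z \<in> coset2 a b y" "z \<otimes> inv g \<in> X"
      using z(1) coset2_closed[OF assms(1,2,5)] by (auto simp: Yset_def)
    have "z \<otimes> inv g \<otimes> g = z" using zc x by (simp add: m_assoc)
    then have "len (z \<otimes> inv g \<otimes> conjg g (alt a b n)) < len (z \<otimes> inv g)"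
      using refl_coset_compare[OF assms(1,2,4) z(2), of "z \<otimes> inv g"] z(3) zc x by simp
    then have "z \<otimes> inv g \<otimes> conjg g (alt a b n) \<in> X"
      using Xlow[OF zc(3), of "conjg g (alt a b n)"] alt_refl[OF assms(1,2) z(2)] x by simp
    moreover have "z \<otimes> inv g \<otimes> conjg g (alt a b n) = z \<otimes> alt a b n \<otimes> inv g"
      using zc x assms by (simp add: conjg_def m_assoc)
    ultimately show ?thesis using coset2_mult(3)[OF assms(1,2,5) zc(2)] by (simp add: Yset_def)
  qed
  then have "lower2 a b x (Yset a b g y)" unfolding lower2_def using assms(1-3) xk(1) sub by simp
  then show ?thesis by (rule that)
qed

text \<open>Odd alternating words reverse the sign, so after the shift by \<open>g\<close> the
  neighbours of \<open>v\<close> along the flat are the elements of opposite sign.\<close>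

lemma card_flat:
  assumes "a \<in> S" "b \<in> S" "g \<in> carrier W" "v \<in> carrier W"
  shows "card {r \<in> flat a b g. v \<otimes> r \<in> X} = card {z \<in> Yset a b g (v \<otimes> g). lsgn z \<noteq> lsgn (v \<otimes> g)}"
proof (rule bij_betw_same_card[of "\<lambda>r. v \<otimes> r \<otimes> g"], rule bij_betw_imageI)
  have rc: "r \<in> carrier W" if "r \<in> flat a b g" for r
    using flat_subset[OF assms(1-3)] that refl_carrier by (meson subsetD)
  show "inj_on (\<lambda>r. v \<otimes> r \<otimes> g) {r \<in> flat a b g. v \<otimes> r \<in> X}"
    using rc assms by (auto simp: inj_on_def)
  have eq: "v \<otimes> conjg g (alt a b n) \<otimes> g = v \<otimes> g \<otimes> alt a b n" for n
    using assms by (simp add: conjg_def m_assoc)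
  have eq2: "v \<otimes> g \<otimes> alt a b n \<otimes> inv g = v \<otimes> conjg g (alt a b n)" for n
    using assms by (simp add: conjg_def m_assoc)
  have neq: "- lsgn z \<noteq> lsgn z" for z using lsgn_cases[of z] by auto
  show "(\<lambda>r. v \<otimes> r \<otimes> g) ` {r \<in> flat a b g. v \<otimes> r \<in> X} = {z \<in> Yset a b g (v \<otimes> g). lsgn z \<noteq> lsgn (v \<otimes> g)}"
  proof (intro equalityI subsetI)
    fix z assume "z \<in> (\<lambda>r. v \<otimes> r \<otimes> g) ` {r \<in> flat a b g. v \<otimes> r \<in> X}"
    then obtain n where n: "odd n" "v \<otimes> conjg g (alt a b n) \<in> X" "z = v \<otimes> g \<otimes> alt a b n"
      using eq by (auto simp: flat_iff)
    then show "z \<in> {z \<in> Yset a b g (v \<otimes> g). lsgn z \<noteq> lsgn (v \<otimes> g)}"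
      using lsgn_alt[OF assms(1,2), of "v \<otimes> g" n] assms eq2[of n] neq by (auto simp: Yset_def coset2_def)
  next
    fix z assume z: "z \<in> {z \<in> Yset a b g (v \<otimes> g). lsgn z \<noteq> lsgn (v \<otimes> g)}"
    then obtain n where n: "z = v \<otimes> g \<otimes> alt a b n" by (auto simp: Yset_def coset2_def)
    then have "odd n" using z lsgn_alt[OF assms(1,2), of "v \<otimes> g" n] assms by (auto split: if_splits)
    moreover have "v \<otimes> conjg g (alt a b n) \<in> X" using z n eq2 by (simp add: Yset_def)
    ultimately show "z \<in> (\<lambda>r. v \<otimes> r \<otimes> g) ` {r \<in> flat a b g. v \<otimes> r \<in> X}"
      using n eq by (intro image_eqI[of _ _ "conjg g (alt a b n)"]) (auto simp: flat_iff)
  qed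
qed

lemma lsgn_sum_split:
  assumes "finite Y"
  shows "sum lsgn Y = lsgn y * (int (card {z \<in> Y. lsgn z = lsgn y}) - int (card {z \<in> Y. lsgn z \<noteq> lsgn y}))"
proof -
  let ?A = "{z \<in> Y. lsgn z = lsgn y}" and ?B = "{z \<in> Y. lsgn z \<noteq> lsgn y}"
  have "sum lsgn (?A \<union> ?B) = sum lsgn ?A + sum lsgn ?B"
    using assms by (intro sum.union_disjoint) auto
  moreover have "?A \<union> ?B = Y" by blast
  moreover have "sum lsgn ?A = (\<Sum>z\<in>?A. lsgn y)" by (rule sum.cong) auto
  moreover have "sum lsgn ?B = (\<Sum>z\<in>?B. - lsgn y)"
  proof (rule sum.cong)
    show "lsgn z = - lsgn y" if "z \<in> ?B" for z
      using lsgn_cases[of z] lsgn_cases[of y] that by auto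
  qed simp
  ultimately show ?thesis by (simp add: algebra_simps)
qed

lemma finite_Yset: "\<lbrakk>a \<in> S; b \<in> S; y \<in> carrier W\<rbrakk> \<Longrightarrow> finite (Yset a b g y)"
  by (rule finite_subset[OF _ fin]) (use coset2_closed[of a b y] in \<open>auto simp: Yset_def\<close>)

text \<open>The shifted vertices \<open>v g\<close> and \<open>v t g\<close> lie in one coset with
  opposite signs. The degree of each therefore counts the sign class of the other, and the
  difference is a signed sum.\<close>

lemma Q_flat:
  assumes "a \<in> S" "b \<in> S" "g \<in> carrier W" "v \<in> carrier W" "odd n" "t = conjg g (alt a b n)"
  shows "Q v t (flat a b g) = - lsgn (v \<otimes> g) * sum lsgn (Yset a b g (v \<otimes> g))"
proof -
  let ?Y = "Yset a b g (v \<otimes> g)"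
  have eq: "v \<otimes> t \<otimes> g = v \<otimes> g \<otimes> alt a b n"
    using assms by (simp add: conjg_def m_assoc)
  have t: "v \<otimes> t \<in> carrier W" using assms by simp
  have Y: "Yset a b g (v \<otimes> t \<otimes> g) = ?Y" using Yset_alt assms eq by simp
  have s: "lsgn (v \<otimes> t \<otimes> g) = - lsgn (v \<otimes> g)" using eq lsgn_alt[OF assms(1,2), of "v \<otimes> g" n] assms by simp
  have "card {r \<in> flat a b g. v \<otimes> t \<otimes> r \<in> X} = card {z \<in> ?Y. lsgn z \<noteq> - lsgn (v \<otimes> g)}"
    using card_flat[OF assms(1-3) t] unfolding Y s .
  also have "{z \<in> ?Y. lsgn z \<noteq> - lsgn (v \<otimes> g)} = {z \<in> ?Y. lsgn z = lsgn (v \<otimes> g)}"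
  proof (rule Collect_cong)
    show "(z \<in> ?Y \<and> lsgn z \<noteq> - lsgn (v \<otimes> g)) = (z \<in> ?Y \<and> lsgn z = lsgn (v \<otimes> g))" for z
      using lsgn_cases[of z] lsgn_cases[of "v \<otimes> g"] by auto
  qed
  finally have c2: "card {r \<in> flat a b g. v \<otimes> t \<otimes> r \<in> X} = card {z \<in> ?Y. lsgn z = lsgn (v \<otimes> g)}" .
  have "finite ?Y" using finite_Yset assms by simp
  then have "sum lsgn ?Y = lsgn (v \<otimes> g) * (int (card {z \<in> ?Y. lsgn z = lsgn (v \<otimes> g)})
      - int (card {z \<in> ?Y. lsgn z \<noteq> lsgn (v \<otimes> g)}))" by (rule lsgn_sum_split)
  then show ?thesis unfolding Q_def card_flat[OF assms(1-4)] c2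
    using lsgn_cases[of "v \<otimes> g"] by auto
qed

lemma Q_union:
  assumes "finite A" "finite B" "A \<inter> B = {}"
  shows "Q v t (A \<union> B) = Q v t A + Q v t B"
proof -
  have "card {r \<in> A \<union> B. P r} = card {r \<in> A. P r} + card {r \<in> B. P r}" for P
  proof -
    have "{r \<in> A \<union> B. P r} = {r \<in> A. P r} \<union> {r \<in> B. P r}" by auto
    then show ?thesis using assms by (simp add: card_Un_disjoint disjoint_iff)
  qed
  then show ?thesis by (simp add: Q_def)
qed

lemma Q_remove:
  assumes "finite A" "t \<in> A" "t \<in> refl" "v \<in> X" "v \<otimes> t \<in> X"
  shows "Q v t (A - {t}) = Q v t A"
proof -
  have "Q v t {t} = 0"
  proof -
    have "{r \<in> {t}. v \<otimes> r \<in> X} = {t}" "{r \<in> {t}. v \<otimes> t \<otimes> r \<in> X} = {t}" using assms by auto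
    then show ?thesis by (simp add: Q_def)
  qed
  moreover have "Q v t (A - {t} \<union> {t}) = Q v t (A - {t}) + Q v t {t}"
    using assms by (intro Q_union) auto
  moreover have "A - {t} \<union> {t} = A" using assms by auto
  ultimately show ?thesis by simp
qed

text \<open>The reflections still to be crossed after \<open>y\<close> split into flats through
  \<open>t\<close> with \<open>t\<close> removed, each of nonnegative contribution, so stopping at
  \<open>y\<close> gives a lower bound. Conjugation by \<open>g0\<close> moves a walk along the
  hyperplane of the generator \<open>s0\<close> to the one of \<open>t\<close>.\<close>

lemma Q_chain:
  assumes vt: "v \<in> X" "v \<otimes> t \<in> X" and g0: "g0 \<in> carrier W" "s0 \<in> S" "t = conjg g0 s0"
    and QF: "\<And>a b g n. \<lbrakk>a \<in> S; b \<in> S; a \<noteq> b; is_min a b g; odd n; t = conjg g (alt a b n)\<rbrakk> \<Longrightarrow> Q v t (flat a b g) \<ge> 0"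
    and y: "y \<in> carrier W" "s \<in> S" "conjg y s = s0" "len y < len (y \<otimes> s)"
  shows "Q v t (conjg g0 ` inversions y) \<le> Q v t (refl - {t})"
  using y
proof (induction "card refl - len y" arbitrary: y s rule: less_induct)
  case less
  have t: "t \<in> refl" using g0 by simp
  show ?case
  proof (cases "\<forall>r\<in>S. r \<noteq> s \<longrightarrow> len (y \<otimes> r) < len y")
    case True
    then have "inversions y = refl - {s0}" using chain_end[of y s] less g0 by auto
    moreover have "conjg g0 ` (refl - {s0}) = refl - {t}"
    proof -
      have "r \<in> conjg g0 ` (refl - {s0})" if "r \<in> refl" "r \<noteq> t" for r
        using that g0 by (intro image_eqI[of _ _ "conjg (inv g0) r"]) auto
      moreover have "conjg g0 r \<noteq> t" if "r \<in> refl" "r \<noteq> s0" for r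
        using that g0 by (metis S_carrier conjg_inv_conjg(1) refl_carrier)
      ultimately show ?thesis using g0 by auto
    qed
    ultimately show ?thesis by simp
  next
    case False
    then obtain r where r: "r \<in> S" "r \<noteq> s" "\<not> len (y \<otimes> r) < len y" by blast
    then have "len y < len (y \<otimes> r)" using len_right_not_less[of y r] less.prems by simp
    then have mi: "is_min s r y" using is_min_iff_ascents[of s r y] less.prems r by simp
    obtain y' s' where y': "s' \<in> S" "y' \<in> carrier W" "conjg y' s' = conjg y s" "len y < len y'" "len y' < len (y' \<otimes> s')"
      "inversions y' = inversions y \<union> (flat s r y - {conjg y s})" "inversions y \<inter> (flat s r y - {conjg y s}) = {}"
      using chain_step[OF less.prems(1,2) r(1) r(2)[symmetric] mi] .
    have "len y' \<le> card refl"
      using inversions_card[OF y'(2)] card_mono[OF finite_refl inversions_refl[of y']] by simp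
    then have IH: "Q v t (conjg g0 ` inversions y') \<le> Q v t (refl - {t})"
      using less.hyps[of y' s'] y' less.prems(3) by simp
    have inj: "inj_on (conjg g0) refl" using conjg_inj[OF g0(1)] by (rule inj_on_subset) auto
    have fs: "flat s r y \<subseteq> refl" using flat_subset less.prems r by simp
    have img: "conjg g0 ` (flat s r y - {conjg y s}) = flat s r (g0 \<otimes> y) - {t}"
    proof -
      have "conjg g0 ` (flat s r y - {conjg y s}) = conjg g0 ` flat s r y - conjg g0 ` {conjg y s}"
        using fs less.prems by (intro inj_on_image_set_diff[OF inj]) auto
      then show ?thesis using conjg_image_flat[of s r g0 y] less.prems r g0 by simp
    qed
    have tin: "t \<in> flat s r (g0 \<otimes> y)"
      unfolding flat_iff using less.prems r g0 by (intro exI[of _ 1]) (simp flip: conjg_conjg)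
    \<comment> \<open>The sign hypothesis concerns minimal representatives; a flat depends only on
      the coset of \<open>g0 \<otimes> y\<close>, so its minimal element can represent it.\<close>
    obtain g k where g: "is_min s r g" "g0 \<otimes> y = g \<otimes> alt s r k"
      using ex_is_min[OF less.prems(2) r(1) m_closed[OF g0(1) less.prems(1)]] by metis
    have fg: "flat s r (g0 \<otimes> y) = flat s r g"
      using flat_alt[of s r g k] g is_min_carrier less.prems r by simp
    then obtain n where "odd n" "t = conjg g (alt s r n)" using tin by (auto simp: flat_iff)
    then have "Q v t (flat s r g) \<ge> 0" using QF[of s r g n] less.prems r g by simp
    moreover have ff: "finite (flat s r (g0 \<otimes> y))"
      using flat_subset[of s r "g0 \<otimes> y"] finite_refl finite_subset less.prems r g0 by (metis m_closed)
    ultimately have nonneg: "Q v t (conjg g0 ` (flat s r y - {conjg y s})) \<ge> 0"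
      unfolding img using Q_remove[OF ff tin t vt] fg by simp
    have "conjg g0 ` inversions y' = conjg g0 ` inversions y \<union> conjg g0 ` (flat s r y - {conjg y s})"
      unfolding y'(6) image_Un ..
    moreover have "conjg g0 ` inversions y \<inter> conjg g0 ` (flat s r y - {conjg y s}) = {}"
      using y'(7) inj_on_image_Int[OF inj, of "inversions y" "flat s r y - {conjg y s}"]
        inversions_refl fs by auto
    moreover have "finite (inversions y)" using inversions_card less.prems by simp
    moreover have "finite (flat s r y)" using fs finite_refl finite_subset by blast
    ultimately have "Q v t (conjg g0 ` inversions y') =
        Q v t (conjg g0 ` inversions y) + Q v t (conjg g0 ` (flat s r y - {conjg y s}))"
      by (simp add: Q_union)
    then show ?thesis using IH nonneg by linarith
  qed
qed

end

section \<open>Regular lower sets\<close>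

context coxeter_lower_set
begin

text \<open>A longest element of \<open>X\<close> in a violating coset. That \<open>X\<close> is
  stable under neither generator is witnessed by \<open>z \<otimes> g\<close> for \<open>a\<close>
  and by \<open>y\<close> for \<open>b\<close>; the descent along \<open>b\<close> says that the
  coset has more than one element in \<open>X\<close>, and it provides the edge used for the
  contradiction.\<close>

definition bad :: "'a \<Rightarrow> bool" where
  "bad z \<longleftrightarrow> z \<in> X \<and> (\<exists>a b g y. a \<in> S \<and> b \<in> S \<and> a \<noteq> b \<and> is_min a b g \<and>
     z \<otimes> g \<otimes> a \<notin> Yset a b g (z \<otimes> g) \<and> len (z \<otimes> g \<otimes> b) < len (z \<otimes> g) \<and>
     y \<in> Yset a b g (z \<otimes> g) \<and> y \<otimes> b \<notin> Yset a b g (z \<otimes> g))"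

text \<open>The shorter element \<open>z\<close> shows that \<open>y1\<close> is not the bottom, so
  it has a descent. A descent along \<open>a\<close> would stay in the lower set, hence it is along
  \<open>b\<close>.\<close>

lemma bad_of_Yset:
  assumes ab: "a \<in> S" "b \<in> S" "a \<noteq> b" "is_min a b g" "y \<in> carrier W"
    and low: "lower2 a b x (Yset a b g y)"
    and y1: "y1 \<in> Yset a b g y" "y1 \<otimes> a \<notin> Yset a b g y"
    and y2: "y2 \<in> Yset a b g y" "y2 \<otimes> b \<notin> Yset a b g y"
    and z: "z \<in> Yset a b g y" "len z < len y1"
  shows "bad (y1 \<otimes> inv g)"
proof -
  note L = lower2D[OF low]
  have g: "g \<in> carrier W" using ab is_min_carrier by simp
  have y1c: "y1 \<in> carrier W" "y1 \<in> coset2 a b x" using y1 L(5,7) by auto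
  have zc: "z \<in> coset2 a b x" using z L(5) by auto
  have eq: "y1 \<otimes> inv g \<otimes> g = y1" using g y1c by (simp add: m_assoc)
  have Y: "Yset a b g y1 = Yset a b g y" using Yset_eq[OF ab(1,2,5) y1(1)] .
  have "len x \<le> len z" using zc L(4) by (auto simp: coset2_def is_min_def)
  then have "y1 \<noteq> x" using z(2) by auto
  then have "len (y1 \<otimes> a) < len y1 \<or> len (y1 \<otimes> b) < len y1"
    using coset2_descent[OF L(1,2,4) y1c(2)] by simp
  then have "len (y1 \<otimes> b) < len y1" using L(9)[OF y1(1)] y1(2) by blast
  moreover have "y1 \<otimes> inv g \<in> X" using y1 by (simp add: Yset_def)
  ultimately show ?thesis unfolding bad_def using ab y1 y2 eq Y by metis
qed

text \<open>A negative value requires \<open>y1\<close> to have the sign of \<open>v g\<close>. Then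
  \<open>v t g\<close> is strictly shorter than \<open>y1\<close>, so \<open>y1 g^-1\<close> is bad
  and differs from \<open>v t\<close> by a reflection; by \<open>refl_coset_compare\<close> it is
  longer than \<open>v t\<close>, against maximality.\<close>

lemma Q_flat_nonneg:
  assumes zX: "v \<in> X" "v \<otimes> t \<in> X" and max: "\<And>u. bad u \<Longrightarrow> len u \<le> len (v \<otimes> t)"
    and ab: "a \<in> S" "b \<in> S" "a \<noteq> b" "is_min a b g" "odd n" "t = conjg g (alt a b n)"
  shows "Q v t (flat a b g) \<ge> 0"
proof -
  have g: "g \<in> carrier W" using ab is_min_carrier by simp
  let ?y = "v \<otimes> g" and ?Y = "Yset a b g (v \<otimes> g)"
  have y: "?y \<in> carrier W" using zX g by simp
  have Q: "Q v t (flat a b g) = - lsgn ?y * sum lsgn ?Y"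
    using Q_flat[OF ab(1,2) g _ ab(5,6)] zX by simp
  obtain x where low: "lower2 a b x ?Y" using Yset_lower2[OF ab(1-4) y] .
  note L = lower2D[OF low]
  have yt: "v \<otimes> t \<otimes> g = ?y \<otimes> alt a b n" using zX(1) g ab by (simp add: conjg_def m_assoc)
  have "v \<otimes> t \<otimes> g \<in> coset2 a b ?y" unfolding yt coset2_def by blast
  moreover have "v \<otimes> t \<otimes> g \<otimes> inv g = v \<otimes> t" using zX(2) g by (simp add: m_assoc)
  ultimately have zY: "v \<otimes> t \<otimes> g \<in> ?Y" using zX(2) by (simp add: Yset_def)
  have sz: "lsgn (v \<otimes> t \<otimes> g) = - lsgn ?y"
    unfolding yt using lsgn_alt[OF ab(1,2) y, of n] ab(5) by simp
  consider "\<forall>z\<in>?Y. z \<otimes> a \<in> ?Y" | "\<forall>z\<in>?Y. z \<otimes> b \<in> ?Y"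
    | y1 y2 where "y1 \<in> ?Y" "y1 \<otimes> a \<notin> ?Y" "y2 \<in> ?Y" "y2 \<otimes> b \<notin> ?Y" by blast
  then show ?thesis
  proof cases
    case 1
    then show ?thesis using lsgn_sum_stable[OF L(7) ab(1)] Q by simp
  next
    case 2
    then show ?thesis using lsgn_sum_stable[OF L(7) ab(2)] Q by simp
  next
    case (3 y1 y2)
    have sum: "sum lsgn ?Y = lsgn y1" using lsgn_sum_bad[OF low 3] .
    have "lsgn y1 = - lsgn ?y"
    proof (rule ccontr)
      assume "lsgn y1 \<noteq> - lsgn ?y"
      then have ne: "lsgn (v \<otimes> t \<otimes> g) \<noteq> lsgn y1" using sz by simp
      then have "len (v \<otimes> t \<otimes> g) \<noteq> len y1" unfolding lsgn_def by metis
      then have lt: "len (v \<otimes> t \<otimes> g) < len y1" using lower2_bad(2)[OF low 3 zY] by simp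
      have "bad (y1 \<otimes> inv g)" using bad_of_Yset[OF ab(1-4) y low 3 zY lt] .
      then have le: "len (y1 \<otimes> inv g) \<le> len (v \<otimes> t)" using max by simp
      have "y1 \<in> coset2 a b (v \<otimes> t \<otimes> g)"
        using 3(1) coset2_alt[OF ab(1,2) y] unfolding yt by (simp add: Yset_def)
      then obtain k where k: "y1 = v \<otimes> t \<otimes> g \<otimes> alt a b k" by (auto simp: coset2_def)
      have c: "v \<otimes> t \<in> carrier W" "v \<otimes> t \<otimes> g \<in> carrier W" using zX g by simp_all
      have odd: "odd k" using ne lsgn_alt[OF ab(1,2) c(2), of k] k by (auto split: if_splits)
      have "y1 \<otimes> inv g = v \<otimes> t \<otimes> conjg g (alt a b k)"
        unfolding k using c(1) g ab(1,2) by (simp add: conjg_def m_assoc)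
      moreover have r: "conjg g (alt a b k) \<in> refl" using alt_refl[OF ab(1,2) odd] g by simp
      moreover have "\<not> len (v \<otimes> t \<otimes> conjg g (alt a b k)) < len (v \<otimes> t)"
        using refl_coset_compare[OF ab(1,2,4) odd c(1)] lt k by simp
      ultimately show False using le len_right_not_less[OF c(1) r] by simp
    qed
    then show ?thesis using Q sum lsgn_cases[of ?y] by auto
  qed
qed

lemma no_bad:
  assumes reg: "\<And>v. v \<in> X \<Longrightarrow> card {r \<in> refl. v \<otimes> r \<in> X} = d"
  shows "\<not> bad z"
proof
  assume "bad z"
  have finX: "finite X" using XW fin finite_subset by blast
  define B where "B = {z. bad z}"
  have "B \<subseteq> X" by (auto simp: B_def bad_def)
  then have B: "finite B" "B \<noteq> {}" using \<open>bad z\<close> finite_subset[OF _ finX, of B] by (auto simp: B_def)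
  have "Max (len ` B) \<in> len ` B" using B by (intro Max_in) auto
  then obtain z where z: "bad z" "len z = Max (len ` B)" by (auto simp: B_def)
  have max: "len u \<le> len z" if "bad u" for u unfolding z(2) using B that by (intro Max_ge) (auto simp: B_def)
  obtain a b g y2 where ab: "a \<in> S" "b \<in> S" "a \<noteq> b" "is_min a b g"
    and za: "z \<otimes> g \<otimes> a \<notin> Yset a b g (z \<otimes> g)" and zb: "len (z \<otimes> g \<otimes> b) < len (z \<otimes> g)"
    and y2: "y2 \<in> Yset a b g (z \<otimes> g)" "y2 \<otimes> b \<notin> Yset a b g (z \<otimes> g)"
    using z(1) unfolding bad_def by blast
  have zX: "z \<in> X" using z(1) by (simp add: bad_def)
  have g: "g \<in> carrier W" using ab is_min_carrier by simp
  let ?Y = "Yset a b g (z \<otimes> g)"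
  have zg: "z \<otimes> g \<in> carrier W" using zX g by simp
  obtain x where low: "lower2 a b x ?Y" using Yset_lower2[OF ab zg] .
  note L = lower2D[OF low]
  have zY: "z \<otimes> g \<in> ?Y" using self_coset2[OF ab(1,2) zg] zX g by (simp add: Yset_def m_assoc)
  define t where "t = conjg g b"
  define v where "v = z \<otimes> t"
  have t: "t \<in> refl" using ab g by (simp add: t_def)
  have vg: "v \<otimes> g = z \<otimes> g \<otimes> b" using zX g ab by (simp add: v_def t_def conjg_def m_assoc)
  have "z \<otimes> g \<otimes> b \<in> ?Y" using L(10)[OF zY zb] .
  then have "z \<otimes> g \<otimes> b \<otimes> inv g \<in> X" by (simp add: Yset_def)
  moreover have "z \<otimes> g \<otimes> b \<otimes> inv g = v" using zX g ab by (simp add: v_def t_def conjg_def m_assoc)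
  ultimately have vX: "v \<in> X" by simp
  have vt: "v \<otimes> t = z" using t zX by (simp add: v_def)
  have tb: "t = conjg g (alt a b (-1))" using ab by (simp add: t_def)
  have Yv: "Yset a b g (v \<otimes> g) = ?Y"
    using Yset_alt[OF ab(1,2) zg, of g "-1"] ab vg by simp
  have "Q v t (flat a b g) = - lsgn (v \<otimes> g) * sum lsgn (Yset a b g (v \<otimes> g))"
    using Q_flat[OF ab(1,2) g _ _ tb] vX by simp
  also have "\<dots> = lsgn (z \<otimes> g) * lsgn (z \<otimes> g)"
    unfolding Yv lsgn_sum_bad[OF low zY za y2] unfolding vg using lsgn_refl[OF zg, of b] ab by simp
  also have "\<dots> = 1" using lsgn_cases[of "z \<otimes> g"] by auto
  finally have Q1: "Q v t (flat a b g) = 1" .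
  have QF: "Q v t (flat a' b' g') \<ge> 0"
    if "a' \<in> S" "b' \<in> S" "a' \<noteq> b'" "is_min a' b' g'" "odd n" "t = conjg g' (alt a' b' n)" for a' b' g' n
    using Q_flat_nonneg[OF vX _ _ that] vt zX max by simp
  \<comment> \<open>Started at the identity, the first step of the walk uses up exactly the flat of
    contribution \<open>1\<close>; \<open>Q_chain\<close> then accounts for all other flats through
    \<open>t\<close>.\<close>
  have "is_min b a \<one>" by (simp add: is_min_def)
  then obtain y' s' where y': "s' \<in> S" "y' \<in> carrier W" "conjg y' s' = conjg \<one> b" "len \<one> < len y'" "len y' < len (y' \<otimes> s')"
      "inversions y' = inversions \<one> \<union> (flat b a \<one> - {conjg \<one> b})"
    using chain_step[OF one_closed ab(2,1) ab(3)[symmetric]] by metis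
  have "conjg g ` inversions y' = conjg g ` (flat a b \<one> - {b})"
    using y'(6) flat_swap[OF ab(1,2)] ab by simp
  also have "\<dots> = conjg g ` flat a b \<one> - conjg g ` {b}"
  proof (rule inj_on_image_set_diff)
    show "inj_on (conjg g) (carrier W)" using conjg_inj g by simp
    show "flat a b \<one> - {b} \<subseteq> carrier W" using flat_subset[OF ab(1,2), of \<one>] by auto
  qed (use ab in auto)
  also have "\<dots> = flat a b g - {t}" using conjg_image_flat[OF ab(1,2) g, of \<one>] g by (simp add: t_def)
  finally have img: "conjg g ` inversions y' = flat a b g - {t}" .
  have vtX: "v \<otimes> t \<in> X" using vt zX by simp
  have "finite (flat a b g)" using flat_subset[OF ab(1,2) g] finite_refl finite_subset by blast
  moreover have "t \<in> flat a b g" unfolding flat_iff using tb by (intro exI[of _ "-1"]) simp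
  ultimately have "Q v t (conjg g ` inversions y') = 1"
    unfolding img using Q_remove[OF _ _ t vX vtX] Q1 by simp
  moreover have "Q v t (conjg g ` inversions y') \<le> Q v t (refl - {t})"
    using Q_chain[OF vX vtX g ab(2) t_def QF y'(2,1) _ y'(5)] y'(3) ab by simp
  moreover have "Q v t (refl - {t}) = Q v t refl" using Q_remove[OF finite_refl t t vX vtX] .
  moreover have "Q v t refl = 0" unfolding Q_def using reg[OF vX] reg[OF vtX] by simp
  ultimately show False by simp
qed

text \<open>Positions \<open>0\<close> and \<open>2*k+1\<close> will be the ends of an edge, the odd
  positions between them giving neighbours of one end and the even ones neighbours of the other. The
  pairs \<open>(2i, 2i+1)\<close> match the two kinds once both ends are included, and both ends
  satisfy \<open>P\<close>; the pairs \<open>(2i+1, 2i+2)\<close> match them directly.\<close>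

lemma card_pairing:
  fixes P :: "nat \<Rightarrow> bool"
  assumes "P 0" "P (2*k+1)"
    and "(\<forall>i. P (2*i) = P (2*i+1)) \<or> (\<forall>i. P (2*i+1) = P (2*i+2))"
  shows "card {i. i < k \<and> P (2*i+1)} = card {i. i < k \<and> P (2*k - 2*i)}"
  using assms(3)
proof
  assume pair: "\<forall>i. P (2*i) = P (2*i+1)"
  have "{j. j < Suc k \<and> P (2*j)} = insert k {j. j < k \<and> P (2*j)}"
    using assms(2) pair by (auto simp: less_Suc_eq)
  then have "card {j. j < Suc k \<and> P (2*j)} = Suc (card {i. i < k \<and> P (2*i+1)})"
    using pair by simp
  moreover have "card {i. i < Suc k \<and> P (2*k - 2*i)} = card {j. j < Suc k \<and> P (2*j)}"
    by (rule bij_betw_same_card[of "\<lambda>i. k - i"], rule bij_betw_byWitness[of _ "\<lambda>i. k - i"])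
      (auto simp: diff_mult_distrib2)
  moreover have "{i. i < Suc k \<and> P (2*k - 2*i)} = insert k {i. i < k \<and> P (2*k - 2*i)}"
    using assms(1) by (auto simp: less_Suc_eq)
  then have "card {i. i < Suc k \<and> P (2*k - 2*i)} = Suc (card {i. i < k \<and> P (2*k - 2*i)})" by simp
  ultimately show ?thesis by simp
next
  assume pair: "\<forall>i. P (2*i+1) = P (2*i+2)"
  have "P (2 * (k - Suc i) + 1) = P (2*k - 2*i)" if "i < k" for i
  proof -
    have "2 * (k - Suc i) + 2 = 2*k - 2*i" using that by simp
    then show ?thesis using pair by metis
  qed
  then have "{i. i < k \<and> P (2*k - 2*i)} = {i. i < k \<and> P (2 * (k - Suc i) + 1)}" by auto
  moreover have "card {i. i < k \<and> P (2 * (k - Suc i) + 1)} = card {i. i < k \<and> P (2*i+1)}"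
    by (rule bij_betw_same_card[of "\<lambda>i. k - Suc i"], rule bij_betw_byWitness[of _ "\<lambda>i. k - Suc i"]) auto
  ultimately show ?thesis by simp
qed

text \<open>The inversions of \<open>g\<close> split into those of a minimal \<open>x\<close> and
  \<open>k\<close> reflections of a rank two flat. The first count is constant on the whole coset by
  induction; the second is handled by the pairing, since the absence of bad elements makes the coset
  stable under a generator.\<close>

lemma balance:
  assumes reg: "\<And>v. v \<in> X \<Longrightarrow> card {r \<in> refl. v \<otimes> r \<in> X} = d"
    and "g \<in> carrier W" "s \<in> S" "len g < len (g \<otimes> s)" "v \<in> X" "v \<otimes> conjg g s \<in> X"
  shows "card {r \<in> inversions g. v \<otimes> r \<in> X} = card {r \<in> inversions g. v \<otimes> conjg g s \<otimes> r \<in> X}"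
  using assms(2-)
proof (induction "len g" arbitrary: g s v rule: less_induct)
  case less
  show ?case
  proof (cases "g = \<one>")
    case False
    obtain r where r: "r \<in> S" "len (g \<otimes> r) < len g" using ex_descent less.prems(1) False by blast
    have "s \<noteq> r" using r less.prems by auto
    obtain x a b k where xk: "a = s \<and> b = r \<or> a = r \<and> b = s" "is_min a b x" "g = x \<otimes> alt a b (int k)"
        "k < dih_ord a b" "s = letter a b (int k)"
      using ascent_representative[OF less.prems(2) r(1) \<open>s \<noteq> r\<close> less.prems(1,3)] .
    have ab: "a \<in> S" "b \<in> S" "a \<noteq> b" using xk(1) less.prems r \<open>s \<noteq> r\<close> by auto
    have x: "x \<in> carrier W" using xk is_min_carrier by simp
    define t where "t = conjg g s"
    let ?v' = "v \<otimes> t"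
    have v: "v \<in> carrier W" "?v' \<in> carrier W" using less.prems unfolding t_def by auto
    have t: "t = conjg x (alt a b (2 * int k + 1))"
      using conjg_alt(2)[OF ab(1,2), of "int k"] xk x ab less.prems by (simp add: t_def flip: conjg_conjg)
    have "k \<noteq> 0"
    proof
      assume "k = 0"
      then have "g = x" using xk x ab by simp
      moreover have "alt a b 1 = r \<or> alt a b (-1) = r" using xk(1) ab by auto
      ultimately have "len g \<le> len (g \<otimes> r)" using xk(2) unfolding is_min_def by metis
      then show False using r by simp
    qed
    then have xg: "len x < len g" using len_alt[OF ab(1,2) xk(2), of "int k"] xk by simp
    let ?Y = "Yset a b x (v \<otimes> x)"
    have vx: "v \<otimes> x \<in> carrier W" using v x by simp
    obtain x1 where low: "lower2 a b x1 ?Y" using Yset_lower2[OF ab xk(2) vx] .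
    note L = lower2D[OF low]
    define h where "h u = card {r \<in> inversions x. u \<otimes> r \<in> X}" for u
    have asc: "len x < len (x \<otimes> c)" if "c = a \<or> c = b" for c
    proof -
      have "alt a b 1 = c \<or> alt a b (-1) = c" using that ab by auto
      then have "len x \<le> len (x \<otimes> c)" using xk(2) unfolding is_min_def by metis
      moreover have "c \<in> S" using that ab by auto
      ultimately show ?thesis using len_mult_refl_neq[of x c] x by (metis S_refl le_neq_implies_less)
    qed
    note IH = less.hyps
    \<comment> \<open>Every element descends inside the lower set to the bottom \<open>x1\<close>.
      Each step along a generator is covered by the outer induction, since \<open>x\<close> is
      shorter than \<open>g\<close> and ascends along both letters.\<close>
    have const: "h (z \<otimes> inv x) = h (x1 \<otimes> inv x)" if "z \<in> ?Y" for z
      using that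
    proof (induction "len z" arbitrary: z rule: less_induct)
      case (less z)
      have zc: "z \<in> coset2 a b x1" "z \<in> carrier W" "z \<otimes> inv x \<in> X"
        using less.prems L(5,7) by (auto simp: Yset_def)
      show ?case
      proof (cases "z = x1")
        case False
        then have "len (z \<otimes> a) < len z \<or> len (z \<otimes> b) < len z"
          using coset2_descent[OF L(1,2,4) zc(1)] by simp
        then obtain c where c: "c = a \<or> c = b" "len (z \<otimes> c) < len z" by blast
        have cS: "c \<in> S" using c ab by auto
        have zcY: "z \<otimes> c \<in> ?Y" using c L(9,10)[OF less.prems] by auto
        have eq: "z \<otimes> inv x \<otimes> conjg x c = z \<otimes> c \<otimes> inv x" using zc x cS by (simp add: conjg_def m_assoc)
        have "z \<otimes> inv x \<otimes> conjg x c \<in> X" unfolding eq using zcY by (simp add: Yset_def)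
        then have "h (z \<otimes> inv x) = h (z \<otimes> inv x \<otimes> conjg x c)"
          unfolding h_def using IH[of x c "z \<otimes> inv x"] xg x cS asc[OF c(1)] zc(3) by simp
        then show ?thesis using less.hyps[OF c(2) zcY] eq by simp
      qed simp
    qed
    have eqv: "u \<otimes> x \<otimes> inv x = u" if "u \<in> carrier W" for u using that x by (simp add: m_assoc)
    have v'x: "?v' \<otimes> x = v \<otimes> x \<otimes> alt a b (2 * int k + 1)"
      unfolding t using v(1) x ab by (simp add: conjg_def m_assoc)
    have vY: "v \<otimes> x \<in> ?Y" using self_coset2[OF ab(1,2) vx] eqv[OF v(1)] less.prems by (simp add: Yset_def)
    have v'Y: "?v' \<otimes> x \<in> ?Y"
      using coset2_mult(3)[OF ab(1,2) vx self_coset2[OF ab(1,2) vx]] v'x eqv[OF v(2)] less.prems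
      by (simp add: Yset_def t_def)
    have part1: "h v = h ?v'" using const[OF vY] const[OF v'Y] eqv v by simp
    define P where "P n = (v \<otimes> x \<otimes> alt a b (int n) \<in> ?Y)" for n :: nat
    have PX: "P n \<longleftrightarrow> v \<otimes> x \<otimes> alt a b (int n) \<otimes> inv x \<in> X" for n
      using coset2_mult(3)[OF ab(1,2) vx self_coset2[OF ab(1,2) vx]] by (simp add: P_def Yset_def)
    define q where "q i = conjg x (alt a b (2 * int i + 1))" for i :: nat
    have q1: "v \<otimes> q i \<in> X \<longleftrightarrow> P (2*i+1)" for i
      unfolding PX q_def using v(1) x ab by (simp add: conjg_def m_assoc add.commute)
    \<comment> \<open>From the far end, at the odd position \<open>2*k+1\<close>, the reflection
      with index \<open>2*i+1\<close> leads to the difference of the two indices.\<close>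
    have q2: "?v' \<otimes> q i \<in> X \<longleftrightarrow> P (2*k - 2*i)" if "i < k" for i
    proof -
      have "?v' \<otimes> q i = ?v' \<otimes> x \<otimes> alt a b (2 * int i + 1) \<otimes> inv x"
        unfolding q_def conjg_def using x ab m_assoc[OF v(2)] m_assoc[of "?v' \<otimes> x"] v(2)
        by (metis alt_closed inv_closed m_closed)
      also have "?v' \<otimes> x \<otimes> alt a b (2 * int i + 1) = v \<otimes> x \<otimes> alt a b (2 * int k - 2 * int i)"
        unfolding v'x using vx ab alt_mult[OF ab(1,2), of "2 * int k + 1" "2 * int i + 1"] by (simp add: m_assoc[of "v \<otimes> x"])
      also have "2 * int k - 2 * int i = int (2*k - 2*i)" using that by simp
      finally show ?thesis using PX by simp
    qed
    have inv: "inversions g = inversions x \<union> q ` {..<k}" "inversions x \<inter> q ` {..<k} = {}"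
      using inversions_coset[OF ab(1,2) xk(2), of k] xk(3,4) unfolding q_def by auto
    have q_inj: "inj_on q {..<k}"
    proof (rule inj_onI)
      fix i j assume ij: "i \<in> {..<k}" "j \<in> {..<k}" "q i = q j"
      then have "alt a b (2 * int i + 1) = alt a b (2 * int j + 1)"
        unfolding q_def using conjg_inv_conjg(1)[OF x] ab by (metis alt_closed)
      then have dv: "int (dih_ord a b) dvd int i - int j" using alt_odd_eq_iff ab by blast
      have "\<bar>int i - int j\<bar> < int (dih_ord a b)" using ij xk(4) by auto
      then show "i = j" using dv zdvd_imp_le[of "int (dih_ord a b)" "\<bar>int i - int j\<bar>"] by fastforce
    qed
    have cardq: "card {r \<in> inversions g. R r} = card {r \<in> inversions x. R r} + card {i. i < k \<and> R (q i)}" for R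
    proof -
      have "{r \<in> inversions g. R r} = {r \<in> inversions x. R r} \<union> q ` {i. i < k \<and> R (q i)}"
        unfolding inv(1) by auto
      moreover have "{r \<in> inversions x. R r} \<inter> q ` {i. i < k \<and> R (q i)} = {}" using inv(2) by auto
      moreover have "finite (inversions x)" using inversions_card x by simp
      moreover have "card (q ` {i. i < k \<and> R (q i)}) = card {i. i < k \<and> R (q i)}"
        by (rule card_image) (rule inj_on_subset[OF q_inj], auto)
      ultimately show ?thesis by (simp add: card_Un_disjoint)
    qed
    \<comment> \<open>The ends of the edge have opposite signs, so they cannot both lie on the top
      level; a violating coset would thus contain an element shorter than \<open>y1\<close>.\<close>
    have stab: "(\<forall>z\<in>?Y. z \<otimes> a \<in> ?Y) \<or> (\<forall>z\<in>?Y. z \<otimes> b \<in> ?Y)"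
    proof (rule ccontr)
      assume "\<not> ?thesis"
      then obtain y1 y2 where y12: "y1 \<in> ?Y" "y1 \<otimes> a \<notin> ?Y" "y2 \<in> ?Y" "y2 \<otimes> b \<notin> ?Y" by blast
      have "lsgn (?v' \<otimes> x) \<noteq> lsgn (v \<otimes> x)"
        unfolding v'x using lsgn_alt[OF ab(1,2) vx, of "2 * int k + 1"] lsgn_cases[of "v \<otimes> x"] by auto
      then have "len (?v' \<otimes> x) \<noteq> len (v \<otimes> x)" unfolding lsgn_def by metis
      moreover have "len (?v' \<otimes> x) \<le> len y1" "len (v \<otimes> x) \<le> len y1"
        using lower2_bad(2)[OF low y12] vY v'Y by auto
      ultimately have "len (?v' \<otimes> x) < len y1 \<or> len (v \<otimes> x) < len y1" by linarith
      then have "bad (y1 \<otimes> inv x)"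
        using bad_of_Yset[OF ab xk(2) vx low y12 vY] bad_of_Yset[OF ab xk(2) vx low y12 v'Y] by blast
      then show False using no_bad[OF reg] by blast
    qed
    have mul: "v \<otimes> x \<otimes> alt a b n \<otimes> c = v \<otimes> x \<otimes> (alt a b n \<otimes> c)" if "c \<in> S" for n c
      using vx that ab by (simp add: m_assoc[of "v \<otimes> x"])
    have "(\<forall>i. P (2*i) = P (2*i+1)) \<or> (\<forall>i. P (2*i+1) = P (2*i+2))"
      using stab
    proof
      assume st: "\<forall>z\<in>?Y. z \<otimes> a \<in> ?Y"
      have "P (2*i) = P (2*i+1)" for i
      proof -
        have "v \<otimes> x \<otimes> alt a b (int (2*i)) \<otimes> a = v \<otimes> x \<otimes> alt a b (int (2*i+1))"
          "v \<otimes> x \<otimes> alt a b (int (2*i+1)) \<otimes> a = v \<otimes> x \<otimes> alt a b (int (2*i))"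
          unfolding mul[OF ab(1)] using alt_a_b(1)[OF ab(1,2)] by (simp_all add: add.commute)
        then show ?thesis using st unfolding P_def by metis
      qed
      then show ?thesis by blast
    next
      assume st: "\<forall>z\<in>?Y. z \<otimes> b \<in> ?Y"
      have "P (2*i+1) = P (2*i+2)" for i
      proof -
        have "v \<otimes> x \<otimes> alt a b (int (2*i+1)) \<otimes> b = v \<otimes> x \<otimes> alt a b (int (2*i+2))"
          "v \<otimes> x \<otimes> alt a b (int (2*i+2)) \<otimes> b = v \<otimes> x \<otimes> alt a b (int (2*i+1))"
          unfolding mul[OF ab(2)] using alt_a_b(2)[OF ab(1,2)] by (simp_all add: add.commute)
        then show ?thesis using st unfolding P_def by metis
      qed
      then show ?thesis by blast
    qed
    moreover have "P 0" using vY vx ab by (simp add: P_def)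
    moreover have "P (2*k+1)" using v'Y v'x by (simp add: P_def add.commute)
    ultimately have "card {i. i < k \<and> P (2*i+1)} = card {i. i < k \<and> P (2*k - 2*i)}"
      using card_pairing by blast
    moreover have "{i. i < k \<and> ?v' \<otimes> q i \<in> X} = {i. i < k \<and> P (2*k - 2*i)}" using q2 by blast
    moreover have "{i. i < k \<and> v \<otimes> q i \<in> X} = {i. i < k \<and> P (2*i+1)}" using q1 by blast
    ultimately show ?thesis
      using part1 cardq[of "\<lambda>r. v \<otimes> r \<in> X"] cardq[of "\<lambda>r. ?v' \<otimes> r \<in> X"]
      unfolding h_def t_def by simp
  qed simp
qed

end

section \<open>The Hecke algebra and the \<open>R\<close>-polynomials\<close>

context finite_coxeter_system
begin

abbreviation qv :: "int poly" where "qv \<equiv> [:0, 1:]"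

text \<open>
  With \<open>f\<close> read as the Hecke algebra element \<open>\<Sum>v. f v * T_v\<close>, these are right and left
  multiplication by \<open>T_t\<close>. As usual, associativity reduces to the fact that they commute.
\<close>

definition hecke_r :: "'a \<Rightarrow> ('a \<Rightarrow> int poly) \<Rightarrow> 'a \<Rightarrow> int poly" where
  "hecke_r t f v = (if v \<in> carrier W then
     (if len (v \<otimes> t) < len v then f (v \<otimes> t) + (qv - 1) * f v else qv * f (v \<otimes> t)) else 0)"

definition hecke_l :: "'a \<Rightarrow> ('a \<Rightarrow> int poly) \<Rightarrow> 'a \<Rightarrow> int poly" where
  "hecke_l t f v = (if v \<in> carrier W then
     (if len (t \<otimes> v) < len v then f (t \<otimes> v) + (qv - 1) * f v else qv * f (t \<otimes> v)) else 0)"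

definition delta :: "'a \<Rightarrow> 'a \<Rightarrow> int poly" where "delta x v = (if v = x then 1 else 0)"

lemma hecke_l_hecke_r_eq:
  assumes "v \<in> carrier W" "s \<in> S" "t \<in> S" "s \<otimes> v = v \<otimes> t"
  shows "hecke_l s f v = hecke_r t f v"
  using assms by (simp add: hecke_l_def hecke_r_def)

text \<open>If \<open>s v = v t\<close>, the two operators coincide at \<open>v\<close> and at
  \<open>v t\<close>. Otherwise multiplication on one side does not affect whether the letter on the
  other side is a descent, and both expansions have the same terms.\<close>

lemma hecke_l_hecke_r_comm:
  assumes "s \<in> S" "t \<in> S"
  shows "hecke_l s (hecke_r t f) = hecke_r t (hecke_l s f)"
proof
  fix v
  show "hecke_l s (hecke_r t f) v = hecke_r t (hecke_l s f) v"
  proof (cases "v \<in> carrier W")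
    case False
    then show ?thesis by (simp add: hecke_l_def hecke_r_def)
  next
    case v: True
    show ?thesis
    proof (cases "s \<otimes> v = v \<otimes> t")
      case True
      then have "s \<otimes> (v \<otimes> t) = v \<otimes> t \<otimes> t" using assms v by (simp flip: m_assoc)
      then have "hecke_l s f (v \<otimes> t) = hecke_r t f (v \<otimes> t)" "hecke_l s f v = hecke_r t f v"
        using hecke_l_hecke_r_eq[of "v \<otimes> t" s t f] hecke_l_hecke_r_eq[of v s t f] True assms v by simp_all
      then have "hecke_r t (hecke_l s f) v = hecke_r t (hecke_r t f) v" by (simp add: hecke_r_def[of t _ v])
      then show ?thesis using hecke_l_hecke_r_eq[of v s t "hecke_r t f"] True assms v by simp
    next
      case False
      have ne: "s \<noteq> conjg v t" using False assms v by (auto simp: conjg_def m_assoc)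
      have "s \<in> inversions (v \<otimes> t) \<longleftrightarrow> (s \<in> inversions v) \<noteq> (conjg (inv v) s \<in> inversions t)"
        using assms v by (intro inversions_mult) auto
      moreover have "conjg (inv v) s \<noteq> t" using ne assms v by auto
      ultimately have l: "len (s \<otimes> (v \<otimes> t)) < len (v \<otimes> t) \<longleftrightarrow> len (s \<otimes> v) < len v"
        using len_left_less_iff(1)[of "v \<otimes> t" s] len_left_less_iff(1)[of v s] inversions_S assms v by simp
      have "conjg (s \<otimes> v) t \<in> inversions (s \<otimes> v) \<longleftrightarrow>
          (conjg (s \<otimes> v) t \<in> inversions s) \<noteq> (conjg (inv s) (conjg (s \<otimes> v) t) \<in> inversions v)"
        using assms v by (intro inversions_mult) auto
      moreover have "conjg (inv s) (conjg (s \<otimes> v) t) = conjg v t"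
        using assms v conjg_inv_conjg(1)[of s "conjg v t"] by (simp add: conjg_conjg)
      moreover have "conjg (s \<otimes> v) t \<noteq> s"
      proof
        assume "conjg (s \<otimes> v) t = s"
        then have "conjg (inv s) (conjg (s \<otimes> v) t) = conjg (inv s) s" by simp
        then have "conjg v t = conjg (inv s) s" using \<open>conjg (inv s) (conjg (s \<otimes> v) t) = conjg v t\<close> by simp
        then show False using ne assms by (simp add: conjg_def)
      qed
      ultimately have r: "len (s \<otimes> v \<otimes> t) < len (s \<otimes> v) \<longleftrightarrow> len (v \<otimes> t) < len v"
        using len_right_less_iff(1)[of "s \<otimes> v" t] len_right_less_iff(1)[of v t] inversions_S assms v by simp
      have a: "s \<otimes> v \<otimes> t = s \<otimes> (v \<otimes> t)" using assms v by (simp add: m_assoc)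
      show ?thesis
        using l r[unfolded a] a assms v by (simp add: hecke_l_def hecke_r_def algebra_simps)
    qed
  qed
qed

lemma hecke_l_fold_hecke_r:
  assumes "s \<in> S" "set ts \<subseteq> S"
  shows "fold hecke_r ts (hecke_l s f) = hecke_l s (fold hecke_r ts f)"
  using assms(2)
proof (induction ts arbitrary: f)
  case (Cons t ts)
  have "fold hecke_r (t # ts) (hecke_l s f) = fold hecke_r ts (hecke_l s (hecke_r t f))"
    using hecke_l_hecke_r_comm[OF assms(1), of t f] Cons.prems by simp
  then show ?case using Cons by simp
qed simp

lemma hecke_r_delta:
  assumes "x \<in> carrier W" "s \<in> S" "len x < len (x \<otimes> s)"
  shows "hecke_r s (delta x) = delta (x \<otimes> s)"
proof
  fix v
  have eq: "v \<otimes> s = x \<longleftrightarrow> v = x \<otimes> s" if "v \<in> carrier W" using that assms by auto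
  show "hecke_r s (delta x) v = delta (x \<otimes> s) v"
    using assms eq by (auto simp: hecke_r_def delta_def)
qed

lemma hecke_l_delta:
  assumes "x \<in> carrier W" "s \<in> S" "len x < len (s \<otimes> x)"
  shows "hecke_l s (delta x) = delta (s \<otimes> x)"
proof
  fix v
  have eq: "s \<otimes> v = x \<longleftrightarrow> v = s \<otimes> x" if "v \<in> carrier W" using that assms by auto
  show "hecke_l s (delta x) v = delta (s \<otimes> x) v"
    using assms eq by (auto simp: hecke_l_def delta_def)
qed

lemma reduced_snoc:
  assumes "set (ts @ [s]) \<subseteq> S" "len (wprod (ts @ [s])) = length (ts @ [s])"
  shows "len (wprod ts) = length ts" "len (wprod ts) < len (wprod ts \<otimes> s)" "wprod (ts @ [s]) = wprod ts \<otimes> s"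
proof -
  show e: "wprod (ts @ [s]) = wprod ts \<otimes> s" using assms(1) by (simp add: wprod_append)
  have "len (wprod ts \<otimes> s) \<le> len (wprod ts) + 1"
    using len_mult_le[of "wprod ts" s] len_S[of s] assms(1) by simp
  moreover have "len (wprod ts) \<le> length ts" using len_le[of ts] assms(1) by simp
  ultimately show "len (wprod ts) = length ts" "len (wprod ts) < len (wprod ts \<otimes> s)"
    using assms(2) e by simp_all
qed

lemma fold_hecke_r_delta_one:
  "\<lbrakk>set ts \<subseteq> S; len (wprod ts) = length ts\<rbrakk> \<Longrightarrow> fold hecke_r ts (delta \<one>) = delta (wprod ts)"
proof (induction ts rule: rev_induct)
  case (snoc s ts)
  note r = reduced_snoc[OF snoc.prems]
  have "fold hecke_r (ts @ [s]) (delta \<one>) = hecke_r s (delta (wprod ts))" using snoc r by simp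
  also have "\<dots> = delta (wprod ts \<otimes> s)" using snoc.prems r by (intro hecke_r_delta) auto
  finally show ?case using r by simp
qed simp

lemma left_descent:
  assumes "v \<in> carrier W" "v \<noteq> \<one>"
  obtains c v' where "c \<in> S" "v' \<in> carrier W" "v = c \<otimes> v'" "len v' < len v"
proof -
  have "inv v \<noteq> \<one>" using assms by (metis inv_inv inv_one)
  then obtain c where c: "c \<in> S" "len (inv v \<otimes> c) < len (inv v)"
    using ex_descent[of "inv v"] assms by auto
  have "inv (inv v \<otimes> c) = c \<otimes> v" using c assms by (simp add: inv_mult_group)
  then have "len (c \<otimes> v) < len v" using c(2) len_inv[of "inv v \<otimes> c"] len_inv[of v] assms c(1) by simp
  then show ?thesis using that[of c "c \<otimes> v"] c assms by simp
qed

text \<open>With \<open>t = z^-1 s z\<close> one has \<open>s z = z t\<close>, a descent on either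
  side, so both products are \<open>q T_(s z) + (q - 1) T_z\<close>.\<close>

lemma longest_delta:
  assumes z: "z \<in> carrier W" "inversions z = refl" and s: "s \<in> S"
  shows "hecke_l s (delta z) = hecke_r (conjg (inv z) s) (delta z)"
proof
  fix u
  let ?t = "conjg (inv z) s"
  have t: "?t \<in> S" using conjg_longest_S[of "inv z" s] inversions_inv_longest[OF z] z s by simp
  have zt: "z \<otimes> ?t = s \<otimes> z" using z s by (simp add: conjg_def m_assoc)
  have d: "len (s \<otimes> z) < len z" using len_left_less_iff(1)[of z s] z s by simp
  show "hecke_l s (delta z) u = hecke_r ?t (delta z) u"
  proof (cases "u \<in> carrier W")
    case u: True
    have e1: "s \<otimes> u = z \<longleftrightarrow> u = s \<otimes> z" using u z s by auto
    have e2: "u \<otimes> ?t = z \<longleftrightarrow> u = s \<otimes> z" using u z t zt by (metis S_refl mult_refl_cancel)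
    have "s \<otimes> z \<noteq> z" using d by auto
    then show ?thesis
      using e1 e2 d zt u z s t e2[unfolded m_assoc]
      by (auto simp: hecke_l_def hecke_r_def delta_def)
  qed (simp add: hecke_l_def hecke_r_def)
qed

text \<open>The relation \<open>T_s T_w0 = T_w0 T_t\<close>, multiplied from the left by
  \<open>T_v\<close>. The element \<open>v\<close> is built up by left multiplications, which
  commute with all right ones, so the case of the identity suffices.\<close>

lemma fold_hecke_r_longest_comm:
  assumes z: "inversions (wprod ts) = refl" and ts: "set ts \<subseteq> S" "len (wprod ts) = length ts"
    and s: "s \<in> S" and v: "v \<in> carrier W"
  shows "fold hecke_r ts (hecke_r s (delta v)) = hecke_r (conjg (inv (wprod ts)) s) (fold hecke_r ts (delta v))"
  using v
proof (induction "len v" arbitrary: v rule: less_induct)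
  case less
  let ?z = "wprod ts"
  let ?t = "conjg (inv ?z) s"
  have zc: "?z \<in> carrier W" using ts by simp
  have t: "?t \<in> S" using conjg_longest_S[of "inv ?z" s] inversions_inv_longest[OF zc z] zc s by simp
  show ?case
  proof (cases "v = \<one>")
    case True
    have "hecke_r s (delta \<one>) = delta s" "hecke_l s (delta \<one>) = delta s"
      using hecke_r_delta[of \<one> s] hecke_l_delta[of \<one> s] s by (simp_all add: len_S)
    then have "fold hecke_r ts (hecke_r s (delta \<one>)) = fold hecke_r ts (hecke_l s (delta \<one>))" by simp
    also have "\<dots> = hecke_l s (delta ?z)" using hecke_l_fold_hecke_r[OF s ts(1)] fold_hecke_r_delta_one[OF ts] by simp
    also have "\<dots> = hecke_r ?t (delta ?z)" using longest_delta[OF zc z s] .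
    finally show ?thesis using True fold_hecke_r_delta_one[OF ts] by simp
  next
    case False
    obtain c v' where c: "c \<in> S" "v' \<in> carrier W" "v = c \<otimes> v'" "len v' < len v"
      using left_descent[OF less.prems False] .
    have d: "delta v = hecke_l c (delta v')" using hecke_l_delta[of v' c] c by simp
    have "fold hecke_r ts (hecke_r s (delta v)) = hecke_l c (fold hecke_r ts (hecke_r s (delta v')))"
      unfolding d by (simp add: hecke_l_hecke_r_comm[OF c(1) s, symmetric] hecke_l_fold_hecke_r[OF c(1) ts(1)])
    also have "\<dots> = hecke_l c (hecke_r ?t (fold hecke_r ts (delta v')))" using less.hyps[OF c(4,2)] by simp
    also have "\<dots> = hecke_r ?t (fold hecke_r ts (delta v))"
      unfolding d by (simp add: hecke_l_hecke_r_comm[OF c(1) t] hecke_l_fold_hecke_r[OF c(1) ts(1)])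
    finally show ?thesis .
  qed
qed

section \<open>The R-polynomials from products with the longest element\<close>

definition wlong :: "'a list" where
  "wlong = (SOME ts. set ts \<subseteq> S \<and> len (wprod ts) = length ts \<and> inversions (wprod ts) = refl)"

lemma wlong: "set wlong \<subseteq> S" "len (wprod wlong) = length wlong" "inversions (wprod wlong) = refl"
    "wprod wlong \<in> carrier W"
proof -
  obtain z where z: "z \<in> carrier W" "inversions z = refl" using ex_longest by blast
  then obtain ts where "set ts \<subseteq> S" "wprod ts = z" "length ts = len z" using ex_reduced by metis
  then have "\<exists>ts. set ts \<subseteq> S \<and> len (wprod ts) = length ts \<and> inversions (wprod ts) = refl" using z by metis
  from someI_ex[OF this] show "set wlong \<subseteq> S" "len (wprod wlong) = length wlong" "inversions (wprod wlong) = refl"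
    unfolding wlong_def by blast+
  then show "wprod wlong \<in> carrier W" by simp
qed

text \<open>
  The coefficient of \<open>T_(u w0)\<close> in \<open>T_v T_w0\<close>, which equals \<open>q^len u\<close> times the \<open>R\<close>-polynomial
  of \<open>u\<close> and \<open>v\<close>.
\<close>

definition Rcoef :: "'a \<Rightarrow> 'a \<Rightarrow> int poly" where
  "Rcoef u v = fold hecke_r wlong (delta v) (u \<otimes> wprod wlong)"

lemma Rcoef_one: "u \<in> carrier W \<Longrightarrow> Rcoef u \<one> = (if u = \<one> then 1 else 0)"
  using fold_hecke_r_delta_one[OF wlong(1,2)] wlong(4)
  by (auto simp: Rcoef_def delta_def)

text \<open>Write \<open>T_v = T_(v s) T_s\<close> and move \<open>T_s\<close> past
  \<open>T_w0\<close>, where it becomes \<open>T_t\<close> with \<open>u w0 t = u s w0\<close>.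
  Right multiplication by \<open>w0\<close> reverses length comparisons, which exchanges the two
  cases.\<close>

lemma Rcoef_rec:
  assumes "u \<in> carrier W" "v \<in> carrier W" "s \<in> S" "len (v \<otimes> s) < len v"
  shows "Rcoef u v = (if len (u \<otimes> s) < len u then qv * Rcoef (u \<otimes> s) (v \<otimes> s)
           else Rcoef (u \<otimes> s) (v \<otimes> s) + (qv - 1) * Rcoef u (v \<otimes> s))"
proof -
  let ?z = "wprod wlong"
  let ?t = "conjg (inv ?z) s"
  have vs: "v \<otimes> s \<in> carrier W" using assms by simp
  have "delta v = hecke_r s (delta (v \<otimes> s))" using hecke_r_delta[of "v \<otimes> s" s] assms by simp
  then have P: "fold hecke_r wlong (delta v) = hecke_r ?t (fold hecke_r wlong (delta (v \<otimes> s)))"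
    using fold_hecke_r_longest_comm[OF wlong(3,1,2) assms(3) vs] by simp
  have uz: "u \<otimes> ?z \<otimes> ?t = u \<otimes> s \<otimes> ?z" using assms wlong(4) by (simp add: conjg_def m_assoc)
  have t: "?t \<in> refl" using assms(3) wlong(4) by simp
  have "conjg (u \<otimes> ?z) ?t = conjg u s" using assms wlong(4) by (simp flip: conjg_conjg)
  moreover have "conjg u s \<in> inversions (u \<otimes> ?z) \<longleftrightarrow> (conjg u s \<in> inversions u) \<noteq> (conjg (inv u) (conjg u s) \<in> inversions ?z)"
    using assms wlong(4) by (intro inversions_mult) auto
  ultimately have "len (u \<otimes> s \<otimes> ?z) < len (u \<otimes> ?z) \<longleftrightarrow> \<not> len (u \<otimes> s) < len u"
    using len_right_less_iff(1)[of "u \<otimes> ?z" ?t] len_right_less_iff(1)[of u s] t uz wlong(3,4) assms by simp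
  then show ?thesis
    unfolding Rcoef_def P hecke_r_def[of ?t] uz using assms(1) wlong(4) by simp
qed

lemma Rcoef_dvd: "\<lbrakk>u \<in> carrier W; v \<in> carrier W\<rbrakk> \<Longrightarrow> qv ^ len u dvd Rcoef u v"
proof (induction "len v" arbitrary: u v rule: less_induct)
  case less
  show ?case
  proof (cases "v = \<one>")
    case True
    then show ?thesis using Rcoef_one less.prems by simp
  next
    case False
    obtain s where s: "s \<in> S" "len (v \<otimes> s) < len v" using ex_descent less.prems False by blast
    have 1: "qv ^ len (u \<otimes> s) dvd Rcoef (u \<otimes> s) (v \<otimes> s)" "qv ^ len u dvd Rcoef u (v \<otimes> s)"
      using less.hyps[of "v \<otimes> s"] s less.prems by simp_all
    show ?thesis
    proof (cases "len (u \<otimes> s) < len u")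
      case True
      have "qv ^ len u = qv * qv ^ len (u \<otimes> s)" using len_down[of u s] True s less.prems by simp
      then show ?thesis using Rcoef_rec[OF less.prems s] True mult_dvd_mono[OF dvd_refl[of qv] 1(1)] by simp
    next
      case False
      then have "len (u \<otimes> s) = len u + 1"
        using len_up[of u s] len_right_not_less[of u s] s less.prems by simp
      then have "qv ^ len u dvd qv ^ len (u \<otimes> s)" by (intro le_imp_power_dvd) simp
      then have "qv ^ len u dvd Rcoef (u \<otimes> s) (v \<otimes> s)" using 1(1) dvd_trans by blast
      then show ?thesis using Rcoef_rec[OF less.prems s] False 1(2) by (simp add: dvd_add dvd_mult)
    qed
  qed
qed

text \<open>The division is exact by \<open>Rcoef_dvd\<close>; the value zero outside the carrier is
  forced by the first clause of \<open>is_R_family\<close>.\<close>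

definition Rfam :: "'a \<Rightarrow> 'a \<Rightarrow> int poly" where
  "Rfam u v = (if u \<in> carrier W \<and> v \<in> carrier W then Rcoef u v div qv ^ len u else 0)"

lemma Rcoef_Rfam: "\<lbrakk>u \<in> carrier W; v \<in> carrier W\<rbrakk> \<Longrightarrow> Rcoef u v = qv ^ len u * Rfam u v"
  using Rcoef_dvd by (simp add: Rfam_def)

lemma Rfam_rec:
  assumes "u \<in> carrier W" "v \<in> carrier W" "s \<in> S" "len (v \<otimes> s) < len v"
  shows "Rfam u v = (if len (u \<otimes> s) < len u then Rfam (u \<otimes> s) (v \<otimes> s)
           else (qv - 1) * Rfam u (v \<otimes> s) + qv * Rfam (u \<otimes> s) (v \<otimes> s))"
proof -
  have "qv ^ len u * Rfam u v = qv ^ len u * (if len (u \<otimes> s) < len u then Rfam (u \<otimes> s) (v \<otimes> s)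
           else (qv - 1) * Rfam u (v \<otimes> s) + qv * Rfam (u \<otimes> s) (v \<otimes> s))"
  proof (cases "len (u \<otimes> s) < len u")
    case True
    then have e: "qv ^ len u = qv * qv ^ len (u \<otimes> s)" using len_down[of u s] assms by simp
    have "qv ^ len u * Rfam u v = qv * (qv ^ len (u \<otimes> s) * Rfam (u \<otimes> s) (v \<otimes> s))"
      using Rcoef_rec[OF assms] True assms by (simp add: Rcoef_Rfam)
    also have "\<dots> = qv ^ len u * Rfam (u \<otimes> s) (v \<otimes> s)" unfolding e by (simp only: mult.assoc)
    finally show ?thesis using True by simp
  next
    case False
    then have "len (u \<otimes> s) = len u + 1"
      using len_up[of u s] len_right_not_less[of u s] assms by simp
    then have e: "qv ^ len (u \<otimes> s) = qv ^ len u * qv" by (simp only: power_add power_one_right)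
    have "qv ^ len u * Rfam u v = qv ^ len (u \<otimes> s) * Rfam (u \<otimes> s) (v \<otimes> s) + (qv - 1) * (qv ^ len u * Rfam u (v \<otimes> s))"
      using Rcoef_rec[OF assms] False assms by (simp add: Rcoef_Rfam)
    then show ?thesis using False unfolding e by (simp only: if_False distrib_left mult_ac add_ac)
  qed
  then show ?thesis by (subst (asm) mult_left_cancel) auto
qed

section \<open>Bruhat order, support and uniqueness of the R-polynomials\<close>

lemma bruhat_refl: "x \<in> carrier W \<Longrightarrow> bruhat_le W S x x"
  by (simp add: bruhat_le_def)

lemma bruhat_trans: "\<lbrakk>bruhat_le W S x y; bruhat_le W S y z\<rbrakk> \<Longrightarrow> bruhat_le W S x z"
  by (auto simp: bruhat_le_def)

lemma bruhat_step_le: "bruhat_step W S x y \<Longrightarrow> bruhat_le W S x y"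
  by (auto simp: bruhat_le_def bruhat_step_def)

lemma bruhat_carrier: "bruhat_le W S x y \<Longrightarrow> x \<in> carrier W \<and> y \<in> carrier W"
  by (simp add: bruhat_le_def)

lemma bruhat_refl_step: "\<lbrakk>x \<in> carrier W; t \<in> refl; len x < len (x \<otimes> t)\<rbrakk> \<Longrightarrow> bruhat_le W S x (x \<otimes> t)"
  by (rule bruhat_step_le) (auto simp: bruhat_step_def)

lemma bruhat_len: "bruhat_le W S x y \<Longrightarrow> x = y \<or> len x < len y"
proof -
  assume "bruhat_le W S x y"
  then have "(bruhat_step W S)\<^sup>*\<^sup>* x y" by (simp add: bruhat_le_def)
  then show ?thesis by induction (auto simp: bruhat_step_def)
qed

text \<open>For \<open>t\<close> different from \<open>s\<close>, the reflection
  \<open>s t s\<close> joins \<open>x s\<close> to \<open>y s\<close>, and the cocycle rule shows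
  that it still points upwards.\<close>

lemma bruhat_step_mult:
  assumes "bruhat_step W S x y" "s \<in> S"
  shows "y = x \<otimes> s \<or> bruhat_step W S (x \<otimes> s) (y \<otimes> s)"
proof -
  obtain t where t: "t \<in> refl" "y = x \<otimes> t" "len x < len y" and c: "x \<in> carrier W" "y \<in> carrier W"
    using assms by (auto simp: bruhat_step_def)
  show ?thesis
  proof (cases "t = s")
    case False
    let ?r = "conjg s t"
    have r: "?r \<in> refl" using t assms by simp
    have xr: "x \<otimes> s \<otimes> ?r = y \<otimes> s" using t c assms by (auto simp: conjg_def m_assoc)
    have "conjg (x \<otimes> s) ?r \<in> inversions (x \<otimes> s) \<longleftrightarrow>
        (conjg (x \<otimes> s) ?r \<in> inversions x) \<noteq> (conjg (inv x) (conjg (x \<otimes> s) ?r) \<in> inversions s)"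
      using c assms r by (intro inversions_mult) auto
    moreover have e: "conjg (x \<otimes> s) ?r = conjg x t" using c t assms by (simp add: conjg_conjg m_assoc)
    moreover have "conjg x t \<notin> inversions x" using len_right_less_iff(2)[of x t] t c by simp
    ultimately have "conjg (x \<otimes> s) ?r \<notin> inversions (x \<otimes> s)"
      using False c t assms by (simp add: inversions_S)
    then have "len (x \<otimes> s) < len (y \<otimes> s)"
      using len_right_less_iff(2)[of "x \<otimes> s" ?r] r xr c assms by simp
    then show ?thesis using r xr[symmetric] c assms unfolding bruhat_step_def by (metis S_carrier m_closed)
  qed (use t in simp)
qed

lemma bruhat_lift:
  assumes "bruhat_le W S x y" "s \<in> S"
  shows "bruhat_le W S (x \<otimes> s) y \<or> bruhat_le W S (x \<otimes> s) (y \<otimes> s)"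
proof -
  have "(bruhat_step W S)\<^sup>*\<^sup>* x y" "x \<in> carrier W" using assms by (auto simp: bruhat_le_def)
  then show ?thesis
  proof induction
    case base
    then show ?case using bruhat_refl[of "x \<otimes> s"] assms(2) by simp
  next
    case (step y z)
    then consider "bruhat_le W S (x \<otimes> s) y" | "bruhat_le W S (x \<otimes> s) (y \<otimes> s)" by auto
    then show ?case
    proof cases
      case 1
      then show ?thesis using bruhat_trans bruhat_step_le[OF step(2)] by blast
    next
      case 2
      then show ?thesis using bruhat_trans bruhat_step_le bruhat_step_mult[OF step(2) assms(2)] by blast
    qed
  qed
qed

text \<open>A nonzero term of the recursion puts \<open>u s\<close> or \<open>u\<close> below
  \<open>v s\<close>; lifting along \<open>s\<close> turns the first case into a relation between
  \<open>u\<close> and \<open>v\<close>.\<close>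

lemma Rfam_support: "Rfam u v \<noteq> 0 \<Longrightarrow> bruhat_le W S u v"
proof (induction "len v" arbitrary: u v rule: less_induct)
  case less
  have c: "u \<in> carrier W" "v \<in> carrier W" using less.prems by (auto simp: Rfam_def split: if_splits)
  show ?case
  proof (cases "v = \<one>")
    case True
    then have "u = \<one>" using less.prems c Rcoef_one[OF c(1)] by (auto simp: Rfam_def split: if_splits)
    then show ?thesis using True bruhat_refl by simp
  next
    case False
    obtain s where s: "s \<in> S" "len (v \<otimes> s) < len v" using ex_descent c False by blast
    have up: "bruhat_le W S (v \<otimes> s) v" using bruhat_refl_step[of "v \<otimes> s" s] s c by simp
    have vs: "v \<otimes> s \<in> carrier W" using s c by simp
    consider "Rfam (u \<otimes> s) (v \<otimes> s) \<noteq> 0" | "Rfam u (v \<otimes> s) \<noteq> 0"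
      using less.prems Rfam_rec[OF c s] by (metis add_0 mult_zero_right)
    then show ?thesis
    proof cases
      case 1
      then have "bruhat_le W S (u \<otimes> s) (v \<otimes> s)" using less.hyps s by simp
      then have "bruhat_le W S (u \<otimes> s \<otimes> s) (v \<otimes> s) \<or> bruhat_le W S (u \<otimes> s \<otimes> s) (v \<otimes> s \<otimes> s)"
        using bruhat_lift s by blast
      then show ?thesis using up bruhat_trans s c by auto
    next
      case 2
      then show ?thesis using less.hyps s up bruhat_trans by blast
    qed
  qed
qed

lemma Rfam_self: "u \<in> carrier W \<Longrightarrow> Rfam u u = 1"
proof (induction "len u" arbitrary: u rule: less_induct)
  case less
  show ?case
  proof (cases "u = \<one>")
    case True
    then show ?thesis using Rcoef_one[of \<one>] by (simp add: Rfam_def)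
  next
    case False
    then obtain s where s: "s \<in> S" "len (u \<otimes> s) < len u" using ex_descent less.prems by blast
    then show ?thesis using Rfam_rec[OF less.prems less.prems s] less by simp
  qed
qed

lemma Rfam_is_R_family: "is_R_family W S Rfam"
  unfolding is_R_family_def using Rfam_support Rfam_self Rfam_rec
  by (auto simp: not_less[symmetric])

lemma is_R_family_unique:
  assumes R: "is_R_family W S R" and R': "is_R_family W S R'"
  shows "R u v = R' u v"
proof (induction "len v" arbitrary: u v rule: less_induct)
  case less
  show ?case
  proof (cases "bruhat_le W S u v")
    case False
    then show ?thesis using R R' by (simp add: is_R_family_def)
  next
    case le: True
    then have c: "u \<in> carrier W" "v \<in> carrier W" using bruhat_carrier by auto
    show ?thesis
    proof (cases "v = \<one>")
      case True
      then have "u = \<one>" using bruhat_len[OF le] by simp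
      then show ?thesis using True R R' by (simp add: is_R_family_def)
    next
      case False
      then obtain s where s: "s \<in> S" "len (v \<otimes> s) < len v" using ex_descent c by blast
      have IH: "R u (v \<otimes> s) = R' u (v \<otimes> s)" "R (u \<otimes> s) (v \<otimes> s) = R' (u \<otimes> s) (v \<otimes> s)"
        using less s by auto
      consider "len (u \<otimes> s) < len u" | "len u < len (u \<otimes> s)"
        using len_right_not_less[of u s] c s by auto
      then show ?thesis using R R' IH c s unfolding is_R_family_def by cases metis+
    qed
  qed
qed

lemma R_poly_eq: "R_poly W S = Rfam"
  unfolding R_poly_def using Rfam_is_R_family is_R_family_unique by (intro the_equality) blast+

lemma hecke_r_sum: "hecke_r s (\<lambda>v. \<Sum>x\<in>A. f x v) = (\<lambda>v. \<Sum>x\<in>A. hecke_r s (f x) v)"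
  by (rule ext) (simp add: hecke_r_def sum.distrib sum_distrib_left)

lemma fold_hecke_r_sum: "fold hecke_r ts (\<lambda>v. \<Sum>x\<in>A. f x v) = (\<lambda>v. \<Sum>x\<in>A. fold hecke_r ts (f x) v)"
  by (induction ts arbitrary: f) (simp_all add: hecke_r_sum)

end

section \<open>The sum over a regular lower set in the Hecke algebra\<close>

context coxeter_lower_set
begin

lemma fold_hecke_r_indicator:
  assumes reg: "\<And>v. v \<in> X \<Longrightarrow> card {r \<in> refl. v \<otimes> r \<in> X} = d"
    and "set ts \<subseteq> S" "len (wprod ts) = length ts" "v \<in> carrier W"
  shows "fold hecke_r ts (\<lambda>u. if u \<in> X then 1 else 0) (v \<otimes> wprod ts)
    = (if v \<in> X then qv ^ card {r \<in> inversions (wprod ts). v \<otimes> r \<in> X} else 0)"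
  using assms(2-)
proof (induction ts arbitrary: v rule: rev_induct)
  case (snoc s ts)
  define g where "g = wprod ts"
  define F where "F = fold hecke_r ts (\<lambda>u. if u \<in> X then 1 else 0)"
  note red = reduced_snoc[OF snoc.prems(1,2)]
  have g: "g \<in> carrier W" "s \<in> S" "len g < len (g \<otimes> s)" "wprod (ts @ [s]) = g \<otimes> s"
    using red snoc.prems by (auto simp: g_def)
  define t where "t = conjg g s"
  have t: "t \<in> refl" using g by (simp add: t_def)
  have v: "v \<in> carrier W" using snoc.prems by simp
  define h where "h u = card {r \<in> inversions g. u \<otimes> r \<in> X}" for u
  have IH: "F (u \<otimes> g) = (if u \<in> X then qv ^ h u else 0)" if "u \<in> carrier W" for u
    using snoc.IH[OF _ red(1) that] snoc.prems by (simp add: F_def g_def h_def)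
  have tg: "t \<notin> inversions g" using len_right_less_iff(2)[of g s] g by (simp add: t_def)
  have inv: "inversions (g \<otimes> s) = insert t (inversions g)"
  proof -
    have "r \<in> inversions (g \<otimes> s) \<longleftrightarrow> r = t \<or> r \<in> inversions g" if r: "r \<in> refl" for r
    proof -
      have "r \<in> inversions (g \<otimes> s) \<longleftrightarrow> (r \<in> inversions g) \<noteq> (conjg (inv g) r \<in> inversions s)"
        using g r by (intro inversions_mult) auto
      moreover have "conjg (inv g) r = s \<longleftrightarrow> r = t" using g r unfolding t_def by auto
      ultimately show ?thesis using tg g inversions_S by auto
    qed
    then show ?thesis using inversions_refl[of "g \<otimes> s"] inversions_refl[of g] t by blast
  qed
  have h': "card {r \<in> inversions (g \<otimes> s). v \<otimes> r \<in> X} = (if v \<otimes> t \<in> X then h v + 1 else h v)"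
  proof -
    have "{r \<in> inversions (g \<otimes> s). v \<otimes> r \<in> X} =
        (if v \<otimes> t \<in> X then insert t {r \<in> inversions g. v \<otimes> r \<in> X} else {r \<in> inversions g. v \<otimes> r \<in> X})"
      unfolding inv by auto
    moreover have "finite (inversions g)" using inversions_card g by simp
    ultimately show ?thesis using tg by (simp add: h_def)
  qed
  have vgs: "v \<otimes> (g \<otimes> s) = v \<otimes> t \<otimes> g" "v \<otimes> (g \<otimes> s) \<otimes> s = v \<otimes> g"
    using v g by (simp_all add: t_def conjg_def m_assoc)
  \<comment> \<open>Since \<open>t\<close> is not an inversion of \<open>g\<close>, right
    translation by \<open>g\<close> preserves the comparison of \<open>v\<close> with
    \<open>v t\<close>.\<close>
  have cmp: "len (v \<otimes> g) < len (v \<otimes> (g \<otimes> s)) \<longleftrightarrow> len v < len (v \<otimes> t)"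
  proof -
    have "conjg (v \<otimes> g) s \<in> inversions (v \<otimes> g) \<longleftrightarrow>
        (conjg (v \<otimes> g) s \<in> inversions v) \<noteq> (conjg (inv v) (conjg (v \<otimes> g) s) \<in> inversions g)"
      using v g by (intro inversions_mult) auto
    moreover have "conjg (v \<otimes> g) s = conjg v t" using v g by (simp add: t_def conjg_conjg)
    ultimately show ?thesis
      using len_right_less_iff(2)[of "v \<otimes> g" s] len_right_less_iff(2)[of v t] v g t tg by (simp add: m_assoc)
  qed
  have "fold hecke_r (ts @ [s]) (\<lambda>u. if u \<in> X then 1 else 0) (v \<otimes> wprod (ts @ [s])) = hecke_r s F (v \<otimes> (g \<otimes> s))"
    using g by (simp add: F_def)
  also have "\<dots> = (if len v < len (v \<otimes> t) then F (v \<otimes> g) + (qv - 1) * F (v \<otimes> t \<otimes> g) else qv * F (v \<otimes> g))"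
    unfolding hecke_r_def vgs(2) cmp unfolding vgs(1) using v g t by simp
  also have "\<dots> = (if v \<in> X then qv ^ (if v \<otimes> t \<in> X then h v + 1 else h v) else 0)"
  proof (cases "len v < len (v \<otimes> t)")
    case up: True
    show ?thesis
    proof (cases "v \<otimes> t \<in> X")
      case True
      then have vX: "v \<in> X" using Xlow[OF True t] up v t by simp
      \<comment> \<open>Equality of the exponents merges \<open>q^h + (q - 1) q^h\<close> into
        \<open>q^(h+1)\<close>; the added unit is the new inversion \<open>t\<close>.\<close>
      have "h v = h (v \<otimes> t)"
        unfolding h_def t_def using balance[OF reg g(1-3) vX] True by (simp add: t_def)
      then have "F (v \<otimes> g) + (qv - 1) * F (v \<otimes> t \<otimes> g) = qv ^ h v + (qv - 1) * qv ^ h v"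
        using IH[OF v] IH[of "v \<otimes> t"] v t vX True by simp
      also have "\<dots> = qv ^ (h v + 1)" by (simp only: power_add power_one_right left_diff_distrib mult_1_left
          mult.commute add_diff_cancel_left' diff_add_eq_diff_diff_swap add.commute diff_add_cancel)
      finally show ?thesis using up True vX by simp
    next
      case False
      then show ?thesis using up IH[OF v] IH[of "v \<otimes> t"] v t by simp
    qed
  next
    case False
    then have "v \<in> X \<Longrightarrow> v \<otimes> t \<in> X" using Xlow[OF _ t] len_right_not_less[OF v t] by blast
    then show ?thesis using False IH[OF v] by simp
  qed
  finally show ?case unfolding g(4) h' .
qed (simp)

text \<open>This reads off the coefficient of \<open>T_w0\<close>. For \<open>u = \<one>\<close> the
  factor \<open>q^len u\<close> is \<open>1\<close>, so \<open>Rcoef\<close> is the R-polynomial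
  itself, and the inversions of \<open>w0\<close> are all reflections, so the exponent is the full
  degree.\<close>

lemma sum_R_poly:
  assumes reg: "\<And>v. v \<in> X \<Longrightarrow> card {r \<in> refl. v \<otimes> r \<in> X} = d" and one: "\<one> \<in> X"
  shows "(\<Sum>v\<in>X. R_poly W S \<one> v) = qv ^ d"
proof -
  have finX: "finite X" using XW fin finite_subset by blast
  have ind: "(\<lambda>u. if u \<in> X then 1 else 0) = (\<lambda>u. \<Sum>x\<in>X. delta x u)"
    using finX by (auto simp: delta_def fun_eq_iff sum.delta')
  have "(\<Sum>v\<in>X. R_poly W S \<one> v) = (\<Sum>v\<in>X. Rcoef \<one> v)"
    unfolding R_poly_eq by (rule sum.cong) (simp_all add: Rcoef_Rfam)
  also have "\<dots> = fold hecke_r wlong (\<lambda>u. if u \<in> X then 1 else 0) (\<one> \<otimes> wprod wlong)"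
    unfolding ind fold_hecke_r_sum Rcoef_def ..
  also have "\<dots> = qv ^ card {r \<in> inversions (wprod wlong). \<one> \<otimes> r \<in> X}"
    using fold_hecke_r_indicator[OF reg wlong(1,2) one_closed] one by simp
  also have "card {r \<in> inversions (wprod wlong). \<one> \<otimes> r \<in> X} = d"
    unfolding wlong(3) using reg[OF one] .
  finally show ?thesis .
qed

end

section \<open>Bruhat intervals, vertex degrees and the average\<close>

lemma pcompose_power_left: "pcompose (p ^ n) r = pcompose p r ^ n" for p r :: "'c :: comm_ring_1 poly"
  by (induction n) (simp_all add: pcompose_mult pcompose_1)

context finite_coxeter_system
begin

lemma bruhat_one_le: "v \<in> carrier W \<Longrightarrow> bruhat_le W S \<one> v"
proof (induction "len v" arbitrary: v rule: less_induct)
  case less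
  show ?case
  proof (cases "v = \<one>")
    case False
    then obtain s where s: "s \<in> S" "len (v \<otimes> s) < len v" using ex_descent less.prems by blast
    then have "bruhat_le W S (v \<otimes> s) v" using bruhat_refl_step[of "v \<otimes> s" s] less.prems by simp
    moreover have "bruhat_le W S \<one> (v \<otimes> s)" using less s by simp
    ultimately show ?thesis using bruhat_trans by blast
  qed (simp add: bruhat_refl)
qed

lemma bruhat_interval_one: "bruhat_interval W S \<one> w = {v. bruhat_le W S v w}"
  using bruhat_one_le bruhat_carrier by (auto simp: bruhat_interval_def)

lemma coxeter_lower_set_bruhat: "coxeter_lower_set W S {v. bruhat_le W S v w}"
proof unfold_locales
  show "{v. bruhat_le W S v w} \<subseteq> carrier W" using bruhat_carrier by auto
  fix v t assume v: "v \<in> {v. bruhat_le W S v w}" "t \<in> refl" "len (v \<otimes> t) < len v"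
  then have "bruhat_le W S (v \<otimes> t) v"
    using bruhat_refl_step[of "v \<otimes> t" t] bruhat_carrier by (simp add: m_assoc)
  then show "v \<otimes> t \<in> {v. bruhat_le W S v w}" using v bruhat_trans by blast
qed

lemma graph_degree_eq:
  assumes "v \<in> X" "X \<subseteq> carrier W"
  shows "graph_degree (induced_edges (bruhat_graph_edges W S) X) v = card {t \<in> refl. v \<otimes> t \<in> X}"
  unfolding graph_degree_def
proof (rule bij_betw_same_card[symmetric, of "\<lambda>t. {v, v \<otimes> t}"], rule bij_betw_imageI)
  have v: "v \<in> carrier W" using assms by auto
  show "inj_on (\<lambda>t. {v, v \<otimes> t}) {t \<in> refl. v \<otimes> t \<in> X}"
  proof (rule inj_onI)
    fix t r assume tr: "t \<in> {t \<in> refl. v \<otimes> t \<in> X}" "r \<in> {t \<in> refl. v \<otimes> t \<in> X}" "{v, v \<otimes> t} = {v, v \<otimes> r}"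
    then have "v \<otimes> t = v \<otimes> r" by (metis doubleton_eq_iff)
    then show "t = r" using tr v by simp
  qed
  show "(\<lambda>t. {v, v \<otimes> t}) ` {t \<in> refl. v \<otimes> t \<in> X} = {e \<in> induced_edges (bruhat_graph_edges W S) X. v \<in> e}"
  proof (intro equalityI subsetI)
    fix e assume "e \<in> (\<lambda>t. {v, v \<otimes> t}) ` {t \<in> refl. v \<otimes> t \<in> X}"
    then obtain t where t: "t \<in> refl" "v \<otimes> t \<in> X" "e = {v, v \<otimes> t}" by blast
    then have "e \<in> bruhat_graph_edges W S"
      unfolding bruhat_graph_edges_def using v refl_carrier m_closed by blast
    then show "e \<in> {e \<in> induced_edges (bruhat_graph_edges W S) X. v \<in> e}"
      using t assms by (simp add: induced_edges_def)
  next
    fix e assume e: "e \<in> {e \<in> induced_edges (bruhat_graph_edges W S) X. v \<in> e}"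
    then obtain x y t where xy: "e = {x, y}" "x \<in> carrier W" "y \<in> carrier W" "t \<in> refl" "y = x \<otimes> t"
      by (auto simp: induced_edges_def bruhat_graph_edges_def)
    have "x = y \<otimes> t" using xy by simp
    then have "e = {v, v \<otimes> t}" using e xy by auto
    then show "e \<in> (\<lambda>t. {v, v \<otimes> t}) ` {t \<in> refl. v \<otimes> t \<in> X}"
      using e xy by (auto simp: induced_edges_def)
  qed
qed

lemma card_right_descents:
  assumes "w \<in> carrier W"
  shows "card {t \<in> refl. len (w \<otimes> t) < len w} = len w"
proof -
  have "card {t \<in> refl. len (w \<otimes> t) < len w} = card (inversions w)"
  proof (rule bij_betw_same_card[of "conjg w"], rule bij_betw_imageI)
    show "inj_on (conjg w) {t \<in> refl. len (w \<otimes> t) < len w}"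
      using conjg_inj[OF assms] by (rule inj_on_subset) auto
    show "conjg w ` {t \<in> refl. len (w \<otimes> t) < len w} = inversions w"
    proof (intro equalityI subsetI)
      fix r assume r: "r \<in> inversions w"
      then have "r \<in> refl" using inversions_refl by blast
      then show "r \<in> conjg w ` {t \<in> refl. len (w \<otimes> t) < len w}"
        using r assms len_right_less_iff(1)[OF assms, of "conjg (inv w) r"]
        by (intro image_eqI[of _ _ "conjg (inv w) r"]) auto
    qed (use len_right_less_iff(1)[OF assms] in auto)
  qed
  then show ?thesis using inversions_card[OF assms] by simp
qed

lemma bruhat_poincare_regular:
  assumes w: "w \<in> carrier W" and reg: "regular_lower_interval W S w"
  shows "bruhat_poincare W S w = [:1, 1:] ^ len w"
proof -
  define X where "X = {v. bruhat_le W S v w}"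
  interpret coxeter_lower_set W S X unfolding X_def by (rule coxeter_lower_set_bruhat)
  have wX: "w \<in> X" using w bruhat_refl by (simp add: X_def)
  obtain d where "\<forall>v\<in>X. graph_degree (induced_edges (bruhat_graph_edges W S) X) v = d"
    using reg unfolding regular_lower_interval_def regular_graph_def bruhat_interval_one Let_def X_def by blast
  then have d: "card {r \<in> refl. v \<otimes> r \<in> X} = d" if "v \<in> X" for v
    using graph_degree_eq[OF that XW] that by simp
  \<comment> \<open>Among the elements joined to \<open>w\<close> by a reflection exactly the
    shorter ones lie below \<open>w\<close>; this identifies the common degree with the
    length.\<close>
  have "{r \<in> refl. w \<otimes> r \<in> X} = {r \<in> refl. len (w \<otimes> r) < len w}"
  proof (rule Collect_cong)
    fix r
    have "w \<otimes> r \<in> X \<longleftrightarrow> len (w \<otimes> r) < len w" if "r \<in> refl"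
      using that Xlow[OF wX that] bruhat_len[of "w \<otimes> r" w] len_mult_refl_neq[OF w that] by (auto simp: X_def)
    then show "(r \<in> refl \<and> w \<otimes> r \<in> X) = (r \<in> refl \<and> len (w \<otimes> r) < len w)" by blast
  qed
  then have "d = len w" using d[OF wX] card_right_descents[OF w] by simp
  then have "(\<Sum>v\<in>X. R_poly W S \<one> v) = qv ^ len w"
    using sum_R_poly[OF d] bruhat_one_le[OF w] by (simp add: X_def)
  then have "pcompose (\<Sum>v\<in>X. R_poly W S \<one> v) [:1, 1:] = [:1, 1:] ^ len w"
    by (simp add: pcompose_power_left pcompose_pCons)
  then show ?thesis by (simp add: bruhat_poincare_def pcompose_sum X_def)
qed

end

lemma poly_average_power: "poly_average ([:1, 1:] ^ n) = real n / 2"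
proof (cases n)
  case (Suc m)
  have "poly (pderiv ([:1, 1:] ^ n)) 1 = int n * 2 ^ m"
    unfolding Suc pderiv_power_Suc by (simp add: poly_power pderiv_pCons algebra_simps)
  then show ?thesis by (simp add: poly_average_def poly_power Suc field_simps)
qed (simp add: poly_average_def)

theorem theorem2:
  fixes W :: "('a, 'b) monoid_scheme" and S :: "'a set" and w :: 'a
  assumes "coxeter_system W S"
    and "finite (carrier W)"
    and "w \<in> carrier W"
    and "poly_average (bruhat_poincare W S w) \<noteq> real (cox_length W S w) / 2"
  shows "irregular_lower_interval W S w"
proof
  assume reg: "regular_lower_interval W S w"
  interpret coxeter_system W S by fact
  interpret finite_coxeter_system W S by unfold_locales fact
  have "bruhat_poincare W S w = [:1, 1:] ^ cox_length W S w"
    using bruhat_poincare_regular assms(3) reg by blast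
  then show False using assms(4) poly_average_power by simp
qed

end
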